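(* Let $w\in S_n$ be a vexillary permutation. Then the homogenized Grothendieck polynomial $\widetilde{\mathfrak G}_w$ has M-convex support. In particular, each homogeneous component $\mathfrak G_w^{(k)}$ of $\mathfrak G_w$ has M-convex support.
   Context: The support of a polynomial is the set of exponent vectors of monomials with nonzero coefficient. Permutations $w\in S_n$ are written in one-line notation; $ws_j$ is $w$ with the values in positions $j,j+1$ swapped; $w_0$ is the longest permutation; $\ell(w)$ is the number of inversions. $w$ is vexillary if there are no $i<j<k<\ell$ with $w(j)<w(i)<w(\ell)<w(k)$. On $\mathbb Z[x_1,\dots,x_n]$ put $\partial_j(f)=\frac{f-s_j\cdot f}{x_j-x_{j+1}}$ ($s_j$ swaps $x_j,x_{j+1}$) and $\overline\partial_j(f)=\partial_j(f-x_{j+1}f)$. The Grothendieck polynomial is defined recursively by $\mathfrak G_{w_0}=x_1^{n-1}x_2^{n-2}\cdots x_{n-1}$ and $\mathfrak G_w=\overline\partial_j\mathfrak G_{ws_j}$ if $w(j)<w(j+1)$. Let $\mathfrak G_w^{(k)}$ denote the degree-$k$ homogeneous component of $\mathfrak G_w$. The homogenized Grothendieck polynomial is $$\widetilde{\mathfrak G}_w(x_1,\dots,x_n,z)=\sum_{k=\ell(w)}^{\deg(\mathfrak G_w)}\mathfrak G_w^{(k)}(x_1,\dots,x_n)\,z^{\deg(\mathfrak G_w)-k}.$$ A set $S\subseteq\mathbb Z^N$ is M-convex if for any $x,y\in S$ and any $i\in[N]$ with $x_i>y_i$ there is $j\in[N]$ with $x_j<y_j$, $x-e_i+e_j\in S$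 and $y-e_j+e_i\in S$. *)

theory Defs
  imports "HOL-Library.Poly_Mapping" "HOL-Combinatorics.Permutations"
begin

section \<open>Polynomials\<close>

text \<open>
  Polynomials over the integers in variables indexed by natural numbers, as finitely supported
  functions from exponent vectors to coefficients. The variable \<open>x\<^sub>i\<close> (for \<open>i \<ge> 1\<close>) has
  index \<open>i\<close>; index \<open>0\<close> is reserved for the homogenizing variable \<open>z\<close>.
\<close>

type_synonym monom = "nat \<Rightarrow>\<^sub>0 nat"
type_synonym mpoly = "monom \<Rightarrow>\<^sub>0 int"

definition X :: "nat \<Rightarrow> mpoly" where
  "X i = Poly_Mapping.single (Poly_Mapping.single i 1) 1"

definition mdeg :: "monom \<Rightarrow> nat" where
  "mdeg m = (\<Sum>i\<in>Poly_Mapping.keys m. Poly_Mapping.lookup m i)"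

definition total_degree :: "mpoly \<Rightarrow> nat" where
  "total_degree f = Max (insert 0 (mdeg ` Poly_Mapping.keys f))"

definition hom_component :: "nat \<Rightarrow> mpoly \<Rightarrow> mpoly" where
  "hom_component k f =
     (\<Sum>m\<in>{m \<in> Poly_Mapping.keys f. mdeg m = k}. Poly_Mapping.single m (Poly_Mapping.lookup f m))"

definition support :: "mpoly \<Rightarrow> (nat \<Rightarrow> int) set" where
  "support f = (\<lambda>m i. int (Poly_Mapping.lookup m i)) ` Poly_Mapping.keys f"


section \<open>M-convexity\<close>

text \<open>A point of \<open>\<int>\<^sup>I\<close> is a function on the naturals that vanishes outside \<open>I\<close>.\<close>

definition unit_vec :: "nat \<Rightarrow> nat \<Rightarrow> int" where
  "unit_vec i = (\<lambda>l. if l = i then 1 else 0)"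

definition M_convex :: "nat set \<Rightarrow> (nat \<Rightarrow> int) set \<Rightarrow> bool" where
  "M_convex I S \<longleftrightarrow>
     S \<subseteq> {x. \<forall>i. i \<notin> I \<longrightarrow> x i = 0} \<and>
     (\<forall>x\<in>S. \<forall>y\<in>S. \<forall>i\<in>I. x i > y i \<longrightarrow>
       (\<exists>j\<in>I. x j < y j \<and>
          (\<lambda>l. x l - unit_vec i l + unit_vec j l) \<in> S \<and>
          (\<lambda>l. y l - unit_vec j l + unit_vec i l) \<in> S))"


section \<open>Permutations\<close>

text \<open>Elements of \<open>S\<^sub>n\<close> are functions \<open>w\<close> with \<open>w permutes {1..n}\<close>.\<close>

definition vexillary :: "nat \<Rightarrow> (nat \<Rightarrow> nat) \<Rightarrow> bool" where
  "vexillary n w \<longleftrightarrow>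
     \<not> (\<exists>i j k l. 1 \<le> i \<and> i < j \<and> j < k \<and> k < l \<and> l \<le> n \<and>
          w j < w i \<and> w i < w l \<and> w l < w k)"

definition inv_count :: "nat \<Rightarrow> (nat \<Rightarrow> nat) \<Rightarrow> nat" where
  "inv_count n w = card {(i, j). 1 \<le> i \<and> i < j \<and> j \<le> n \<and> w j < w i}"

definition longest :: "nat \<Rightarrow> nat \<Rightarrow> nat" where
  "longest n i = (if i \<in> {1..n} then n + 1 - i else i)"

text \<open>The permutation \<open>ws\<^sub>j\<close>: the values in positions \<open>j\<close> and \<open>j + 1\<close> are swapped.\<close>

definition swap_pos :: "nat \<Rightarrow> (nat \<Rightarrow> nat) \<Rightarrow> nat \<Rightarrow> nat" where
  "swap_pos j w = w \<circ> transpose j (j + 1)"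


section \<open>Grothendieck polynomials\<close>

text \<open>
  The action of \<open>s\<^sub>j\<close> on polynomials. As \<open>transpose j (j + 1)\<close> is an involution, pulling back
  along it is the same as pushing forward.
\<close>

definition swap_vars :: "nat \<Rightarrow> mpoly \<Rightarrow> mpoly" where
  "swap_vars j f = Poly_Mapping.map_key (Poly_Mapping.map_key (transpose j (j + 1))) f"

definition div_diff :: "nat \<Rightarrow> mpoly \<Rightarrow> mpoly" where
  "div_diff j f = (THE g. (X j - X (j + 1)) * g = f - swap_vars j f)"

definition iso_div_diff :: "nat \<Rightarrow> mpoly \<Rightarrow> mpoly" where
  "iso_div_diff j f = div_diff j (f - X (j + 1) * f)"

text \<open>
  The recursion may descend along any ascent of \<open>w\<close>, so it is first stated as a relation;
  \<open>is_grothendieck_ex1\<close> below shows that the relation is functional.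
\<close>

inductive is_grothendieck :: "nat \<Rightarrow> (nat \<Rightarrow> nat) \<Rightarrow> mpoly \<Rightarrow> bool" for n where
  longest: "is_grothendieck n (longest n) (\<Prod>i=1..n. X i ^ (n - i))"
| step: "is_grothendieck n w (iso_div_diff j f)"
    if "w permutes {1..n}" "1 \<le> j" "j < n" "w j < w (j + 1)" "is_grothendieck n (swap_pos j w) f"

definition grothendieck :: "nat \<Rightarrow> (nat \<Rightarrow> nat) \<Rightarrow> mpoly" where
  "grothendieck n w = (THE f. is_grothendieck n w f)"

definition hom_grothendieck :: "nat \<Rightarrow> (nat \<Rightarrow> nat) \<Rightarrow> mpoly" where
  "hom_grothendieck n w =
     (let G = grothendieck n w; d = total_degree G
      in \<Sum>k=inv_count n w..d. hom_component k G * X 0 ^ (d - k))"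


section \<open>Well-definedness\<close>

lemma map_key_transpose_invol:
  "Poly_Mapping.map_key (transpose i j) (Poly_Mapping.map_key (transpose i j) m) = m"
  by (simp add: map_key_compose map_key_id[unfolded id_def[symmetric]])

lemma inj_map_key_transpose: "inj (Poly_Mapping.map_key (transpose i j) :: monom \<Rightarrow> monom)"
  by (rule inj_on_inverseI) (rule map_key_transpose_invol)

lemma lookup_swap_vars:
  "Poly_Mapping.lookup (swap_vars j f) m =
   Poly_Mapping.lookup f (Poly_Mapping.map_key (transpose j (j + 1)) m)"
  by (simp add: swap_vars_def map_key.rep_eq inj_map_key_transpose)

lemma swap_vars_invol [simp]: "swap_vars j (swap_vars j f) = f"
  by (rule poly_mapping_eqI) (simp add: lookup_swap_vars map_key_transpose_invol)

lemma swap_vars_0 [simp]: "swap_vars j 0 = 0"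
  by (rule poly_mapping_eqI) (simp add: lookup_swap_vars)

lemma swap_vars_add: "swap_vars j (f + g) = swap_vars j f + swap_vars j g"
  by (rule poly_mapping_eqI) (simp add: lookup_swap_vars lookup_add)

lemma swap_vars_diff: "swap_vars j (f - g) = swap_vars j f - swap_vars j g"
  by (rule poly_mapping_eqI) (simp add: lookup_swap_vars lookup_minus)

lemma swap_vars_single:
  "swap_vars j (Poly_Mapping.single m c) =
   Poly_Mapping.single (Poly_Mapping.map_key (transpose j (j + 1)) m) c"
  by (rule poly_mapping_eqI)
    (metis lookup_single_eq lookup_single_not_eq lookup_swap_vars map_key_transpose_invol)

lemma swap_vars_1 [simp]: "swap_vars j 1 = 1"
  by (simp flip: single_one add: swap_vars_single map_key_zero)

lemma swap_vars_mult_single: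
  "swap_vars j (Poly_Mapping.single a c * Poly_Mapping.single b d) =
   swap_vars j (Poly_Mapping.single a c) * swap_vars j (Poly_Mapping.single b d)"
  by (simp add: swap_vars_single mult_single map_key_plus)

lemma swap_vars_mult: "swap_vars j (f * g) = swap_vars j f * swap_vars j g"
proof -
  have 1: "swap_vars j (Poly_Mapping.single a 1 * g) = swap_vars j (Poly_Mapping.single a 1) * swap_vars j g"
    for a
    using subset_UNIV[of "Poly_Mapping.keys g"]
    by (induction g rule: frag_induction)
      (simp_all add: swap_vars_mult_single swap_vars_diff right_diff_distrib)
  show ?thesis
    using subset_UNIV[of "Poly_Mapping.keys f"]
    by (induction f rule: frag_induction) (simp_all add: 1 swap_vars_diff left_diff_distrib)
qed

lemma swap_vars_X: "swap_vars j (X i) = X (transpose j (j + 1) i)"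
proof -
  have "Poly_Mapping.map_key (transpose j (j + 1)) (Poly_Mapping.single i (1::nat)) =
        Poly_Mapping.single (transpose j (j + 1) i) 1"
    using map_key_single[of "transpose j (j + 1)" "transpose j (j + 1) i" "1::nat"] by simp
  then show ?thesis by (simp add: X_def swap_vars_single)
qed

lemma X_inject [simp]: "X i = X j \<longleftrightarrow> i = j"
proof
  assume "X i = X j"
  then have "Poly_Mapping.keys (X i) = Poly_Mapping.keys (X j)" by simp
  then have "Poly_Mapping.single i (1::nat) = Poly_Mapping.single j 1" by (simp add: X_def)
  then have "Poly_Mapping.keys (Poly_Mapping.single i (1::nat)) = Poly_Mapping.keys (Poly_Mapping.single j (1::nat))"
    by simp
  then show "i = j" by simp
qed simp

lemma monom_times_X: "Poly_Mapping.single (Poly_Mapping.single k v) (1::int) = X k ^ v"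
proof (induction v)
  case 0
  then show ?case by simp
next
  case (Suc v)
  have "Poly_Mapping.single (Poly_Mapping.single k (Suc v)) (1::int) =
        Poly_Mapping.single (Poly_Mapping.single k 1) 1 * Poly_Mapping.single (Poly_Mapping.single k v) 1"
    by (simp add: mult_single flip: single_add)
  then show ?case using Suc by (simp add: X_def)
qed

lemma div_diff_dvd: "(X j - X (j + 1)) dvd f - swap_vars j f"
proof -
  let ?P = "\<lambda>f. (X j - X (j + 1)) dvd f - swap_vars j f"
  have mult: "?P (f * g)" if "?P f" "?P g" for f g
  proof -
    have "f * g - swap_vars j (f * g) =
          f * (g - swap_vars j g) + swap_vars j g * (f - swap_vars j f)"
      by (simp add: swap_vars_mult algebra_simps)
    then show ?thesis using that by (metis dvd_add dvd_mult)
  qed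
  have var: "?P (X i)" for i
  proof -
    consider "i = j" | "i = j + 1" | "i \<noteq> j" "i \<noteq> j + 1" by blast
    then show ?thesis
    proof cases
      case 2
      then show ?thesis
        by (simp add: swap_vars_X) (metis dvd_minus_iff dvd_refl minus_diff_eq)
    qed (simp_all add: swap_vars_X)
  qed
  have pow: "?P (X i ^ v)" for i v
    by (induction v) (simp_all add: mult[simplified] var[simplified])
  have mono: "?P (Poly_Mapping.single m 1)" for m
  proof (induction m rule: update_induct)
    case const
    then show ?case by simp
  next
    case (update p a b)
    have "Poly_Mapping.update a b p = p + Poly_Mapping.single a b"
      using update(1)
      by (intro poly_mapping_eqI)
        (auto simp: lookup_update lookup_add lookup_single when_def in_keys_iff)
    then have "Poly_Mapping.single (Poly_Mapping.update a b p) (1::int) =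
      Poly_Mapping.single p 1 * X a ^ b"
      by (simp add: mult_single flip: monom_times_X)
    then show ?case using mult[OF update.IH pow] by simp
  qed
  show ?thesis
    using subset_UNIV[of "Poly_Mapping.keys f"]
  proof (induction f rule: frag_induction)
    case (diff a b)
    have "a - b - swap_vars j (a - b) = (a - swap_vars j a) - (b - swap_vars j b)"
      by (simp add: swap_vars_diff)
    then show ?case using diff by (metis dvd_diff)
  qed (simp_all add: mono[simplified])
qed

lemma div_diff_eq: "(X j - X (j + 1)) * div_diff j f = f - swap_vars j f"
proof -
  obtain g where g: "(X j - X (j + 1)) * g = f - swap_vars j f"
    using div_diff_dvd by (metis dvdE)
  have "X j - X (j + 1) \<noteq> 0" by simp
  then have "\<exists>!g. (X j - X (j + 1)) * g = f - swap_vars j f"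
    using g by (metis mult_left_cancel)
  then show ?thesis unfolding div_diff_def by (rule theI')
qed

lemma iso_div_diff_eq:
  "(X j - X (Suc j)) * iso_div_diff j f = (1 - X (Suc j)) * f - (1 - X j) * swap_vars j f"
  using div_diff_eq[of j "f - X (j + 1) * f"]
  by (simp add: iso_div_diff_def swap_vars_diff swap_vars_mult swap_vars_X algebra_simps)


lemma iso_div_diff_swap:
  "(X (transpose i (i + 1) j) - X (transpose i (i + 1) (Suc j))) * swap_vars i (iso_div_diff j f) =
   (1 - X (transpose i (i + 1) (Suc j))) * swap_vars i f
     - (1 - X (transpose i (i + 1) j)) * swap_vars i (swap_vars j f)"
  using arg_cong[OF iso_div_diff_eq[of j f], of "swap_vars i"]
  by (simp add: swap_vars_diff swap_vars_mult swap_vars_X)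

lemma swap_vars_iso_div_diff: "swap_vars j (iso_div_diff j f) = iso_div_diff j f"
proof -
  have "(X j - X (Suc j)) * swap_vars j (iso_div_diff j f) = (X j - X (Suc j)) * iso_div_diff j f"
    unfolding iso_div_diff_eq using iso_div_diff_swap[of j j f]
    by (simp add: algebra_simps)
  then show ?thesis by simp
qed

lemma swap_vars_compose:
  assumes "transpose j (j + 1) \<circ> transpose i (i + 1) = transpose l (l + 1) \<circ> transpose k (k + 1)"
  shows "swap_vars j (swap_vars i f) = swap_vars l (swap_vars k f)"
  using assms by (intro poly_mapping_eqI) (simp add: lookup_swap_vars map_key_compose)

lemma swap_vars_commute:
  assumes "Suc i < j"
  shows "swap_vars i (swap_vars j f) = swap_vars j (swap_vars i f)"
  using assms by (intro swap_vars_compose) (auto simp: fun_eq_iff transpose_def)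

lemma transpose_braid:
  "transpose i (i + 1) \<circ> transpose (Suc i) (Suc i + 1) \<circ> transpose i (i + 1) =
   transpose (Suc i) (Suc i + 1) \<circ> transpose i (i + 1) \<circ> transpose (Suc i) (Suc i + 1)"
  by (auto simp: fun_eq_iff transpose_def)

lemma swap_vars_braid:
  "swap_vars i (swap_vars (Suc i) (swap_vars i f)) =
   swap_vars (Suc i) (swap_vars i (swap_vars (Suc i) f))"
  using transpose_braid[of i]
  by (intro poly_mapping_eqI) (simp add: lookup_swap_vars map_key_compose inj_compose comp_assoc del: add_Suc)

lemma iso_div_diff_commute:
  assumes "Suc i < j"
  shows "iso_div_diff i (iso_div_diff j f) = iso_div_diff j (iso_div_diff i f)"
proof -
  define a b c d where "a = X i" and "b = X (Suc i)" and "c = X j" and "d = X (Suc j)"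
  note a_b_c_d_def = this
  have ne: "a - b \<noteq> 0" "c - d \<noteq> 0" by (auto simp: a_b_c_d_def)
  let ?D = iso_div_diff and ?s = swap_vars
  have t: "transpose i (i + 1) j = j" "transpose i (i + 1) (Suc j) = Suc j"
      "transpose j (j + 1) i = i" "transpose j (j + 1) (Suc i) = Suc i"
    using assms by (auto simp: transpose_def)
  have 1: "(a - b) * ?D i (?D j f) = (1 - b) * ?D j f - (1 - a) * ?s i (?D j f)"
    and 2: "(c - d) * ?D j f = (1 - d) * f - (1 - c) * ?s j f"
    and 3: "(c - d) * ?s i (?D j f) = (1 - d) * ?s i f - (1 - c) * ?s i (?s j f)"
    and 4: "(c - d) * ?D j (?D i f) = (1 - d) * ?D i f - (1 - c) * ?s j (?D i f)"
    and 5: "(a - b) * ?D i f = (1 - b) * f - (1 - a) * ?s i f"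
    and 6: "(a - b) * ?s j (?D i f) = (1 - b) * ?s j f - (1 - a) * ?s i (?s j f)"
    using iso_div_diff_eq iso_div_diff_swap[of i j f] iso_div_diff_swap[of j i f]
    by (simp_all only: a_b_c_d_def t swap_vars_commute[OF assms])
  have "(a - b) * (c - d) * ?D i (?D j f) =
        (1 - b) * ((c - d) * ?D j f) - (1 - a) * ((c - d) * ?s i (?D j f))"
    using arg_cong[OF 1, of "(*) (c - d)"] by (simp only: algebra_simps)
  also have "\<dots> = (1 - d) * ((a - b) * ?D i f) - (1 - c) * ((a - b) * ?s j (?D i f))"
    unfolding 2 3 5 6 by (simp only: algebra_simps)
  also have "\<dots> = (a - b) * (c - d) * ?D j (?D i f)"
    using arg_cong[OF 4, of "(*) (a - b)"] by (simp only: algebra_simps)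
  finally show ?thesis using ne by simp
qed

lemma iso_div_diff_braid:
  "iso_div_diff i (iso_div_diff (Suc i) (iso_div_diff i f)) =
   iso_div_diff (Suc i) (iso_div_diff i (iso_div_diff (Suc i) f))"
proof -
  define a b c where "a = X i" and "b = X (Suc i)" and "c = X (Suc (Suc i))"
  note a_b_c_def = this
  have ne: "a - b \<noteq> 0" "b - c \<noteq> 0" "a - c \<noteq> 0" by (auto simp: a_b_c_def)
  let ?s = "swap_vars i" and ?t = "swap_vars (Suc i)"
  let ?D = "iso_div_diff i" and ?E = "iso_div_diff (Suc i)"
  have tr: "transpose i (i + 1) i = Suc i" "transpose i (i + 1) (Suc i) = i"
    "transpose i (i + 1) (Suc (Suc i)) = Suc (Suc i)"
    "transpose (Suc i) (Suc i + 1) i = i" "transpose (Suc i) (Suc i + 1) (Suc i) = Suc (Suc i)"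
    "transpose (Suc i) (Suc i + 1) (Suc (Suc i)) = Suc i"
    by (auto simp: transpose_def)
  have push: "swap_vars k (u * v) = swap_vars k u * swap_vars k v"
    "swap_vars k (u - v) = swap_vars k u - swap_vars k v" for k u v
    by (rule swap_vars_mult swap_vars_diff)+
  have D: "(a - b) * ?D h = (1 - b) * h - (1 - a) * ?s h" for h
    using iso_div_diff_eq by (simp only: a_b_c_def)
  have E: "(b - c) * ?E h = (1 - c) * h - (1 - b) * ?t h" for h
    using iso_div_diff_eq by (simp only: a_b_c_def)
  have tD: "(a - c) * ?t (?D h) = (1 - c) * ?t h - (1 - a) * ?t (?s h)" for h
    using iso_div_diff_swap[of "Suc i" i h] by (simp only: a_b_c_def tr)
  have sE: "(a - c) * ?s (?E h) = (1 - c) * ?s h - (1 - a) * ?s (?t h)" for h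
    using iso_div_diff_swap[of i "Suc i" h] by (simp only: a_b_c_def tr)
  have stD: "(b - c) * ?s (?t (?D h)) = (1 - c) * ?s (?t h) - (1 - b) * ?s (?t (?s h))" for h
    using arg_cong[OF tD[of h], of ?s] by (simp only: a_b_c_def push swap_vars_1 swap_vars_X tr)
  have tsE: "(a - b) * ?t (?s (?E h)) = (1 - b) * ?t (?s h) - (1 - a) * ?t (?s (?t h))" for h
    using arg_cong[OF sE[of h], of ?t] by (simp only: a_b_c_def push swap_vars_1 swap_vars_X tr)
  define M where "M = (a - b) * (b - c) * (a - c)"
  have "M * ?D (?E (?D f)) =
        (b - c) * (a - c) * ((a - b) * ?D (?E (?D f)))"
    by (simp only: M_def algebra_simps)
  also have "\<dots> = (a - c) * (1 - b) * ((b - c) * ?E (?D f))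
                - (b - c) * (1 - a) * ((a - c) * ?s (?E (?D f)))"
    unfolding D[of "?E (?D f)"] by (simp only: algebra_simps)
  also have "\<dots> = (1 - c)^2 * ((a - b) * ?D f) - (1 - b)^2 * ((a - c) * ?t (?D f))
                + (1 - a)^2 * ((b - c) * ?s (?t (?D f)))"
    unfolding E sE swap_vars_iso_div_diff by (simp add: algebra_simps power2_eq_square)
  also have "\<dots> = (1 - b) * (1 - c) * ((b - c) * ?E f) - (1 - a) * (1 - c) * ((a - c) * ?s (?E f))
                + (1 - b) * (1 - a) * ((a - b) * ?t (?s (?E f)))"
    unfolding D E tD sE stD tsE swap_vars_braid by (simp add: algebra_simps power2_eq_square)
  also have "\<dots> = (a - c) * (1 - c) * ((a - b) * ?D (?E f))
                - (a - b) * (1 - b) * ((a - c) * ?t (?D (?E f)))"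
    unfolding D[of "?E f"] tD[of "?E f"] swap_vars_iso_div_diff
    by (simp add: algebra_simps power2_eq_square)
  also have "\<dots> = (a - b) * (a - c) * ((b - c) * ?E (?D (?E f)))"
    unfolding E[of "?D (?E f)"] by (simp only: algebra_simps)
  also have "\<dots> = M * ?E (?D (?E f))"
    by (simp only: M_def algebra_simps)
  finally show ?thesis using ne by (simp add: M_def)
qed

lemma swap_pos_permutes:
  assumes "w permutes {1..n}" "1 \<le> j" "j < n"
  shows "swap_pos j w permutes {1..n}"
  using assms unfolding swap_pos_def
  by (intro permutes_compose permutes_swap_id) auto

lemma swap_pos_weight:
  assumes "1 \<le> j" "j < n" "w j < w (j + 1)"
  shows "(\<Sum>i=1..n. i * swap_pos j w i) < (\<Sum>i=1..n. i * w i)"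
proof -
  have split: "(\<Sum>i=1..n. f i) = f j + (f (Suc j) + (\<Sum>i\<in>{1..n} - {j} - {Suc j}. f i))" for f :: "nat \<Rightarrow> nat"
    using assms by (simp add: sum.remove[of _ j] sum.remove[of _ "Suc j"])
  have "(\<Sum>i\<in>{1..n} - {j} - {Suc j}. i * swap_pos j w i) = (\<Sum>i\<in>{1..n} - {j} - {Suc j}. i * w i)"
    by (intro sum.cong) (auto simp: swap_pos_def transpose_def)
  then show ?thesis
    unfolding split using assms(3) by (simp add: swap_pos_def transpose_def algebra_simps)
qed

lemma no_ascent_longest:
  assumes w: "w permutes {1..n}" and no: "\<And>j. 1 \<le> j \<Longrightarrow> j < n \<Longrightarrow> \<not> w j < w (j + 1)"
  shows "w = longest n"
proof -
  have dec: "w (Suc j) < w j" if "1 \<le> j" "j < n" for j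
  proof -
    have "w (Suc j) \<noteq> w j" using permutes_inj[OF w] by (simp add: inj_eq)
    then show ?thesis using no[OF that] by simp
  qed
  have im: "w i \<in> {1..n}" if "1 \<le> i" "i \<le> n" for i
    using that permutes_in_image[OF w, of i] by auto
  have up: "w (Suc k) + k \<le> n" if "Suc k \<le> n" for k
    using that
  proof (induction k)
    case 0
    then show ?case using im[of 1] by simp
  next
    case (Suc k)
    then show ?case using dec[of "Suc k"] by simp
  qed
  have down: "Suc k \<le> w (n - k)" if "k < n" for k
    using that
  proof (induction k)
    case 0
    then show ?case using im[of n] by simp
  next
    case (Suc k)
    have "w (Suc (n - Suc k)) < w (n - Suc k)" using Suc.prems by (intro dec) auto
    moreover have "Suc (n - Suc k) = n - k" using Suc.prems by simp
    ultimately show ?case using Suc by simp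
  qed
  show ?thesis
  proof
    fix i
    show "w i = longest n i"
    proof (cases "i \<in> {1..n}")
      case True
      then have "w i + (i - 1) \<le> n" "Suc (n - i) \<le> w i"
        using up[of "i - 1"] down[of "n - i"] by auto
      with True show ?thesis by (auto simp: longest_def)
    next
      case False
      then show ?thesis using permutes_not_in[OF w] by (auto simp: longest_def)
    qed
  qed
qed

lemma is_grothendieck_cases_ascent:
  assumes "is_grothendieck n w f" "1 \<le> k" "k < n" "w k < w (k + 1)"
  obtains j g where "1 \<le> j" "j < n" "w j < w (j + 1)" "is_grothendieck n (swap_pos j w) g"
    "f = iso_div_diff j g"
  using assms(1)
proof cases
  case longest
  then show ?thesis using assms(2-4) by (simp add: longest_def)
next
  case (step j g)
  then show ?thesis using that by blast
qed

theorem is_grothendieck_ex1: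
  assumes "w permutes {1..n}"
  shows "\<exists>!f. is_grothendieck n w f"
  using assms
proof (induction "\<Sum>i=1..n. i * w i" arbitrary: w rule: less_induct)
  case less
  note w = \<open>w permutes {1..n}\<close>
  have IH: "\<exists>!f. is_grothendieck n v f"
    if "v permutes {1..n}" "(\<Sum>i=1..n. i * v i) < (\<Sum>i=1..n. i * w i)" for v
    using less.hyps that by blast
  have desc: "\<exists>!f. is_grothendieck n (swap_pos j w) f" "swap_pos j w permutes {1..n}"
    "(\<Sum>i=1..n. i * swap_pos j w i) < (\<Sum>i=1..n. i * w i)"
    if "1 \<le> j" "j < n" "w j < w (j + 1)" for j
    using IH swap_pos_permutes[OF w] swap_pos_weight that by blast+
  show ?case
  proof (cases "\<exists>j. 1 \<le> j \<and> j < n \<and> w j < w (j + 1)")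
    case False
    then have eq: "w = longest n" using no_ascent_longest[OF w] by blast
    show ?thesis
    proof (rule ex1I)
      show "is_grothendieck n w (\<Prod>i=1..n. X i ^ (n - i))"
        unfolding eq by (rule is_grothendieck.longest)
    next
      fix f assume "is_grothendieck n w f"
      then show "f = (\<Prod>i=1..n. X i ^ (n - i))"
        by cases (use False in auto)
    qed
  next
    case True
    then obtain j0 where j0: "1 \<le> j0" "j0 < n" "w j0 < w (j0 + 1)" by blast
    have less_case: "iso_div_diff j f = iso_div_diff k g"
      if j: "1 \<le> j" "j < n" "w j < w (j + 1)" "is_grothendieck n (swap_pos j w) f"
        and k: "1 \<le> k" "k < n" "w k < w (k + 1)" "is_grothendieck n (swap_pos k w) g"
        and jk: "j < k" for j k f g
    proof (cases "k = Suc j")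
      case False
      with jk have jk: "Suc j < k" by simp
      let ?v = "swap_pos k (swap_pos j w)"
      have v: "?v = swap_pos j (swap_pos k w)"
        using jk by (auto simp: swap_pos_def fun_eq_iff transpose_def)
      have asc: "swap_pos j w k < swap_pos j w (k + 1)" "swap_pos k w j < swap_pos k w (j + 1)"
        using jk j k by (auto simp: swap_pos_def transpose_def)
      have "?v permutes {1..n}" "(\<Sum>i=1..n. i * ?v i) < (\<Sum>i=1..n. i * w i)"
        using desc[OF j(1-3)] swap_pos_permutes[of "swap_pos j w" n k]
          swap_pos_weight[of k n "swap_pos j w"] k asc by auto
      then obtain h where h: "is_grothendieck n ?v h" using IH by blast
      have "is_grothendieck n (swap_pos j w) (iso_div_diff k h)"
        using h desc(2)[OF j(1-3)] k asc by (intro is_grothendieck.step) auto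
      then have f: "f = iso_div_diff k h" using desc(1)[OF j(1-3)] j(4) by blast
      have "is_grothendieck n (swap_pos k w) (iso_div_diff j h)"
        using h desc(2)[OF k(1-3)] j asc unfolding v by (intro is_grothendieck.step) auto
      then have g: "g = iso_div_diff j h" using desc(1)[OF k(1-3)] k(4) by blast
      show ?thesis unfolding f g by (rule iso_div_diff_commute[OF jk])
    next
      case True
      let ?u = "swap_pos k (swap_pos j w)" and ?u' = "swap_pos j (swap_pos k w)"
      let ?v = "swap_pos j ?u"
      have v: "?v = swap_pos k ?u'"
        using transpose_braid[of j] True by (simp add: swap_pos_def comp_assoc del: add_Suc)
      have asc: "swap_pos j w k < swap_pos j w (k + 1)" "?u j < ?u (j + 1)"
          "swap_pos k w j < swap_pos k w (j + 1)" "?u' k < ?u' (k + 1)"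
        using True j k by (auto simp: swap_pos_def transpose_def)
      have u: "?u permutes {1..n}" "(\<Sum>i=1..n. i * ?u i) < (\<Sum>i=1..n. i * w i)"
        using desc[OF j(1-3)] swap_pos_permutes[of "swap_pos j w" n k]
          swap_pos_weight[of k n "swap_pos j w"] k asc by auto
      have u': "?u' permutes {1..n}"
        using desc[OF k(1-3)] swap_pos_permutes[of "swap_pos k w" n j] j by auto
      have "?v permutes {1..n}" "(\<Sum>i=1..n. i * ?v i) < (\<Sum>i=1..n. i * w i)"
        using u swap_pos_permutes[of ?u n j] swap_pos_weight[of j n ?u] j asc by auto
      then obtain h where h: "is_grothendieck n ?v h" using IH by blast
      have "is_grothendieck n (swap_pos j w) (iso_div_diff k (iso_div_diff j h))"
        using h desc(2)[OF j(1-3)] u j k asc by (intro is_grothendieck.step) auto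
      then have f: "f = iso_div_diff k (iso_div_diff j h)" using desc(1)[OF j(1-3)] j(4) by blast
      have "is_grothendieck n (swap_pos k w) (iso_div_diff j (iso_div_diff k h))"
        using h desc(2)[OF k(1-3)] u' j k asc unfolding v by (intro is_grothendieck.step) auto
      then have g: "g = iso_div_diff j (iso_div_diff k h)" using desc(1)[OF k(1-3)] k(4) by blast
      show ?thesis unfolding f g True by (rule iso_div_diff_braid)
    qed
    obtain f0 where f0: "is_grothendieck n (swap_pos j0 w) f0" using desc(1)[OF j0] by blast
    show ?thesis
    proof (rule ex1I)
      show "is_grothendieck n w (iso_div_diff j0 f0)"
        using w j0 f0 by (rule is_grothendieck.step)
    next
      fix f assume "is_grothendieck n w f"
      then obtain k g where k: "1 \<le> k" "k < n" "w k < w (k + 1)" "is_grothendieck n (swap_pos k w) g"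
        and f: "f = iso_div_diff k g"
        using j0 by (rule is_grothendieck_cases_ascent)
      consider "j0 < k" | "k < j0" | "k = j0" by linarith
      then show "f = iso_div_diff j0 f0"
      proof cases
        case 1
        then show ?thesis using less_case[OF j0 f0 k] f by simp
      next
        case 2
        then show ?thesis using less_case[OF k j0 f0] f by simp
      next
        case 3
        then show ?thesis using desc(1)[OF j0] f0 k(4) f by blast
      qed
    qed
  qed
qed

lemma is_grothendieck_grothendieck:
  assumes "w permutes {1..n}"
  shows "is_grothendieck n w (grothendieck n w)"
  unfolding grothendieck_def by (rule theI'[OF is_grothendieck_ex1[OF assms]])

lemma grothendieck_eqI:
  assumes "w permutes {1..n}" "is_grothendieck n w f"
  shows "grothendieck n w = f"
  using is_grothendieck_ex1[OF assms(1)] is_grothendieck_grothendieck[OF assms(1)] assms(2) by blast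

lemma longest_permutes: "longest n permutes {1..n}"
proof (rule bij_imp_permutes)
  show "bij_betw (longest n) {1..n} {1..n}"
    by (rule bij_betw_byWitness[where f' = "longest n"]) (auto simp: longest_def)
next
  fix i assume "i \<notin> {1..n}"
  then show "longest n i = i" by (simp only: longest_def if_False)
qed

theorem grothendieck_longest: "grothendieck n (longest n) = (\<Prod>i=1..n. X i ^ (n - i))"
  by (rule grothendieck_eqI[OF longest_permutes is_grothendieck.longest])

theorem grothendieck_step:
  assumes "w permutes {1..n}" "1 \<le> j" "j < n" "w j < w (j + 1)"
  shows "grothendieck n w = iso_div_diff j (grothendieck n (swap_pos j w))"
  by (rule grothendieck_eqI[OF assms(1) is_grothendieck.step[OF assms]])
    (rule is_grothendieck_grothendieck[OF swap_pos_permutes[OF assms(1-3)]])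

end

theory Submission
  imports Defs
begin

text \<open>
  For a vexillary permutation the Grothendieck polynomial is a flagged Grothendieck polynomial: it
  arises from the partition \<open>\<mu>\<close> obtained by sorting the Lehmer code, by applying to a monomial one chain of isobaric
  divided differences for each row, whose length is dictated by a flag \<open>\<phi>\<close>
  (\<open>vexillary_grothendieck_flagged\<close>). Commuting one variable through a chain of operators gives a
  transition equation
  \<open>G(\<mu>, \<phi>) = (1 - x\<^sub>m) G(\<mu>, \<phi> - e\<^sub>t) + x\<^sub>m G(\<mu> - e\<^sub>t, \<phi>)\<close>,
  where \<open>t\<close> is the first row with the largest flag \<open>m\<close> (\<open>flagged_transition_row\<close>). All its terms have
  the same sign in each degree, so nothing cancels and the transition equation is also a
  recursion for supports (\<open>alternating_transition\<close>).

  This recursion is solved by weights of certain fillings of the diagram of \<open>\<mu>\<close>, read column by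
  column. A column may hold several entries in one of its boxes, and no two columns may do so in the same row. Apart
  from this condition the columns are independent of each other, in contrast to set-valued
  tableaux, whose weights they have in common (\<open>filling_weights_transition\<close>,
  \<open>flagged_alternating_support\<close>). An exchange argument shows that the rows can be distributed to
  the columns once and for all without losing weights (\<open>column_sets_exchange\<close>,
  \<open>filling_weights_dominant_assignment\<close>), so the support is a Minkowski sum over the columns.

  After homogenization each column is described by bounds on coordinates and on prefix sums in a suitable
  order of the variables (\<open>chain_box_column_sets\<close>). Such systems are networks, so the difference of
  two solutions decomposes into moves that are feasible from both ends, and this makes Minkowski sums of
  the solution sets M-convex (\<open>M_convex_sum_chain_boxes\<close>). Homogeneous components are slices
  of the homogenized support.
\<close>

section \<open>Isobaric divided differences\<close>

lemma iso_div_diff_eqI: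
  assumes "(X j - X (Suc j)) * g = (1 - X (Suc j)) * f - (1 - X j) * swap_vars j f"
  shows "iso_div_diff j f = g"
proof -
  have "(X j - X (Suc j)) * iso_div_diff j f = (X j - X (Suc j)) * g"
    using assms iso_div_diff_eq[of j f] by simp
  then show ?thesis by simp
qed

lemma iso_div_diff_add: "iso_div_diff j (f + g) = iso_div_diff j f + iso_div_diff j g"
  by (rule iso_div_diff_eqI) (simp add: swap_vars_add distrib_left iso_div_diff_eq)

lemma iso_div_diff_symmetric_mult:
  assumes "swap_vars j s = s"
  shows "iso_div_diff j (s * f) = s * iso_div_diff j f"
proof (rule iso_div_diff_eqI)
  have "(X j - X (Suc j)) * (s * iso_div_diff j f) = s * ((X j - X (Suc j)) * iso_div_diff j f)"
    by (simp only: ac_simps)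
  then show "(X j - X (Suc j)) * (s * iso_div_diff j f) =
      (1 - X (Suc j)) * (s * f) - (1 - X j) * swap_vars j (s * f)"
    unfolding iso_div_diff_eq by (simp add: swap_vars_mult assms algebra_simps)
qed

lemma iso_div_diff_one [simp]: "iso_div_diff j 1 = 1"
  by (rule iso_div_diff_eqI) (simp add: algebra_simps)

lemma iso_div_diff_symmetric: "swap_vars j f = f \<Longrightarrow> iso_div_diff j f = f"
  using iso_div_diff_symmetric_mult[of j f 1] by simp

lemma swap_vars_X_Suc: "swap_vars j (X j) = X (Suc j)" "swap_vars j (X (Suc j)) = X j"
  by (simp_all add: swap_vars_X)

lemma swap_vars_X_other: "i \<noteq> j \<Longrightarrow> i \<noteq> Suc j \<Longrightarrow> swap_vars j (X i) = X i"
  by (simp add: swap_vars_X)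

lemma swap_vars_power: "swap_vars j (f ^ k) = swap_vars j f ^ k"
  by (induction k) (simp_all add: swap_vars_mult)

text \<open>
  The commutation rule between a variable and an isobaric divided difference. The second summand
  carries no operator any more; it is the source of the terms that flag lowering produces.
\<close>

lemma iso_div_diff_X_mult:
  "iso_div_diff j (X j * f) = X (Suc j) * iso_div_diff j f + (1 - X (Suc j)) * f"
proof (rule iso_div_diff_eqI)
  have "(X j - X (Suc j)) * (X (Suc j) * iso_div_diff j f + (1 - X (Suc j)) * f) =
      X (Suc j) * ((X j - X (Suc j)) * iso_div_diff j f) + (X j - X (Suc j)) * (1 - X (Suc j)) * f"
    by (simp only: algebra_simps)
  also have "\<dots> = (1 - X (Suc j)) * (X j * f) - (1 - X j) * swap_vars j (X j * f)"
    unfolding iso_div_diff_eq by (simp add: swap_vars_mult swap_vars_X_Suc algebra_simps)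
  finally show "(X j - X (Suc j)) * (X (Suc j) * iso_div_diff j f + (1 - X (Suc j)) * f) =
      (1 - X (Suc j)) * (X j * f) - (1 - X j) * swap_vars j (X j * f)" .
qed

lemma iso_div_diff_X: "iso_div_diff j (X j) = 1"
  using iso_div_diff_X_mult[of j 1] by simp

lemma iso_div_diff_one_minus_X:
  assumes "swap_vars j f = f"
  shows "iso_div_diff j ((1 - X j) * f) = 0"
  by (rule iso_div_diff_eqI)
    (simp add: swap_vars_mult swap_vars_diff swap_vars_X_Suc assms algebra_simps)


text \<open>
  The composite \<open>\<partial>\<^sub>e\<^sub>-\<^sub>1 \<cdots> \<partial>\<^sub>i\<close> of isobaric divided differences; it spreads a power of
  \<open>x\<^sub>i\<close> over the variables \<open>x\<^sub>i, \<dots>, x\<^sub>e\<close> and is the identity when \<open>e \<le> i\<close>.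
\<close>

primrec div_chain :: "nat \<Rightarrow> nat \<Rightarrow> mpoly \<Rightarrow> mpoly" where
  "div_chain i 0 f = f"
| "div_chain i (Suc e) f = (if i \<le> e then iso_div_diff e (div_chain i e f) else f)"

lemma div_chain_trivial [simp]: "e \<le> i \<Longrightarrow> div_chain i e f = f"
  by (cases e) simp_all

lemma div_chain_add: "div_chain i e (f + g) = div_chain i e f + div_chain i e g"
  by (induction e) (simp_all add: iso_div_diff_add)

lemma div_chain_inert_mult:
  assumes "\<And>j. i \<le> j \<Longrightarrow> j < e \<Longrightarrow> swap_vars j s = s"
  shows "div_chain i e (s * f) = s * div_chain i e f"
  using assms by (induction e) (simp_all add: iso_div_diff_symmetric_mult)

lemma div_chain_first:
  "i < e \<Longrightarrow> div_chain i e f = div_chain (Suc i) e (iso_div_diff i f)"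
proof (induction e)
  case (Suc e)
  then show ?case by (cases "i = e") simp_all
qed simp

lemma iso_div_diff_div_chain_far:
  "e < l \<Longrightarrow> iso_div_diff l (div_chain i e f) = div_chain i e (iso_div_diff l f)"
proof (induction e)
  case (Suc e)
  then show ?case using iso_div_diff_commute[of e l "div_chain i e f"] by simp
qed simp

lemma iso_div_diff_div_chain_below:
  "Suc l < i \<Longrightarrow> iso_div_diff l (div_chain i e f) = div_chain i e (iso_div_diff l f)"
  by (induction e) (simp_all add: iso_div_diff_commute)

text \<open>
  By the braid relation, an operator inside the range of a chain passes through it and loses one
  in its index.
\<close>

lemma iso_div_diff_div_chain_inside:
  assumes "i \<le> l" "Suc l < e"
  shows "iso_div_diff l (div_chain i e f) = div_chain i e (iso_div_diff (Suc l) f)"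
  using assms
proof (induction e)
  case (Suc e)
  show ?case
  proof (cases "Suc l = e")
    case True
    then show ?thesis
      using Suc.prems iso_div_diff_braid[of l "div_chain i l f"]
        iso_div_diff_div_chain_far[of l "Suc l" i f]
      by auto
  next
    case False
    then show ?thesis
      using Suc iso_div_diff_commute[of l e] by simp
  qed
qed simp

text \<open>
  Commuting \<open>x\<^sub>i\<close> through the whole chain leaves one summand for every omitted factor. A summand that
  omits \<open>\<partial>\<^sub>l\<close> with \<open>l + 1 < e\<close> next applies \<open>\<partial>\<^sub>l\<^sub>+\<^sub>1\<close> to \<open>1 - x\<^sub>l\<^sub>+\<^sub>1\<close> times a
  polynomial symmetric in \<open>x\<^sub>l\<^sub>+\<^sub>1, x\<^sub>l\<^sub>+\<^sub>2\<close>, hence vanishes; only the omission of the outermost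
  factor survives.
\<close>

lemma div_chain_X_mult:
  assumes "i < e" "\<And>l. i < l \<Longrightarrow> l < e \<Longrightarrow> swap_vars l g = g"
  shows "div_chain i e (X i * g) = X e * div_chain i e g + (1 - X e) * div_chain i (e - 1) g"
  using assms
proof (induction e)
  case (Suc e)
  show ?case
  proof (cases "i = e")
    case True
    then show ?thesis by (simp add: iso_div_diff_X_mult)
  next
    case False
    with Suc.prems have ie: "i < e" by simp
    let ?h = "div_chain i (e - 1) g"
    have "iso_div_diff e g = g" using Suc.prems ie by (intro iso_div_diff_symmetric) auto
    then have "iso_div_diff e ?h = ?h"
      using iso_div_diff_div_chain_far[of "e - 1" e i g] ie by simp
    then have sym: "swap_vars e ?h = ?h" by (metis swap_vars_iso_div_diff)
    have IH: "div_chain i e (X i * g) = X e * div_chain i e g + (1 - X e) * ?h"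
      using Suc ie by auto
    show ?thesis
      using ie by (simp add: IH iso_div_diff_add iso_div_diff_X_mult iso_div_diff_one_minus_X[OF sym, simplified])
  qed
qed simp

lemma div_chain_div_chain:
  assumes "e' \<le> e"
  shows "div_chain i e (div_chain (Suc i) e' f) = div_chain i (e' - 1) (div_chain i e f)"
  using assms
proof (induction e')
  case (Suc e')
  show ?case
  proof (cases "i < e'")
    case True
    then obtain l where l: "e' = Suc l" "i \<le> l" by (cases e') auto
    have "div_chain (Suc i) (Suc e') f = iso_div_diff e' (div_chain (Suc i) e' f)"
      using True by simp
    then show ?thesis
      using l Suc.IH Suc.prems iso_div_diff_div_chain_inside[of i l e "div_chain (Suc i) (Suc l) f"]
      by (simp del: div_chain.simps) (simp)
  qed simp
qed simp

section \<open>Flagged Grothendieck polynomials\<close>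

text \<open>
  The flagged Grothendieck polynomial of the rows \<open>i, \<dots>, i + r - 1\<close> of a shape \<open>\<mu>\<close> with flag
  \<open>\<phi>\<close>, meaning that row \<open>j\<close> uses the variables up to \<open>x\<close> with index \<open>\<phi> j\<close>. Enlarging the exponent to
  \<open>\<mu> i + \<phi> i - i\<close> compensates for the degree lost to the \<open>\<phi> i - i\<close> operators.
\<close>

primrec flagged :: "(nat \<Rightarrow> nat) \<Rightarrow> (nat \<Rightarrow> nat) \<Rightarrow> nat \<Rightarrow> nat \<Rightarrow> mpoly" where
  "flagged \<mu> \<phi> 0 i = 1"
| "flagged \<mu> \<phi> (Suc r) i =
     div_chain i (\<phi> i) (X i ^ (\<mu> i + \<phi> i - i) * flagged \<mu> \<phi> r (Suc i))"

lemma flagged_cong: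
  assumes "\<And>j. i \<le> j \<Longrightarrow> j < i + r \<Longrightarrow> \<mu> j = \<mu>' j \<and> \<phi> j = \<phi>' j"
  shows "flagged \<mu> \<phi> r i = flagged \<mu>' \<phi>' r i"
  using assms
proof (induction r arbitrary: i)
  case (Suc r)
  then show ?case using Suc.IH[of "Suc i"] Suc.prems[of i] by simp
qed simp

lemma swap_vars_flagged_below:
  assumes "Suc l < i"
  shows "swap_vars l (flagged \<mu> \<phi> r i) = flagged \<mu> \<phi> r i"
  using assms
proof (induction r arbitrary: i)
  case (Suc r)
  let ?g = "X i ^ (\<mu> i + \<phi> i - i) * flagged \<mu> \<phi> r (Suc i)"
  have "swap_vars l ?g = ?g"
    using Suc by (simp add: swap_vars_mult swap_vars_power swap_vars_X_other)
  then have "iso_div_diff l ?g = ?g" by (rule iso_div_diff_symmetric)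
  then have "iso_div_diff l (flagged \<mu> \<phi> (Suc r) i) = flagged \<mu> \<phi> (Suc r) i"
    using iso_div_diff_div_chain_below[OF Suc.prems, of "\<phi> i" ?g] by simp
  then show ?case by (metis swap_vars_iso_div_diff)
qed simp

text \<open>
  Rows that share one flag \<open>m\<close> give a polynomial symmetric in the variables up to \<open>x\<^sub>m\<close>: an operator
  with index below \<open>m - 1\<close> passes the first chain, raising its index, and is then absorbed by the later
  rows, while the outermost operator of the first chain yields the remaining symmetry.
\<close>

lemma swap_vars_flagged_constant_flag:
  assumes "\<And>j. i \<le> j \<Longrightarrow> j < i + r \<Longrightarrow> \<phi> j = m" "i \<le> l" "l < m"
  shows "swap_vars l (flagged \<mu> \<phi> r i) = flagged \<mu> \<phi> r i"
  using assms
proof (induction r arbitrary: i l)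
  case (Suc r)
  let ?g = "X i ^ (\<mu> i + \<phi> i - i) * flagged \<mu> \<phi> r (Suc i)"
  have \<phi>: "\<phi> i = m" using Suc.prems by simp
  show ?case
  proof (cases "Suc l = m")
    case True
    then show ?thesis using \<phi> Suc.prems(2) by (auto simp: swap_vars_iso_div_diff)
  next
    case False
    then have l: "Suc l < m" using Suc.prems by simp
    have "swap_vars (Suc l) (flagged \<mu> \<phi> r (Suc i)) = flagged \<mu> \<phi> r (Suc i)"
      using Suc.prems l by (intro Suc.IH) auto
    then have "swap_vars (Suc l) ?g = ?g"
      using Suc.prems by (simp add: swap_vars_mult swap_vars_power swap_vars_X_other)
    then have "iso_div_diff (Suc l) ?g = ?g" by (rule iso_div_diff_symmetric)
    then have "iso_div_diff l (div_chain i m ?g) = div_chain i m ?g"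
      using iso_div_diff_div_chain_inside[OF Suc.prems(2) l, of ?g] by simp
    then have "swap_vars l (div_chain i m ?g) = div_chain i m ?g" by (metis swap_vars_iso_div_diff)
    then show ?thesis by (simp only: flagged.simps \<phi>)
  qed
qed simp

lemma div_chain_X_power: "div_chain i (i + d) (X i ^ d) = 1"
proof (induction d)
  case (Suc d)
  have "div_chain i (i + Suc d) (X i * X i ^ d) =
      X (i + Suc d) * div_chain i (i + Suc d) (X i ^ d) + (1 - X (i + Suc d)) * div_chain i (i + d) (X i ^ d)"
    using div_chain_X_mult[of i "i + Suc d" "X i ^ d"]
    by (simp add: swap_vars_power swap_vars_X_other)
  also have "\<dots> = 1" using Suc by simp
  finally show ?case by simp
qed simp

lemma flagged_drop_row:
  assumes "\<mu> (i + r) = 0" "i + r \<le> \<phi> (i + r)"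
  shows "flagged \<mu> \<phi> (Suc r) i = flagged \<mu> \<phi> r i"
  using assms
proof (induction r arbitrary: i)
  case 0
  then show ?case using div_chain_X_power[of i "\<phi> i - i"] by simp
next
  case (Suc r)
  have "flagged \<mu> \<phi> (Suc r) (Suc i) = flagged \<mu> \<phi> r (Suc i)"
    using Suc.prems by (intro Suc.IH) simp_all
  then show ?case unfolding flagged.simps(2)[of \<mu> \<phi> "Suc r" i] flagged.simps(2)[of \<mu> \<phi> r i]
    by (simp only:)
qed

text \<open>
  In a semistandard filling the box below the last box of row \<open>i\<close> is strictly larger, so when two
  equal rows share the flag \<open>m\<close> the upper one cannot use \<open>x\<^sub>m\<close>. Algebraically, the braid relations
  move a factor \<open>\<partial>\<^sub>i\<close> to the inside, where it meets \<open>x\<^sub>i (x\<^sub>i x\<^sub>i\<^sub>+\<^sub>1)\<^sup>p\<close> and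
  only removes the first factor.
\<close>

lemma flagged_straighten_row:
  assumes "\<mu> (Suc i) = \<mu> i" "\<phi> i = m" "\<phi> (Suc i) = m" "i < m"
  shows "flagged \<mu> \<phi> (Suc (Suc r)) i = flagged \<mu> (\<phi>(i := m - 1)) (Suc (Suc r)) i"
proof -
  define p where "p = \<mu> i + m - Suc i"
  let ?A = "flagged \<mu> \<phi> r (Suc (Suc i))"
  let ?P = "(X i * X (Suc i)) ^ p * ?A"
  have p: "\<mu> i + m - i = Suc p" "\<mu> i + (m - 1) - i = p" using assms(4) by (auto simp: p_def)
  have symP: "swap_vars i ?P = ?P"
    by (simp add: swap_vars_mult swap_vars_power swap_vars_X_Suc swap_vars_flagged_below mult.commute)
  have "swap_vars j (X i ^ q) = X i ^ q" if "Suc i \<le> j" for j q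
    using that by (simp add: swap_vars_power swap_vars_X_other)
  then have pull: "div_chain (Suc i) m (X i ^ q * f) = X i ^ q * div_chain (Suc i) m f" for q f
    by (intro div_chain_inert_mult) auto
  have "X i ^ Suc p * div_chain (Suc i) m (X (Suc i) ^ p * ?A) =
      div_chain (Suc i) m (X i ^ Suc p * (X (Suc i) ^ p * ?A))"
    by (simp only: pull)
  also have "X i ^ Suc p * (X (Suc i) ^ p * ?A) = ?P * X i"
    by (simp add: power_mult_distrib ac_simps)
  finally have "flagged \<mu> \<phi> (Suc (Suc r)) i = div_chain i m (div_chain (Suc i) m (?P * X i))"
    using assms p by (simp add: p_def)
  also have "\<dots> = div_chain i (m - 1) (div_chain i m (?P * X i))"
    by (rule div_chain_div_chain) simp
  also have "div_chain i m (?P * X i) = div_chain (Suc i) m ?P"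
    using assms(4) by (simp add: div_chain_first iso_div_diff_symmetric_mult[OF symP] iso_div_diff_X)
  also have "\<dots> = X i ^ p * div_chain (Suc i) m (X (Suc i) ^ p * ?A)"
    using pull[of p "X (Suc i) ^ p * ?A"] by (simp add: power_mult_distrib ac_simps)
  also have "div_chain i (m - 1) \<dots> = flagged \<mu> (\<phi>(i := m - 1)) (Suc (Suc r)) i"
  proof -
    have "flagged \<mu> (\<phi>(i := m - 1)) r (Suc (Suc i)) = ?A" by (rule flagged_cong) auto
    then show ?thesis using assms p by (simp add: p_def)
  qed
  finally show ?thesis .
qed

text \<open>
  The transition equation. In terms of fillings: row \<open>i\<close> either avoids \<open>m\<close>, or \<open>m\<close> shares its last box
  with smaller entries, or \<open>m\<close> is alone in its last box, which can then be removed.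
\<close>

lemma flagged_transition_row:
  assumes "\<And>j. i \<le> j \<Longrightarrow> j \<le> i + r \<Longrightarrow> \<phi> j = m" "i < m" "0 < \<mu> i"
  shows "flagged \<mu> \<phi> (Suc r) i =
    (1 - X m) * flagged \<mu> (\<phi>(i := m - 1)) (Suc r) i + X m * flagged (\<mu>(i := \<mu> i - 1)) \<phi> (Suc r) i"
proof -
  define p where "p = \<mu> i + m - Suc i"
  let ?A = "flagged \<mu> \<phi> r (Suc i)"
  have p: "\<mu> i + m - i = Suc p" "\<mu> i + (m - 1) - i = p" "\<mu> i - 1 + m - i = p"
    using assms(2,3) by (auto simp: p_def)
  have eqs: "flagged \<mu> (\<phi>(i := m - 1)) r (Suc i) = ?A" "flagged (\<mu>(i := \<mu> i - 1)) \<phi> r (Suc i) = ?A"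
    by (rule flagged_cong; simp)+
  have \<phi>: "\<phi> i = m" using assms(1) by simp
  have "swap_vars l (X i ^ p * ?A) = X i ^ p * ?A" if "i < l" "l < m" for l
    using that assms(1) swap_vars_flagged_constant_flag[of "Suc i" r \<phi> m l \<mu>]
    by (simp add: swap_vars_mult swap_vars_power swap_vars_X_other)
  then have "div_chain i m (X i * (X i ^ p * ?A)) =
      X m * div_chain i m (X i ^ p * ?A) + (1 - X m) * div_chain i (m - 1) (X i ^ p * ?A)"
    using assms(2) by (intro div_chain_X_mult) auto
  then show ?thesis
    unfolding flagged.simps fun_upd_same \<phi> p eqs power_Suc mult.assoc by (rule trans) (rule add.commute)
qed

text \<open>
  The rows above row \<open>t\<close> have flags below \<open>m\<close>, so their operators commute with coefficients that
  only involve variables of index at least \<open>m\<close>, and a linear relation for the lower rows extends to the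
  whole shape.
\<close>

lemma flagged_prepend_rows:
  assumes "flagged \<mu> \<phi> s t = a * flagged \<mu> \<phi>' s t + b * flagged \<mu>' \<phi> s t"
    and "\<And>j. Suc j < m \<Longrightarrow> swap_vars j a = a \<and> swap_vars j b = b"
    and "\<And>j. i \<le> j \<Longrightarrow> j < t \<Longrightarrow> \<phi>' j = \<phi> j \<and> \<mu>' j = \<mu> j \<and> \<phi> j < m" and "i \<le> t"
  shows "flagged \<mu> \<phi> (t - i + s) i =
     a * flagged \<mu> \<phi>' (t - i + s) i + b * flagged \<mu>' \<phi> (t - i + s) i"
  using assms(4,3)
proof (induction "t - i" arbitrary: i)
  case 0
  then show ?case using assms(1) by simp
next
  case (Suc d)
  let ?n = "t - Suc i + s"
  have n: "t - i + s = Suc ?n" using Suc by simp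
  have IH: "flagged \<mu> \<phi> ?n (Suc i) = a * flagged \<mu> \<phi>' ?n (Suc i) + b * flagged \<mu>' \<phi> ?n (Suc i)"
    using Suc.hyps(2) Suc.prems by (intro Suc.hyps) auto
  have i: "\<phi>' i = \<phi> i" "\<mu>' i = \<mu> i" "\<phi> i < m" using Suc by auto
  let ?P = "X i ^ (\<mu> i + \<phi> i - i)"
  have inert: "div_chain i (\<phi> i) (c * f) = c * div_chain i (\<phi> i) f" if "c = a \<or> c = b" for c f
    using that i assms(2) by (intro div_chain_inert_mult) auto
  have "div_chain i (\<phi> i) (?P * (a * u + b * v)) =
      a * div_chain i (\<phi> i) (?P * u) + b * div_chain i (\<phi> i) (?P * v)" for u v
    unfolding distrib_left div_chain_add mult.left_commute[of ?P] by (simp add: inert)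
  then show ?case unfolding n flagged.simps i IH by simp
qed

section \<open>Supports of sign-alternating polynomials\<close>

lemma lookup_X_mult: "Poly_Mapping.lookup (X i * f) (Poly_Mapping.single i 1 + k) = Poly_Mapping.lookup f k"
proof -
  have "X i * Poly_Mapping.single a (1::int) = Poly_Mapping.single (Poly_Mapping.single i 1 + a) 1" for a
    by (simp add: X_def mult_single)
  note single = this
  show ?thesis
    using subset_UNIV[of "Poly_Mapping.keys f"]
    by (induction f rule: frag_induction)
      (auto simp: single lookup_single when_def right_diff_distrib lookup_minus)
qed

lemma keys_X_mult: "Poly_Mapping.keys (X i * f) = (+) (Poly_Mapping.single i 1) ` Poly_Mapping.keys f"
proof
  show "Poly_Mapping.keys (X i * f) \<subseteq> (+) (Poly_Mapping.single i 1) ` Poly_Mapping.keys f"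
    using keys_mult[of "X i" f] by (auto simp: X_def)
  show "(+) (Poly_Mapping.single i 1) ` Poly_Mapping.keys f \<subseteq> Poly_Mapping.keys (X i * f)"
    by (auto simp: in_keys_iff lookup_X_mult simp del: One_nat_def)
qed

lemma mdeg_eq_sum: "finite A \<Longrightarrow> Poly_Mapping.keys m \<subseteq> A \<Longrightarrow> mdeg m = (\<Sum>i\<in>A. Poly_Mapping.lookup m i)"
  unfolding mdeg_def by (intro sum.mono_neutral_left) (auto simp: in_keys_iff)

lemma mdeg_add: "mdeg (a + b) = mdeg a + mdeg b"
proof -
  let ?A = "Poly_Mapping.keys a \<union> Poly_Mapping.keys b"
  have "Poly_Mapping.keys (a + b) \<subseteq> ?A" by (rule keys_add)
  then have "mdeg (a + b) = (\<Sum>i\<in>?A. Poly_Mapping.lookup (a + b) i)"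
    by (intro mdeg_eq_sum) auto
  then show ?thesis
    using mdeg_eq_sum[of ?A a] mdeg_eq_sum[of ?A b] by (simp add: lookup_add sum.distrib)
qed

lemma mdeg_single [simp]: "mdeg (Poly_Mapping.single i k) = k"
  by (cases "k = 0") (simp_all add: mdeg_def)

definition exp_vec :: "monom \<Rightarrow> nat \<Rightarrow> int" where
  "exp_vec m = (\<lambda>i. int (Poly_Mapping.lookup m i))"

lemma support_eq_image: "support f = exp_vec ` Poly_Mapping.keys f"
  unfolding support_def exp_vec_def by simp

lemma exp_vec_add: "exp_vec (a + b) = (\<lambda>i. exp_vec a i + exp_vec b i)"
  by (simp add: exp_vec_def lookup_add)

lemma exp_vec_single: "exp_vec (Poly_Mapping.single i 1) = unit_vec i"
  by (auto simp: exp_vec_def unit_vec_def lookup_single when_def)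

definition shift :: "nat \<Rightarrow> (nat \<Rightarrow> int) set \<Rightarrow> (nat \<Rightarrow> int) set" where
  "shift i S = (\<lambda>x l. x l + unit_vec i l) ` S"

text \<open>
  The sign of a coefficient is the parity of the degree plus \<open>a\<close>. Among polynomials with
  one sign pattern, addition cannot cancel, so supports can be computed with.
\<close>

definition alternating_with_support :: "nat \<Rightarrow> mpoly \<Rightarrow> (nat \<Rightarrow> int) set \<Rightarrow> bool" where
  "alternating_with_support a f S \<longleftrightarrow>
     (\<forall>m. (-1) ^ (mdeg m + a) * Poly_Mapping.lookup f m \<ge> 0) \<and> support f = S"

lemma alternating_one: "alternating_with_support 0 1 {\<lambda>i. 0}"
  unfolding alternating_with_support_def
  by (auto simp: support_def lookup_one mdeg_def when_def)

lemma alternating_add: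
  assumes "alternating_with_support a f S" "alternating_with_support a g T"
  shows "alternating_with_support a (f + g) (S \<union> T)"
proof -
  have pos: "0 \<le> (-1) ^ (mdeg m + a) * Poly_Mapping.lookup f m" "0 \<le> (-1) ^ (mdeg m + a) * Poly_Mapping.lookup g m" for m
    using assms by (auto simp: alternating_with_support_def)
  have "Poly_Mapping.lookup (f + g) m = 0 \<longleftrightarrow> Poly_Mapping.lookup f m = 0 \<and> Poly_Mapping.lookup g m = 0" for m
  proof -
    have "(-1 :: int) ^ (mdeg m + a) = 1 \<or> (-1 :: int) ^ (mdeg m + a) = -1"
      by (meson neg_one_even_power neg_one_odd_power)
    then show ?thesis using pos[of m] unfolding lookup_add by fastforce
  qed
  then have "Poly_Mapping.keys (f + g) = Poly_Mapping.keys f \<union> Poly_Mapping.keys g"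
    unfolding set_eq_iff Un_iff in_keys_iff by blast
  then have "support (f + g) = support f \<union> support g" by (simp add: support_eq_image image_Un)
  moreover have "0 \<le> (-1) ^ (mdeg m + a) * Poly_Mapping.lookup (f + g) m" for m
    unfolding lookup_add distrib_left using pos[of m] by (intro add_nonneg_nonneg)
  ultimately show ?thesis using assms unfolding alternating_with_support_def by blast
qed

lemma support_X_mult: "support (X i * f) = shift i (support f)"
proof -
  have "exp_vec (Poly_Mapping.single i 1 + m) = (\<lambda>l. exp_vec m l + unit_vec i l)" for m
    unfolding exp_vec_add exp_vec_single by (simp add: add.commute)
  then show ?thesis
    unfolding support_eq_image keys_X_mult shift_def image_image by (simp only:)
qed

lemma alternating_X_mult:
  assumes "alternating_with_support a f S"
  shows "alternating_with_support (Suc a) (X i * f) (shift i S)"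
    and "alternating_with_support a (- (X i * f)) (shift i S)"
proof -
  have pos: "0 \<le> (-1) ^ (mdeg m + Suc a) * Poly_Mapping.lookup (X i * f) m" for m
  proof (cases "m \<in> Poly_Mapping.keys (X i * f)")
    case True
    then obtain k where "m = Poly_Mapping.single i 1 + k" by (auto simp: keys_X_mult)
    then show ?thesis
      using assms unfolding alternating_with_support_def
      by (simp add: lookup_X_mult[simplified] mdeg_add)
  next
    case False
    then show ?thesis by (simp add: in_keys_iff)
  qed
  show "alternating_with_support (Suc a) (X i * f) (shift i S)"
    using pos assms by (simp add: alternating_with_support_def support_X_mult)
  have "support (- (X i * f)) = support (X i * f)" by (simp add: support_eq_image)
  then show "alternating_with_support a (- (X i * f)) (shift i S)"
    using pos assms by (simp add: alternating_with_support_def support_X_mult)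
qed

lemma alternating_transition:
  assumes "alternating_with_support a f S" "alternating_with_support b g T" "a = Suc b"
  shows "alternating_with_support a ((1 - X i) * f + X i * g) (S \<union> shift i S \<union> shift i T)"
proof -
  have "(1 - X i) * f + X i * g = f + - (X i * f) + X i * g" by (simp add: algebra_simps)
  moreover have "alternating_with_support a (f + - (X i * f) + X i * g) (S \<union> shift i S \<union> shift i T)"
    unfolding assms(3)
    by (intro alternating_add alternating_X_mult assms(2) assms(1)[unfolded assms(3)])
  ultimately show ?thesis by simp
qed

section \<open>Column sets and their exchange property\<close>

definition low :: "nat set \<Rightarrow> nat \<Rightarrow> nat" where
  "low I a = card (I \<inter> {..a})"

definition high :: "nat set \<Rightarrow> nat \<Rightarrow> nat" where
  "high I a = card (I \<inter> {a<..})"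

lemma low_plus_high: "finite I \<Longrightarrow> low I a + high I a = card I"
  unfolding low_def high_def by (subst card_Un_disjoint[symmetric]) (auto intro: arg_cong[of _ _ card])

lemma low_insert: "finite I \<Longrightarrow> m \<notin> I \<Longrightarrow> low (insert m I) a = low I a + (if m \<le> a then 1 else 0)"
  by (simp add: low_def Int_insert_left)

lemma high_insert: "finite I \<Longrightarrow> m \<notin> I \<Longrightarrow> high (insert m I) a = high I a + (if a < m then 1 else 0)"
  by (simp add: high_def Int_insert_left)

lemma low_mono: "finite I \<Longrightarrow> a \<le> b \<Longrightarrow> low I a \<le> low I b"
  unfolding low_def by (intro card_mono) auto

lemma high_antimono: "finite I \<Longrightarrow> a \<le> b \<Longrightarrow> high I b \<le> high I a"
  unfolding high_def by (intro card_mono) auto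

lemma low_le_card: "finite I \<Longrightarrow> low I a \<le> card I"
  unfolding low_def by (intro card_mono) auto

lemma high_0_iff: "finite I \<Longrightarrow> high I a = 0 \<longleftrightarrow> I \<subseteq> {..a}"
  by (auto simp: high_def not_less)

lemma low_full: "I \<subseteq> {..a} \<Longrightarrow> low I a = card I"
  by (simp add: low_def Int_absorb2)

lemma high_pred_le: "finite I \<Longrightarrow> high I (a - 1) \<le> Suc (high I a)"
proof -
  assume "finite I"
  moreover have "I \<inter> {a - 1<..} \<subseteq> insert a (I \<inter> {a<..})" by auto
  ultimately show ?thesis unfolding high_def
    by (metis card_insert_le_m1 card_mono card_insert_if finite_Int finite_insert le_SucI le_refl)
qed

lemma low_skip: "m \<notin> I \<Longrightarrow> low I (m - 1) = low I m"
  unfolding low_def by (rule arg_cong[of _ _ card]) (auto simp: le_less intro: Suc_leI)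

lemma high_skip: "m \<notin> I \<Longrightarrow> 0 < m \<Longrightarrow> high I (m - 1) = high I m"
  unfolding high_def by (rule arg_cong[of _ _ card]) (auto, metis Suc_lessI Suc_pred)

text \<open>
  The initial segment of \<open>A\<close> up to \<open>a\<close>, continued by \<open>B\<close>.
\<close>

definition splice :: "nat \<Rightarrow> nat set \<Rightarrow> nat set \<Rightarrow> nat set" where
  "splice a A B = (A \<inter> {..a}) \<union> (B \<inter> {a<..})"

lemma finite_splice: "finite A \<Longrightarrow> finite B \<Longrightarrow> finite (splice a A B)"
  by (simp add: splice_def)

lemma card_splice: "finite A \<Longrightarrow> finite B \<Longrightarrow> card (splice a A B) = low A a + high B a"
  unfolding splice_def low_def high_def by (rule card_Un_disjoint) auto

lemma low_splice_below: "b \<le> a \<Longrightarrow> low (splice a A B) b = low A b"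
  unfolding splice_def low_def by (rule arg_cong[of _ _ card]) auto

lemma high_splice_above: "a \<le> b \<Longrightarrow> high (splice a A B) b = high B b"
  unfolding splice_def high_def by (rule arg_cong[of _ _ card]) auto

lemma high_splice_below:
  assumes "finite A" "finite B" "b \<le> a"
  shows "high (splice a A B) b + high A a = high A b + high B a"
  using assms low_plus_high[OF finite_splice[OF assms(1,2)], of a b] card_splice[OF assms(1,2), of a]
    low_splice_below[OF assms(3), of A B] low_plus_high[OF assms(1), of a] low_plus_high[OF assms(1), of b]
  by simp

lemma splice_count:
  "of_bool (i \<in> splice a A B) + of_bool (i \<in> splice a B A) = (of_bool (i \<in> A) + of_bool (i \<in> B) :: int)"
  by (auto simp: splice_def)

text \<open>
  Going one step to the right, \<open>high J\<close> loses at most one and \<open>high I\<close> does not grow, so the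
  difference cannot jump over \<open>d\<close>.
\<close>

lemma exists_crossing:
  assumes fin: "finite I" "finite J"
    and lo: "high J a > high I a + d" and hi: "high J b \<le> high I b + d" and "a \<le> b"
  obtains c where "a \<le> c" "c \<le> b" "high J c = high I c + d"
proof -
  define c where "c = (LEAST c. a \<le> c \<and> high J c \<le> high I c + d)"
  have c: "a \<le> c" "high J c \<le> high I c + d"
    unfolding c_def using LeastI[of "\<lambda>c. a \<le> c \<and> high J c \<le> high I c + d" b] assms by auto
  have cb: "c \<le> b" unfolding c_def by (rule Least_le) (use assms in auto)
  have ac: "a < c" using c lo by (cases "a = c") auto
  then have "\<not> high J (c - 1) \<le> high I (c - 1) + d"
    using not_less_Least[of "c - 1" "\<lambda>c. a \<le> c \<and> high J c \<le> high I c + d"] by (auto simp: c_def)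
  moreover have "high J (c - 1) \<le> Suc (high J c)" "high I c \<le> high I (c - 1)"
    using high_pred_le[OF fin(2)] high_antimono[OF fin(1), of "c - 1" c] by simp_all
  ultimately show ?thesis using that[of c] c cb by linarith
qed

text \<open>
  The possible contents of a set-valued column of length \<open>l\<close> in which the entries of box \<open>q\<close> are
  positive and at most \<open>\<phi> q\<close>, and only box \<open>r\<close> may have more than one entry: box \<open>q > r\<close> and the boxes
  below it hold the \<open>l - q + 1\<close> largest elements. With \<open>\<phi> 0 = 0\<close>, the value \<open>r = 0\<close> says that
  every box has exactly one entry.
\<close>

definition column_sets :: "(nat \<Rightarrow> nat) \<Rightarrow> nat \<Rightarrow> nat \<Rightarrow> nat set set" where
  "column_sets \<phi> l r = {I. finite I \<and> 0 \<notin> I \<and> (\<forall>q\<le>l. q \<le> low I (\<phi> q)) \<and>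
     (\<forall>q. r \<le> q \<and> q \<le> l \<longrightarrow> high I (\<phi> q) \<le> l - q)}"

lemma column_setsI:
  assumes "finite I" "0 \<notin> I" "\<And>q. q \<le> l \<Longrightarrow> q \<le> low I (\<phi> q)"
    "\<And>q. r \<le> q \<Longrightarrow> q \<le> l \<Longrightarrow> high I (\<phi> q) \<le> l - q"
  shows "I \<in> column_sets \<phi> l r"
  using assms by (simp add: column_sets_def)

lemma column_setsD:
  assumes "I \<in> column_sets \<phi> l r"
  shows "finite I" "0 \<notin> I" "\<And>q. q \<le> l \<Longrightarrow> q \<le> low I (\<phi> q)"
    "\<And>q. r \<le> q \<Longrightarrow> q \<le> l \<Longrightarrow> high I (\<phi> q) \<le> l - q" "l \<le> card I"
proof -
  show *: "finite I" "0 \<notin> I" "\<And>q. q \<le> l \<Longrightarrow> q \<le> low I (\<phi> q)"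
    "\<And>q. r \<le> q \<Longrightarrow> q \<le> l \<Longrightarrow> high I (\<phi> q) \<le> l - q"
    using assms by (auto simp: column_sets_def)
  show "l \<le> card I" using *(3)[of l] low_le_card[OF *(1), of "\<phi> l"] by simp
qed

lemma column_sets_bounded: "I \<in> column_sets \<phi> l r \<Longrightarrow> r \<le> l \<Longrightarrow> I \<subseteq> {..\<phi> l}"
  using column_setsD(1)[of I \<phi> l r] column_setsD(4)[of I \<phi> l r l] high_0_iff[of I "\<phi> l"] by simp

text \<open>
  An \<open>m\<close> can be added to the last box of a column that may have a multiple box there.
\<close>

lemma column_sets_gain_mono: "r \<le> r' \<Longrightarrow> column_sets \<phi> l r \<subseteq> column_sets \<phi> l r'"
  by (auto simp: column_sets_def)

lemma column_sets_flag_mono: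
  assumes "\<And>q. q \<le> l \<Longrightarrow> \<phi>' q \<le> \<phi> q"
  shows "column_sets \<phi>' l r \<subseteq> column_sets \<phi> l r"
proof
  fix I assume I: "I \<in> column_sets \<phi>' l r"
  note ID = column_setsD[OF I]
  show "I \<in> column_sets \<phi> l r"
  proof (rule column_setsI[OF ID(1,2)])
    show "q \<le> low I (\<phi> q)" if "q \<le> l" for q
      using ID(3)[OF that] low_mono[OF ID(1) assms[OF that]] by simp
    show "high I (\<phi> q) \<le> l - q" if "r \<le> q" "q \<le> l" for q
      using ID(4)[OF that] high_antimono[OF ID(1) assms[OF that(2)]] by simp
  qed
qed

text \<open>
  The right to have a multiple box can be handed to the shorter column. If \<open>J\<close> does not already obey the
  stricter bounds, take the last violated one. There \<open>J\<close> has too many large elements compared with \<open>I\<close>,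
  whereas at the end of the shorter column it has not, so in between there is a position at which the
  excess is exactly the difference of the lengths. Swapping the initial segments of \<open>I\<close> and \<open>J\<close> up to
  that position turns the bounds of each of the two sets into those of the other.
\<close>

lemma column_sets_exchange:
  assumes mono: "\<And>q q'. q \<le> q' \<Longrightarrow> q' \<le> l' \<Longrightarrow> \<phi> q \<le> \<phi> q'"
    and len: "l \<le> l'" and r: "r < r'" "r' \<le> l"
    and I: "I \<in> column_sets \<phi> l r" and J: "J \<in> column_sets \<phi> l' r'"
  obtains I' J' where "I' \<in> column_sets \<phi> l r'" "J' \<in> column_sets \<phi> l' r"
    "\<And>i. of_bool (i \<in> I') + of_bool (i \<in> J') = (of_bool (i \<in> I) + of_bool (i \<in> J) :: int)"
proof (cases "J \<in> column_sets \<phi> l' r")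
  case True
  then show ?thesis using that[of I J] column_sets_gain_mono[of r r' \<phi> l] I r by auto
next
  case False
  note ID = column_setsD[OF I] and JD = column_setsD[OF J]
  \<comment> \<open>Only the bounds for rows \<open>r, \<dots>, r' - 1\<close> are new for \<open>J\<close>.\<close>
  define bad where "bad q \<longleftrightarrow> r \<le> q \<and> q < r' \<and> l' - q < high J (\<phi> q)" for q
  have "\<exists>q. bad q"
  proof (rule ccontr)
    assume "\<nexists>q. bad q"
    then have "J \<in> column_sets \<phi> l' r" using JD by (intro column_setsI) (auto simp: bad_def not_less)
    then show False using False by simp
  qed
  then obtain q0 where "bad q0" by blast
  define p where "p = (GREATEST q. bad q)"
  have p: "bad p" and p_max: "\<And>q. bad q \<Longrightarrow> q \<le> p"
  proof -
    have b: "q \<le> r'" if "bad q" for q using that by (simp add: bad_def)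
    show "bad p" unfolding p_def by (rule GreatestI_nat[of bad q0 r']) (use \<open>bad q0\<close> b in auto)
    show "q \<le> p" if "bad q" for q unfolding p_def by (rule Greatest_le_nat[of bad q r']) (use that b in auto)
  qed
  then have pb: "r \<le> p" "p < r'" "l' - p < high J (\<phi> p)" by (auto simp: bad_def)
  have good: "high J (\<phi> q) \<le> l' - q" if "p < q" "q \<le> l'" for q
  proof (cases "q < r'")
    case True
    then have "\<not> bad q" using p_max[of q] that by auto
    then show ?thesis using True that pb by (simp add: bad_def not_less)
  next
    case False
    then show ?thesis using JD(4)[of q] that by simp
  qed
  obtain a where a: "\<phi> p \<le> a" "a \<le> \<phi> l" "high J a = high I a + (l' - l)"
  proof (rule exists_crossing[of I J "\<phi> p" "l' - l" "\<phi> l"])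
    show "high I (\<phi> p) + (l' - l) < high J (\<phi> p)" using ID(4)[of p] pb len r by simp
    show "high J (\<phi> l) \<le> high I (\<phi> l) + (l' - l)" using JD(4)[of l] r len by simp
    show "\<phi> p \<le> \<phi> l" using mono[of p l] pb r len by simp
  qed (use ID JD in auto)
  let ?I = "splice a J I" and ?J = "splice a I J"
  have fin: "finite ?I" "finite ?J" using ID JD by (auto intro: finite_splice)
  have hiI: "high ?I b + (l' - l) = high J b" if "b \<le> a" for b
    using high_splice_below[OF JD(1) ID(1) that] a(3) by simp
  have hiJ: "high ?J b = high I b + (l' - l)" if "b \<le> a" for b
    using high_splice_below[OF ID(1) JD(1) that] a(3) by simp
  have cards: "card ?I + (l' - l) = card J" "card ?J = card I + (l' - l)"
    using card_splice[OF JD(1) ID(1), of a] card_splice[OF ID(1) JD(1), of a] a(3)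
      low_plus_high[OF JD(1), of a] low_plus_high[OF ID(1), of a] by simp_all
  have q_less: "q < l" if "\<phi> q < a" "q \<le> l'" for q
    using that a(2) mono[of l q] by (cases "l \<le> q") auto
  have q_gt: "p < q" if "a < \<phi> q" "q \<le> l'" for q
    using that a(1) mono[of q p] pb r len by (cases "q \<le> p") auto
  have upI: "high ?I (\<phi> q) \<le> l - q" if "r' \<le> q" "q \<le> l" for q
  proof (cases "\<phi> q \<le> a")
    case True
    then show ?thesis using hiI[OF True] JD(4)[of q] that len by simp
  next
    case F: False
    then show ?thesis using high_splice_above[of a "\<phi> q" J I] ID(4)[of q] that r by simp
  qed
  have upJ: "high ?J (\<phi> q) \<le> l' - q" if "r \<le> q" "q \<le> l'" for q
  proof (cases "\<phi> q < a")
    case True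
    then show ?thesis using hiJ[of "\<phi> q"] ID(4)[of q] q_less[of q] that len by simp
  next
    case F: False
    show ?thesis
    proof (cases "p < q")
      case True
      then show ?thesis using high_splice_above[of a "\<phi> q" I J] F good[of q] that by simp
    next
      case F': False
      then have "\<phi> q = a" using F a(1) mono[of q p] pb r len by simp
      then show ?thesis using hiJ[of "\<phi> q"] ID(4)[of q] that F' pb r len by simp
    qed
  qed
  have loI: "q \<le> low ?I (\<phi> q)" if "q \<le> l" for q
  proof (cases "\<phi> q \<le> a")
    case True
    then show ?thesis using low_splice_below[OF True, of J I] JD(3)[of q] that len by simp
  next
    case F: False
    then have "high ?I (\<phi> q) \<le> l - q"
      using high_splice_above[of a "\<phi> q" J I] ID(4)[of q] that q_gt[of q] pb len by simp
    then show ?thesis using low_plus_high[OF fin(1), of "\<phi> q"] cards JD(5) that len by simp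
  qed
  have loJ: "q \<le> low ?J (\<phi> q)" if "q \<le> l'" for q
  proof (cases "\<phi> q \<le> a")
    case T: True
    show ?thesis
    proof (cases "q \<le> l")
      case True
      then show ?thesis using low_splice_below[OF T, of I J] ID(3)[of q] by simp
    next
      case F: False
      then have "\<phi> q = a" using T q_less[of q] that by force
      then have "high ?J (\<phi> q) \<le> l' - q" using upJ[of q] F that r by simp
      then show ?thesis using low_plus_high[OF fin(2), of "\<phi> q"] cards ID(5) that len by simp
    qed
  next
    case F: False
    then have "high ?J (\<phi> q) \<le> l' - q"
      using high_splice_above[of a "\<phi> q" I J] good[of q] q_gt[of q] that by simp
    then show ?thesis using low_plus_high[OF fin(2), of "\<phi> q"] cards ID(5) that len by simp
  qed
  have "0 \<notin> ?I" "0 \<notin> ?J" using ID(2) JD(2) by (auto simp: splice_def)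
  then have "?I \<in> column_sets \<phi> l r'" "?J \<in> column_sets \<phi> l' r"
    using fin upI upJ loI loJ by (auto intro: column_setsI)
  then show ?thesis by (rule that) (use splice_count[of _ a J I] in \<open>simp add: add.commute\<close>)
qed

section \<open>Sums of column sets\<close>

definition column_sum :: "nat \<Rightarrow> (nat \<Rightarrow> nat set) \<Rightarrow> nat \<Rightarrow> int" where
  "column_sum N I = (\<lambda>i. \<Sum>c<N. of_bool (i \<in> I c))"

text \<open>
  An assignment names for each column the row in which that column may have a multiple box, or \<open>0\<close> for
  none; each row is named by at most one column.
\<close>

definition assignments :: "nat \<Rightarrow> (nat \<Rightarrow> nat) \<Rightarrow> (nat \<Rightarrow> nat) set" where
  "assignments N l = {r. (\<forall>c<N. r c \<le> l c) \<and> (\<forall>c<N. \<forall>c'<N. c \<noteq> c' \<longrightarrow> r c = r c' \<longrightarrow> r c = 0)}"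

definition fillings :: "(nat \<Rightarrow> nat) \<Rightarrow> nat \<Rightarrow> (nat \<Rightarrow> nat) \<Rightarrow> (nat \<Rightarrow> nat) \<Rightarrow> (nat \<Rightarrow> nat set) set" where
  "fillings \<phi> N l r = {I. \<forall>c<N. I c \<in> column_sets \<phi> (l c) (r c)}"

text \<open>
  The union over all assignments is convenient for the recursion, where assignments carry over between
  shapes; it is shown below to be attained by a single assignment.
\<close>

definition filling_weights :: "(nat \<Rightarrow> nat) \<Rightarrow> nat \<Rightarrow> (nat \<Rightarrow> nat) \<Rightarrow> (nat \<Rightarrow> int) set" where
  "filling_weights \<phi> N l = (\<Union>r\<in>assignments N l. column_sum N ` fillings \<phi> N l r)"

lemma filling_weightsI:
  "r \<in> assignments N l \<Longrightarrow> I \<in> fillings \<phi> N l r \<Longrightarrow> x = column_sum N I \<Longrightarrow> x \<in> filling_weights \<phi> N l"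
  by (auto simp: filling_weights_def)

lemma filling_weightsE:
  assumes "x \<in> filling_weights \<phi> N l"
  obtains r I where "r \<in> assignments N l" "I \<in> fillings \<phi> N l r" "x = column_sum N I"
  using assms by (auto simp: filling_weights_def)

lemma column_sum_upd:
  assumes "c < N"
  shows "column_sum N (I(c := A)) i = column_sum N I i - of_bool (i \<in> I c) + of_bool (i \<in> A)"
proof -
  have "(\<Sum>d\<in>{..<N} - {c}. of_bool (i \<in> (I(c := A)) d) :: int) = (\<Sum>d\<in>{..<N} - {c}. of_bool (i \<in> I d))"
    by (rule sum.cong) auto
  moreover have "column_sum N J i = of_bool (i \<in> J c) + (\<Sum>d\<in>{..<N} - {c}. of_bool (i \<in> J d))" for J
    unfolding column_sum_def by (rule sum.remove) (use assms in auto)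
  ultimately show ?thesis by (simp only: fun_upd_same)
qed

text \<open>
  Two columns may trade their rows in the assignment if their contents can be rearranged accordingly.
\<close>

lemma exchange_columns:
  assumes r: "r \<in> assignments N l" and I: "I \<in> fillings \<phi> N l r"
    and c: "c < N" "c' < N" "c \<noteq> c'" and le: "r c' \<le> l c" "r c \<le> l c'"
    and A: "A \<in> column_sets \<phi> (l c) (r c')" and B: "B \<in> column_sets \<phi> (l c') (r c)"
    and count: "\<And>i. of_bool (i \<in> A) + of_bool (i \<in> B) = (of_bool (i \<in> I c) + of_bool (i \<in> I c') :: int)"
  shows "r(c := r c', c' := r c) \<in> assignments N l"
    and "I(c := A, c' := B) \<in> fillings \<phi> N l (r(c := r c', c' := r c))"
    and "column_sum N (I(c := A, c' := B)) = column_sum N I"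
proof -
  show "r(c := r c', c' := r c) \<in> assignments N l" using r c le by (auto simp: assignments_def)
  show "I(c := A, c' := B) \<in> fillings \<phi> N l (r(c := r c', c' := r c))"
    using I A B by (auto simp: fillings_def)
  show "column_sum N (I(c := A, c' := B)) = column_sum N I"
  proof
    fix i
    show "column_sum N (I(c := A, c' := B)) i = column_sum N I i"
      using count[of i] c by (simp add: column_sum_upd)
  qed
qed

lemma raise_gain:
  assumes r: "r \<in> assignments N l" and I: "I \<in> fillings \<phi> N l r"
    and c: "c < N" "r c \<le> a" "a \<le> l c" and new: "\<And>c'. c' < N \<Longrightarrow> c' \<noteq> c \<Longrightarrow> r c' \<noteq> a \<or> a = 0"
  shows "r(c := a) \<in> assignments N l" "I \<in> fillings \<phi> N l (r(c := a))"
proof -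
  show "r(c := a) \<in> assignments N l" using assms by (auto simp: assignments_def)
  show "I \<in> fillings \<phi> N l (r(c := a))"
    using I c column_sets_gain_mono[of "r c" a \<phi> "l c"] by (auto simp: fillings_def)
qed

text \<open>
  A filling can be rearranged, with the same weight, so that column \<open>c\<close> receives the row \<open>a\<close>: if
  another column, at least as long, holds that row then the exchange property applies, and if no column does then \<open>c\<close> may
  take it, since a larger named row only relaxes the bounds.
\<close>

lemma give_gain:
  assumes mono: "\<And>q q'. q \<le> q' \<Longrightarrow> q' \<le> k \<Longrightarrow> \<phi> q \<le> \<phi> q'"
    and lk: "\<And>c. c < N \<Longrightarrow> l c \<le> k"
    and r: "r \<in> assignments N l" and I: "I \<in> fillings \<phi> N l r"
    and c: "c < N" and a: "r c \<le> a" "a \<le> l c"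
    and longer: "\<And>c'. c' < N \<Longrightarrow> r c' = a \<Longrightarrow> a \<noteq> 0 \<Longrightarrow> l c \<le> l c'"
  obtains r' I' where "r' \<in> assignments N l" "I' \<in> fillings \<phi> N l r'"
    "column_sum N I' = column_sum N I" "r' c = a"
    "\<And>d. d \<noteq> c \<Longrightarrow> r d \<noteq> a \<or> a = 0 \<Longrightarrow> r' d = r d"
proof (cases "r c = a")
  case True
  then show ?thesis using that r I by blast
next
  case ne: False
  show ?thesis
  proof (cases "\<exists>c'<N. c' \<noteq> c \<and> r c' = a \<and> a \<noteq> 0")
    case True
    then obtain c' where c': "c' < N" "c' \<noteq> c" "r c' = a" "a \<noteq> 0" by blast
    have len: "l c \<le> l c'" using longer c' by simp
    have IJ: "I c \<in> column_sets \<phi> (l c) (r c)" "I c' \<in> column_sets \<phi> (l c') (r c')"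
      using I c c' by (auto simp: fillings_def)
    obtain A B where AB: "A \<in> column_sets \<phi> (l c) (r c')" "B \<in> column_sets \<phi> (l c') (r c)"
      "\<And>i. of_bool (i \<in> A) + of_bool (i \<in> B) = (of_bool (i \<in> I c) + of_bool (i \<in> I c') :: int)"
    proof (rule column_sets_exchange[OF _ len _ _ IJ])
      show "\<phi> q \<le> \<phi> q'" if "q \<le> q'" "q' \<le> l c'" for q q' using mono[OF that(1)] that lk[OF c'(1)] by simp
    qed (use a ne c' in auto)
    have le: "r c' \<le> l c" "r c \<le> l c'" using a c' len by auto
    note ex = exchange_columns[OF r I c c'(1) c'(2)[symmetric] le AB]
    show ?thesis by (rule that[OF ex]) (use c' in auto)
  next
    case False
    then have "r(c := a) \<in> assignments N l" "I \<in> fillings \<phi> N l (r(c := a))"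
      using raise_gain[OF r I c a] by blast+
    then show ?thesis using that[of "r(c := a)" I] by simp
  qed
qed

text \<open>
  The greedy assignment, which lets the columns choose in order of increasing length and each take the
  largest row still available, dominates: any assignment is changed into the greedy one column by column,
  without losing weights.
\<close>

lemma filling_weights_dominant_assignment:
  assumes mono: "\<And>q q'. q \<le> q' \<Longrightarrow> q' \<le> k \<Longrightarrow> \<phi> q \<le> \<phi> q'"
    and lk: "\<And>c. c < N \<Longrightarrow> l c \<le> k"
    and sorted: "\<And>c c'. c \<le> c' \<Longrightarrow> c' < N \<Longrightarrow> l c \<le> l c'"
  obtains g where "g \<in> assignments N l" "filling_weights \<phi> N l = column_sum N ` fillings \<phi> N l g"
proof -
  have "\<exists>g\<in>assignments N l. \<forall>x\<in>filling_weights \<phi> N l. \<exists>r\<in>assignments N l. (\<forall>c<j. r c = g c) \<and>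
      x \<in> column_sum N ` fillings \<phi> N l r" if "j \<le> N" for j
    using that
  proof (induction j)
    case 0
    have "(\<lambda>_. 0) \<in> assignments N l" by (auto simp: assignments_def)
    then show ?case by (intro bexI[of _ "\<lambda>_. 0"]) (auto simp: filling_weights_def)
  next
    case (Suc j)
    then obtain g where g: "g \<in> assignments N l"
      and dom: "\<And>x. x \<in> filling_weights \<phi> N l \<Longrightarrow> \<exists>r\<in>assignments N l. (\<forall>c<j. r c = g c) \<and>
         x \<in> column_sum N ` fillings \<phi> N l r"
      by auto
    define F where "F = {a. a \<le> l j \<and> (a = 0 \<or> a \<notin> g ` {..<j})}"
    define a where "a = Max F"
    have F: "finite F" "F \<noteq> {}" by (auto simp: F_def)
    then have aF: "a \<in> F" unfolding a_def by (rule Max_in)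
    define g' where "g' = (\<lambda>c. if c < j then g c else if c = j then a else 0)"
    have "g c' = 0" if "c < j" "c' < j" "c \<noteq> c'" "g c = g c'" for c c'
      using that g Suc.prems unfolding assignments_def by (smt (verit) Suc_le_lessD less_trans mem_Collect_eq)
    then have g': "g' \<in> assignments N l"
      using g aF Suc.prems by (auto simp: assignments_def g'_def F_def)
    have "\<exists>r\<in>assignments N l. (\<forall>c<Suc j. r c = g' c) \<and> x \<in> column_sum N ` fillings \<phi> N l r"
      if x: "x \<in> filling_weights \<phi> N l" for x
    proof -
      obtain r I where r: "r \<in> assignments N l" "\<And>c. c < j \<Longrightarrow> r c = g c"
        and I: "I \<in> fillings \<phi> N l r" "x = column_sum N I"
        using dom[OF x] by blast
      have jN: "j < N" using Suc.prems by simp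
      have "r j \<noteq> 0 \<Longrightarrow> r j \<notin> g ` {..<j}" using r jN unfolding assignments_def
        by (smt (verit) image_iff lessThan_iff mem_Collect_eq less_trans nat_neq_iff)
      then have "r j \<in> F" using r(1) jN by (auto simp: F_def assignments_def)
      then have ra: "r j \<le> a" unfolding a_def using F by simp
      have new: "j \<le> c'" if "r c' = a" "a \<noteq> 0" for c'
        using that aF r(2)[of c'] by (cases "c' < j") (auto simp: F_def)
      obtain r' I' where r': "r' \<in> assignments N l" "I' \<in> fillings \<phi> N l r'"
        "column_sum N I' = column_sum N I" "r' j = a" "\<And>d. d \<noteq> j \<Longrightarrow> r d \<noteq> a \<or> a = 0 \<Longrightarrow> r' d = r d"
      proof (rule give_gain[OF mono lk r(1) I(1) jN ra])
        show "a \<le> l j" using aF by (simp add: F_def)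
        show "l j \<le> l c'" if "c' < N" "r c' = a" "a \<noteq> 0" for c'
          using sorted[OF new] that by simp
      qed blast+
      have "r' c = g' c" if "c < Suc j" for c
      proof (cases "c = j")
        case True
        then show ?thesis using r'(4) by (simp add: g'_def)
      next
        case False
        then have c: "c < j" using that by simp
        have "r c \<noteq> a \<or> a = 0" using aF c r(2)[OF c] unfolding F_def by auto
        then have "r' c = r c" by (rule r'(5)[OF False])
        then show ?thesis using c r(2)[OF c] by (simp add: g'_def)
      qed
      then show ?thesis
        using r'(1,2,3) I(2) by (intro bexI[of _ r'] conjI image_eqI[of _ _ I']) auto
    qed
    then show ?case using g' by blast
  qed
  from this[of N] obtain g where g: "g \<in> assignments N l"
    and dom: "\<And>x. x \<in> filling_weights \<phi> N l \<Longrightarrow> \<exists>r\<in>assignments N l. (\<forall>c<N. r c = g c) \<and>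
         x \<in> column_sum N ` fillings \<phi> N l r"
    by auto
  have "filling_weights \<phi> N l \<subseteq> column_sum N ` fillings \<phi> N l g"
  proof
    fix x assume "x \<in> filling_weights \<phi> N l"
    then obtain r where "\<forall>c<N. r c = g c" "x \<in> column_sum N ` fillings \<phi> N l r" using dom by blast
    moreover from this have "fillings \<phi> N l r = fillings \<phi> N l g" by (auto simp: fillings_def)
    ultimately show "x \<in> column_sum N ` fillings \<phi> N l g" by simp
  qed
  moreover have "column_sum N ` fillings \<phi> N l g \<subseteq> filling_weights \<phi> N l"
    using g by (auto simp: filling_weights_def)
  ultimately show ?thesis using that g by blast
qed

section \<open>The transition for fillings\<close>

text \<open>
  A column longer than \<open>t\<close> contains at most one \<open>m\<close>, and that one can be put below row \<open>t\<close>, so it does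
  not matter whether the flag of row \<open>t\<close> is \<open>m\<close> or \<open>m - 1\<close>.
\<close>

lemma column_sets_lower_flag:
  assumes mono: "\<And>q q'. q \<le> q' \<Longrightarrow> q' \<le> k \<Longrightarrow> \<phi> q \<le> \<phi> q'"
    and m: "\<And>i. t \<le> i \<Longrightarrow> i \<le> k \<Longrightarrow> \<phi> i = m" "0 < m" and l: "l \<le> k" "l \<noteq> t" "r \<le> l"
  shows "column_sets (\<phi>(t := m - 1)) l r = column_sets \<phi> l r"
proof (cases "l < t")
  case True
  then show ?thesis by (auto simp: column_sets_def)
next
  case False
  then have tl: "t < l" using l by simp
  have \<phi>: "\<phi> t = m" "\<phi> l = m" using m tl l by auto
  show ?thesis
  proof
    show "column_sets (\<phi>(t := m - 1)) l r \<subseteq> column_sets \<phi> l r"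
      using \<phi> by (intro column_sets_flag_mono) auto
    show "column_sets \<phi> l r \<subseteq> column_sets (\<phi>(t := m - 1)) l r"
    proof
      fix I assume I: "I \<in> column_sets \<phi> l r"
      note ID = column_setsD[OF I]
      have "high I m = 0" using ID(4)[of l] l \<phi> by simp
      then have hi: "high I (m - 1) \<le> 1" using high_pred_le[OF ID(1), of m] by simp
      then have "l \<le> Suc (low I (m - 1))" using low_plus_high[OF ID(1), of "m - 1"] ID(5) by simp
      then show "I \<in> column_sets (\<phi>(t := m - 1)) l r"
        using ID hi tl by (intro column_setsI) auto
    qed
  qed
qed

lemma column_sets_avoiding:
  assumes I: "I \<in> column_sets \<phi> l r" and "\<phi> t = m" "0 < m" "m \<notin> I"
  shows "I \<in> column_sets (\<phi>(t := m - 1)) l r"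
  using column_setsD[OF I] low_skip[OF assms(4)] high_skip[OF assms(4,3)] assms(2)
  by (intro column_setsI) auto

lemma column_sets_gain:
  assumes I: "I \<in> column_sets (\<phi>(t := m - 1)) t t" and "\<phi> t = m" "0 < m"
    and "\<And>q. q < t \<Longrightarrow> \<phi> q < m"
  shows "insert m I \<in> column_sets \<phi> t t" "m \<notin> I"
proof -
  note ID = column_setsD[OF I]
  have sub: "I \<subseteq> {..m - 1}" using column_sets_bounded[OF I] by simp
  then show m: "m \<notin> I" using assms(3) by auto
  show "insert m I \<in> column_sets \<phi> t t"
  proof (rule column_setsI)
    show "q \<le> low (insert m I) (\<phi> q)" if "q \<le> t" for q
      using ID(3)[OF that] low_mono[OF ID(1), of "m - 1" m] assms(2) m ID(1)
      by (cases "q = t") (auto simp: low_insert)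
    show "high (insert m I) (\<phi> q) \<le> t - q" if "t \<le> q" "q \<le> t" for q
      using that ID(1) m sub assms(2) high_0_iff[OF ID(1), of m] by (auto simp: high_insert)
  qed (use ID assms in auto)
qed

text \<open>
  Here the \<open>m\<close> fills a new box at the bottom.
\<close>

lemma column_sets_extend:
  assumes I: "I \<in> column_sets \<phi> (t - 1) r" and "\<phi> t = m" "0 < t" "r < t"
    and less: "\<And>q. q < t \<Longrightarrow> \<phi> q < m"
  shows "insert m I \<in> column_sets \<phi> t r" "m \<notin> I"
proof -
  note ID = column_setsD[OF I]
  have sub: "I \<subseteq> {..\<phi> (t - 1)}" using column_sets_bounded[OF I] assms by simp
  then show m: "m \<notin> I" using less[of "t - 1"] assms(3) by auto
  have subm: "I \<subseteq> {..m}" using sub less[of "t - 1"] assms(3) by auto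
  show "insert m I \<in> column_sets \<phi> t r"
  proof (rule column_setsI)
    show "q \<le> low (insert m I) (\<phi> q)" if "q \<le> t" for q
    proof (cases "q = t")
      case True
      then show ?thesis using ID(1,5) m subm assms(2) by (simp add: low_insert low_full)
    next
      case False
      then have "q \<le> t - 1" using that by simp
      then show ?thesis using ID(3)[of q] m ID(1) by (simp add: low_insert)
    qed
    show "high (insert m I) (\<phi> q) \<le> t - q" if "r \<le> q" "q \<le> t" for q
    proof (cases "q = t")
      case True
      then show ?thesis using ID(1) m subm assms(2) high_0_iff[OF ID(1), of m] by (simp add: high_insert)
    next
      case False
      then have "high I (\<phi> q) \<le> t - 1 - q" using ID(4)[of q] that by simp
      then show ?thesis using False that m ID(1) less[of q] by (simp add: high_insert)
    qed
  qed (use ID less[of 0] assms(3) in auto)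
qed

lemma low_remove: "finite I \<Longrightarrow> m \<in> I \<Longrightarrow> low (I - {m}) a = low I a - (if m \<le> a then 1 else 0)"
  using low_insert[of "I - {m}" m a] by (simp add: insert_absorb)

lemma high_remove: "finite I \<Longrightarrow> m \<in> I \<Longrightarrow> high (I - {m}) a = high I a - (if a < m then 1 else 0)"
  using high_insert[of "I - {m}" m a] by (simp add: insert_absorb)

text \<open>
  If the multiple box is above row \<open>t\<close> then the bottom box contains nothing but \<open>m\<close>.
\<close>

lemma column_sets_remove:
  assumes I: "I \<in> column_sets \<phi> t r" and "m \<in> I" "0 < t" "r < t"
    and less: "\<And>q. q < t \<Longrightarrow> \<phi> q < m"
  shows "I - {m} \<in> column_sets \<phi> (t - 1) r"
proof (rule column_setsI)
  note ID = column_setsD[OF I]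
  have qt: "q < t" if "q \<le> t - 1" for q using that assms(3) by simp
  show "q \<le> low (I - {m}) (\<phi> q)" if "q \<le> t - 1" for q
    using ID(1) ID(3)[of q] less[of q] assms(2) qt[OF that] by (simp add: low_remove)
  show "high (I - {m}) (\<phi> q) \<le> t - 1 - q" if "r \<le> q" "q \<le> t - 1" for q
    using that(1) ID(1) ID(4)[of q] less[of q] assms(2) qt[OF that(2)] by (simp add: high_remove)
qed (use column_setsD[OF I] in auto)

text \<open>
  The two cases are that \<open>m\<close> shares the bottom box with other entries, or is alone in it; in the latter
  case all boxes are single.
\<close>

lemma column_sets_remove_gain:
  assumes I: "I \<in> column_sets \<phi> t t" and "m \<in> I" "0 < t" "\<phi> t = m"
    and less: "\<And>q. q < t \<Longrightarrow> \<phi> q < m"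
  shows "I - {m} \<in> column_sets (\<phi>(t := m - 1)) t t \<or> I - {m} \<in> column_sets \<phi> (t - 1) 0"
proof -
  note ID = column_setsD[OF I]
  have "I \<subseteq> {..m}" using column_sets_bounded[OF I] assms(4) by simp
  then have "I - {m} \<subseteq> {..m - 1}" by (force simp: subset_iff)
  then have full: "low (I - {m}) (m - 1) = card (I - {m})" and hi: "high (I - {m}) (m - 1) = 0"
    using high_0_iff[of "I - {m}" "m - 1"] ID(1) by (auto intro: low_full)
  have lo: "q \<le> low (I - {m}) (\<phi> q)" if "q < t" for q
    using that ID(1) ID(3)[of q] less[of q] assms(2,3) by (simp add: low_remove)
  show ?thesis
  proof (cases "t \<le> card (I - {m})")
    case True
    then have "I - {m} \<in> column_sets (\<phi>(t := m - 1)) t t"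
      using ID(1,2) lo full hi by (intro column_setsI) auto
    then show ?thesis by blast
  next
    case False
    have "high (I - {m}) (\<phi> q) \<le> t - 1 - q" if "q \<le> t - 1" for q
    proof -
      have "q < t" using that assms(3) by simp
      then show ?thesis using low_plus_high[of "I - {m}" "\<phi> q"] lo[of q] False ID(1) by simp
    qed
    then have "I - {m} \<in> column_sets \<phi> (t - 1) 0"
      using ID(1,2) lo assms(3) by (intro column_setsI) auto
    then show ?thesis by blast
  qed
qed

lemma column_sum_insert:
  assumes "c < N" "m \<notin> I c"
  shows "column_sum N (I(c := insert m (I c))) = (\<lambda>i. column_sum N I i + unit_vec m i)"
  using assms by (auto simp: column_sum_upd unit_vec_def fun_eq_iff)

lemma column_sum_remove:
  assumes "c < N" "m \<in> I c"
  shows "column_sum N I = (\<lambda>i. column_sum N (I(c := I c - {m})) i + unit_vec m i)"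
  using assms by (auto simp: column_sum_upd unit_vec_def fun_eq_iff)

lemma filling_weights_straighten:
  assumes mono: "\<And>q q'. q \<le> q' \<Longrightarrow> q' \<le> k \<Longrightarrow> \<phi> q \<le> \<phi> q'"
    and m: "\<And>i. t \<le> i \<Longrightarrow> i \<le> k \<Longrightarrow> \<phi> i = m" "0 < m"
    and l: "\<And>c. c < N \<Longrightarrow> l c \<le> k \<and> l c \<noteq> t"
  shows "filling_weights (\<phi>(t := m - 1)) N l = filling_weights \<phi> N l"
proof -
  have "fillings (\<phi>(t := m - 1)) N l r = fillings \<phi> N l r" if "r \<in> assignments N l" for r
  proof -
    have "column_sets (\<phi>(t := m - 1)) (l c) (r c) = column_sets \<phi> (l c) (r c)" if "c < N" for c
      by (rule column_sets_lower_flag[of k])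
        (use mono m l[OF that] \<open>r \<in> assignments N l\<close> that in \<open>auto simp: assignments_def\<close>)
    then show ?thesis unfolding fillings_def by simp
  qed
  then show ?thesis unfolding filling_weights_def by simp
qed

text \<open>
  The weights of fillings obey the recursion of the transition equation, where \<open>c0\<close> is any column whose
  bottom box lies in row \<open>t\<close>. To add an \<open>m\<close> after lowering the flag, first hand the row \<open>t\<close> to the column
  \<open>c0\<close>. Conversely, take an \<open>m\<close> away from a column of length \<open>t\<close>, preferably from one that is not
  allowed a multiple box in row \<open>t\<close>: such a column loses its bottom box. If only the column with that
  permission contains \<open>m\<close> then no other column of length \<open>t\<close> does, and all of them also obey the lowered flag.
\<close>

lemma filling_weights_transition:
  assumes mono: "\<And>q q'. q \<le> q' \<Longrightarrow> q' \<le> k \<Longrightarrow> \<phi> q \<le> \<phi> q'"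
    and t: "0 < t" and m: "\<And>i. t \<le> i \<Longrightarrow> i \<le> k \<Longrightarrow> \<phi> i = m"
    and less: "\<And>i. i < t \<Longrightarrow> \<phi> i < m"
    and lk: "\<And>c. c < N \<Longrightarrow> l c \<le> k" and c0: "c0 < N" "l c0 = t"
  shows "filling_weights \<phi> N l =
    filling_weights (\<phi>(t := m - 1)) N l \<union> shift m (filling_weights (\<phi>(t := m - 1)) N l)
      \<union> shift m (filling_weights \<phi> N (l(c0 := t - 1)))"
proof -
  let ?\<phi> = "\<phi>(t := m - 1)" and ?l = "l(c0 := t - 1)"
  have m0: "0 < m" using less[OF t] by simp
  have \<phi>t: "\<phi> t = m" using m[of t] lk[OF c0(1)] c0 by simp
  have rl: "r c \<le> l c" if "r \<in> assignments N l" "c < N" for r c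
    using that by (auto simp: assignments_def)
  have sub1: "filling_weights ?\<phi> N l \<subseteq> filling_weights \<phi> N l"
  proof -
    have "column_sets ?\<phi> n r \<subseteq> column_sets \<phi> n r" for n r
      by (rule column_sets_flag_mono) (use \<phi>t in auto)
    then have "fillings ?\<phi> N l r \<subseteq> fillings \<phi> N l r" for r unfolding fillings_def by blast
    then show ?thesis unfolding filling_weights_def by blast
  qed
  have sub2: "shift m (filling_weights ?\<phi> N l) \<subseteq> filling_weights \<phi> N l"
  proof
    fix y assume "y \<in> shift m (filling_weights ?\<phi> N l)"
    then obtain r I where r: "r \<in> assignments N l" and I: "I \<in> fillings ?\<phi> N l r"
      and y: "y = (\<lambda>i. column_sum N I i + unit_vec m i)"
      by (auto simp: shift_def elim!: filling_weightsE)
    have mono': "?\<phi> q \<le> ?\<phi> q'" if "q \<le> q'" "q' \<le> k" for q q'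
    proof (cases "q' = t")
      case True
      then show ?thesis using less[of q] that by (cases "q = t") auto
    next
      case False
      then show ?thesis using mono[OF that] \<phi>t by auto
    qed
    obtain r' I' where r': "r' \<in> assignments N l" "I' \<in> fillings ?\<phi> N l r'"
      "column_sum N I' = column_sum N I" "r' c0 = t"
    proof (rule give_gain[OF mono' lk r I c0(1)])
      show "r c0 \<le> t" "t \<le> l c0" using rl[OF r c0(1)] c0 by auto
      show "l c0 \<le> l c'" if "c' < N" "r c' = t" for c' using rl[OF r that(1)] that c0 by simp
    qed blast+
    have "I' c0 \<in> column_sets ?\<phi> t t" using r' c0 by (auto simp: fillings_def)
    then have g: "insert m (I' c0) \<in> column_sets \<phi> t t" "m \<notin> I' c0"
      using column_sets_gain[of "I' c0" \<phi> t m] \<phi>t m0 less by blast+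
    have "I' \<in> fillings \<phi> N l r'"
    proof -
      have "column_sets ?\<phi> n r \<subseteq> column_sets \<phi> n r" for n r
        by (rule column_sets_flag_mono) (use \<phi>t in auto)
      then show ?thesis using r'(2) unfolding fillings_def by blast
    qed
    then have "I'(c0 := insert m (I' c0)) \<in> fillings \<phi> N l r'"
      using g c0 r'(4) by (auto simp: fillings_def)
    then show "y \<in> filling_weights \<phi> N l"
      using r'(1) column_sum_insert[of c0 N m I', OF c0(1) g(2)] r'(3) y by (auto intro: filling_weightsI)
  qed
  have sub3: "shift m (filling_weights \<phi> N ?l) \<subseteq> filling_weights \<phi> N l"
  proof
    fix y assume "y \<in> shift m (filling_weights \<phi> N ?l)"
    then obtain r I where r: "r \<in> assignments N ?l" and I: "I \<in> fillings \<phi> N ?l r"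
      and y: "y = (\<lambda>i. column_sum N I i + unit_vec m i)"
      by (auto simp: shift_def elim!: filling_weightsE)
    have "r c0 \<le> t - 1" using r c0 by (auto simp: assignments_def)
    then have rc: "r c0 < t" using t by simp
    have "I c0 \<in> column_sets \<phi> (t - 1) (r c0)" using I c0 unfolding fillings_def by fastforce
    then have e: "insert m (I c0) \<in> column_sets \<phi> t (r c0)" "m \<notin> I c0"
      using column_sets_extend[of "I c0" \<phi> t "r c0" m] \<phi>t t rc less by blast+
    have "r c \<le> l c" if "c < N" for c
      using r that c0 unfolding assignments_def by (cases "c = c0") fastforce+
    then have "r \<in> assignments N l" using r by (simp add: assignments_def)
    moreover have "I(c0 := insert m (I c0)) \<in> fillings \<phi> N l r"
      using e I c0 unfolding fillings_def by auto
    ultimately show "y \<in> filling_weights \<phi> N l"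
      using column_sum_insert[of c0 N m I, OF c0(1) e(2)] y by (auto intro: filling_weightsI)
  qed
  have sup: "x \<in> filling_weights ?\<phi> N l \<union> shift m (filling_weights ?\<phi> N l)
      \<union> shift m (filling_weights \<phi> N ?l)" if x: "x \<in> filling_weights \<phi> N l" for x
  proof -
    have lower: "I c \<in> column_sets ?\<phi> (l c) (r c)"
      if "r \<in> assignments N l" "I \<in> fillings \<phi> N l r" "c < N" "l c = t \<Longrightarrow> m \<notin> I c" for r I c
    proof (cases "l c = t")
      case True
      have "I c \<in> column_sets \<phi> (l c) (r c)" using that by (simp add: fillings_def)
      then show ?thesis by (rule column_sets_avoiding) (use that(4) True \<phi>t m0 in auto)
    next
      case False
      have "column_sets ?\<phi> (l c) (r c) = column_sets \<phi> (l c) (r c)"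
        by (rule column_sets_lower_flag[of k]) (use mono m m0 lk that False rl in auto)
      then show ?thesis using that by (auto simp: fillings_def)
    qed
    obtain r I where r: "r \<in> assignments N l" and I: "I \<in> fillings \<phi> N l r" and xI: "x = column_sum N I"
      using x by (rule filling_weightsE)
    have short: "x \<in> shift m (filling_weights \<phi> N ?l)"
      if "r \<in> assignments N l" "I \<in> fillings \<phi> N l r" "x = column_sum N I" "m \<in> I c0" "r c0 < t" for r I
    proof -
      have "I c0 - {m} \<in> column_sets \<phi> (t - 1) (r c0)"
        using that c0 t less by (intro column_sets_remove) (auto simp: fillings_def)
      then have "I(c0 := I c0 - {m}) \<in> fillings \<phi> N ?l r" using that(2) by (auto simp: fillings_def)
      moreover have "r \<in> assignments N ?l" using that(1,5) by (auto simp: assignments_def)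
      ultimately have "column_sum N (I(c0 := I c0 - {m})) \<in> filling_weights \<phi> N ?l"
        by (auto intro: filling_weightsI)
      then show ?thesis using column_sum_remove[of c0 N m I] c0 that(3,4) by (auto simp: shift_def)
    qed
    show ?thesis
    proof (cases "\<exists>c<N. l c = t \<and> m \<in> I c \<and> r c \<noteq> t")
      case True
      then obtain c where c: "c < N" "l c = t" "m \<in> I c" "r c \<noteq> t" by blast
      show ?thesis
      proof (cases "c = c0")
        case True
        then show ?thesis using short[OF r I xI] c rl[OF r c(1)] by auto
      next
        case False
        have le: "r c \<le> l c0" "r c0 \<le> l c" using rl[OF r c(1)] rl[OF r c0(1)] c c0 by auto
        have "I c \<in> column_sets \<phi> (l c0) (r c)" "I c0 \<in> column_sets \<phi> (l c) (r c0)"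
          using I c c0 by (auto simp: fillings_def)
        note ex = exchange_columns[OF r I c0(1) c(1) False[symmetric] le this, simplified]
        show ?thesis
          using short[OF ex(1,2)] ex(3) xI c rl[OF r c(1)] False by (auto simp: add.commute)
      qed
    next
      case none: False
      show ?thesis
      proof (cases "\<exists>c<N. l c = t \<and> m \<in> I c")
        case False
        then have "I \<in> fillings ?\<phi> N l r" using lower[OF r I] by (auto simp: fillings_def)
        then show ?thesis using r xI by (auto intro: filling_weightsI)
      next
        case True
        then obtain c where c: "c < N" "l c = t" "m \<in> I c" "r c = t" using none by blast
        have others: "m \<notin> I d" if "d < N" "l d = t" "d \<noteq> c" for d
        proof
          assume "m \<in> I d"
          then have "r d = t" using none that by blast
          then show False using r that c t unfolding assignments_def by force
        qed
        have "I c \<in> column_sets \<phi> t t" using I c by (auto simp: fillings_def)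
        then consider "I c - {m} \<in> column_sets ?\<phi> t t" | "I c - {m} \<in> column_sets \<phi> (t - 1) 0"
          using column_sets_remove_gain[of "I c" \<phi> t m] c t \<phi>t less by blast
        then show ?thesis
        proof cases
          case 1
          then have "I(c := I c - {m}) \<in> fillings ?\<phi> N l r"
            using lower[OF r I] c others by (auto simp: fillings_def)
          then have "column_sum N (I(c := I c - {m})) \<in> filling_weights ?\<phi> N l"
            using r by (auto intro: filling_weightsI)
          then show ?thesis using column_sum_remove[of c N m I] c xI by (auto simp: shift_def)
        next
          case 2
          \<comment> \<open>The column \<open>c\<close> loses its bottom box; renaming makes it the column \<open>c0\<close>.\<close>
          let ?r = "r(c := 0)"
          define r' where "r' = ?r(c := ?r c0, c0 := ?r c)"
          define I' where "I' = (I(c := I c - {m}))(c := (I(c := I c - {m})) c0, c0 := I c - {m})"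
          have r1: "r' \<in> assignments N ?l"
            using r c c0 by (auto simp: assignments_def r'_def)
          have "I' \<in> fillings \<phi> N ?l r'"
            using 2 I c c0 by (auto simp: fillings_def I'_def r'_def)
          then have "column_sum N I' \<in> filling_weights \<phi> N ?l" using r1 by (auto intro: filling_weightsI)
          moreover have "x = (\<lambda>i. column_sum N I' i + unit_vec m i)"
            unfolding xI column_sum_remove[of c N m I, OF c(1,3)]
            using c c0 by (cases "c = c0") (auto simp: I'_def column_sum_upd fun_eq_iff)
          ultimately show ?thesis by (auto simp: shift_def)
        qed
      qed
    qed
  qed
  show ?thesis using sub1 sub2 sub3 sup by blast
qed

section \<open>Supports of flagged Grothendieck polynomials\<close>

lemma column_sets_0: "\<phi> 0 = 0 \<Longrightarrow> column_sets \<phi> 0 0 = {{}}"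
proof -
  assume \<phi>: "\<phi> 0 = 0"
  have "I = {}" if "I \<in> column_sets \<phi> 0 0" for I
    using column_sets_bounded[OF that] column_setsD(2)[OF that] \<phi> by auto
  moreover have "{} \<in> column_sets \<phi> 0 0" by (rule column_setsI) (auto simp: high_def)
  ultimately show ?thesis by blast
qed

lemma filling_weights_empty_shape:
  assumes "\<phi> 0 = 0" "\<And>c. c < N \<Longrightarrow> l c = 0"
  shows "filling_weights \<phi> N l = {\<lambda>i. 0}"
proof -
  have *: "fillings \<phi> N l r = {I. \<forall>c<N. I c = {}}" if "r \<in> assignments N l" for r
    using that assms column_sets_0[of \<phi>, OF assms(1)] by (auto simp: fillings_def assignments_def)
  have "column_sum N ` {I. \<forall>c<N. I c = {}} = {\<lambda>i. 0}"
  proof -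
    have "column_sum N I = (\<lambda>i. 0)" if "\<forall>c<N. I c = {}" for I
      using that by (simp add: column_sum_def)
    then show ?thesis by (auto intro!: image_eqI[of _ _ "\<lambda>c. {}"])
  qed
  moreover have "(\<lambda>c. 0) \<in> assignments N l" by (simp add: assignments_def)
  ultimately show ?thesis unfolding filling_weights_def using * by auto
qed

text \<open>
  The first \<open>t\<close> boxes need \<open>t\<close> distinct positive entries.
\<close>

lemma filling_weights_flag_below_row:
  assumes "\<phi> t < t" "c < N" "l c = t"
  shows "filling_weights \<phi> N l = {}"
proof -
  have "column_sets \<phi> t r = {}" for r
  proof -
    have False if I: "I \<in> column_sets \<phi> t r" for I
    proof -
      note ID = column_setsD[OF I]
      have "I \<inter> {..\<phi> t} \<subseteq> {1..\<phi> t}" using ID(2) by (auto simp: Suc_le_eq intro: Nat.gr0I)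
      then have "low I (\<phi> t) \<le> card {1..\<phi> t}" unfolding low_def by (intro card_mono) auto
      then show False using ID(3)[of t] assms(1) by simp
    qed
    then show ?thesis by blast
  qed
  then have "fillings \<phi> N l r = {}" for r using assms by (auto simp: fillings_def)
  then show ?thesis by (simp add: filling_weights_def)
qed

lemma flag_mono_lower:
  fixes \<phi> :: "nat \<Rightarrow> nat"
  assumes mono: "\<And>q q'. q \<le> q' \<Longrightarrow> q' \<le> k \<Longrightarrow> \<phi> q \<le> \<phi> q'"
    and "\<phi> t = m" "\<And>i. i < t \<Longrightarrow> \<phi> i < m" and "q \<le> q'" "q' \<le> k"
  shows "(\<phi>(t := m - 1)) q \<le> (\<phi>(t := m - 1)) q'"
proof (cases "q' = t")
  case True
  then show ?thesis using assms(3)[of q] assms(4) by (cases "q = t") auto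
next
  case False
  then show ?thesis using mono[OF assms(4,5)] assms(2) by auto
qed

text \<open>
  Both sides satisfy the same recursion, which always acts on the first row \<open>t\<close> whose flag is the largest
  flag \<open>m\<close>. If no column ends in row \<open>t\<close>, the flag of that row can be lowered; otherwise the transition
  equation applies, or, when \<open>m = t\<close> and the row is therefore forced to consist of entries \<open>m\<close>, one box is
  split off as a factor \<open>x\<^sub>m\<close>.
\<close>

lemma flagged_alternating_support:
  assumes "\<And>q q'. q \<le> q' \<Longrightarrow> q' \<le> k \<Longrightarrow> \<phi> q \<le> \<phi> q'" and "\<phi> 0 = 0"
    and "\<And>q. q \<le> k \<Longrightarrow> q \<le> \<phi> q"
    and "\<And>c. c < N \<Longrightarrow> l c \<le> k"
    and "\<And>i. 1 \<le> i \<Longrightarrow> i \<le> k \<Longrightarrow> \<mu> i = card {c. c < N \<and> i \<le> l c}"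
  shows "alternating_with_support (\<Sum>c<N. l c) (flagged \<mu> \<phi> k 1) (filling_weights \<phi> N l)"
  using assms
proof (induction "k + (\<Sum>q\<le>k. \<phi> q) + (\<Sum>c<N. l c)" arbitrary: k \<phi> l \<mu> rule: less_induct)
  case less
  note mono = less.prems(1) and \<phi>0 = less.prems(2) and ge = less.prems(3) and lk = less.prems(4)
    and \<mu> = less.prems(5)
  show ?case
  proof (cases k)
    case 0
    then have "l c = 0" if "c < N" for c using lk[OF that] by simp
    then show ?thesis using filling_weights_empty_shape[of \<phi> N l] \<phi>0 0 alternating_one by simp
  next
    case k: (Suc k')
    show ?thesis
    proof (cases "\<exists>c<N. l c = k")
      case False
      then have lk': "l c \<le> k'" if "c < N" for c using lk[OF that] that k by fastforce
      have "{c. c < N \<and> k \<le> l c} = {}" using lk' k by fastforce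
      then have "\<mu> k = 0" using \<mu>[of k] k by simp
      then have eq: "flagged \<mu> \<phi> k 1 = flagged \<mu> \<phi> k' 1"
        using flagged_drop_row[of \<mu> 1 k' \<phi>] ge[of k] k by simp
      show ?thesis unfolding eq
        by (rule less.hyps) (use mono \<phi>0 ge lk' \<mu> k in auto)
    next
      case True
      define m where "m = \<phi> k"
      define t where "t = (LEAST i. \<phi> i = m)"
      have t: "\<phi> t = m" "t \<le> k" unfolding t_def
        by (rule LeastI[of _ k], simp add: m_def) (rule Least_le, simp add: m_def)
      have m: "k \<le> m" using ge by (simp add: m_def)
      have t0: "0 < t" using t(1) m k \<phi>0 by (cases "t = 0") auto
      have top: "\<phi> i = m" if "t \<le> i" "i \<le> k" for i
        using mono[of t i] mono[of i k] that t by (simp add: m_def)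
      have below: "\<phi> i < m" if "i < t" for i
        using mono[of i t] not_less_Least[of i "\<lambda>i. \<phi> i = m"] that t by (simp add: t_def le_neq_implies_less)
      let ?\<phi> = "\<phi>(t := m - 1)"
      have mono': "?\<phi> q \<le> ?\<phi> q'" if "q \<le> q'" "q' \<le> k" for q q'
        using flag_mono_lower[of k \<phi> t m q q'] mono t(1) below that by blast
      have sum_split: "(\<Sum>q\<le>k. f q) = f t + (\<Sum>q\<in>{..k} - {t}. f q)" for f :: "nat \<Rightarrow> nat"
        using t(2) by (simp add: sum.remove)
      have "(\<Sum>q\<in>{..k} - {t}. ?\<phi> q) = (\<Sum>q\<in>{..k} - {t}. \<phi> q)" by (rule sum.cong) auto
      then have dec: "(\<Sum>q\<le>k. ?\<phi> q) < (\<Sum>q\<le>k. \<phi> q)"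
        unfolding sum_split using t m k by simp
      have rows: "flagged \<mu> \<phi> k 1 = a * flagged \<mu> ?\<phi> k 1 + b * flagged \<mu>' \<phi> k 1"
        if "flagged \<mu> \<phi> (Suc (k - t)) t = a * flagged \<mu> ?\<phi> (Suc (k - t)) t + b * flagged \<mu>' \<phi> (Suc (k - t)) t"
          "\<And>j. Suc j < m \<Longrightarrow> swap_vars j a = a \<and> swap_vars j b = b" "\<And>j. j < t \<Longrightarrow> \<mu>' j = \<mu> j"
        for a b \<mu>'
      proof -
        have "flagged \<mu> \<phi> (t - 1 + Suc (k - t)) 1 =
            a * flagged \<mu> ?\<phi> (t - 1 + Suc (k - t)) 1 + b * flagged \<mu>' \<phi> (t - 1 + Suc (k - t)) 1"
          by (rule flagged_prepend_rows[where m = m, OF that(1)]) (use that(2,3) below t0 in auto)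
        moreover have "t - 1 + Suc (k - t) = k" using t0 t(2) by simp
        ultimately show ?thesis by (simp only:)
      qed
      have IH\<phi>: "alternating_with_support (\<Sum>c<N. l c) (flagged \<mu> ?\<phi> k 1) (filling_weights ?\<phi> N l)"
        if "t < m"
        by (rule less.hyps) (use dec mono' \<phi>0 t0 ge lk \<mu> that in auto)
      show ?thesis
      proof (cases "\<exists>c<N. l c = t")
        case none: False
        have tk: "t < k" using True none t(2) by (cases "t = k") auto
        then obtain r where r: "k - t = Suc r" by (cases "k - t") auto
        have "{c. c < N \<and> Suc t \<le> l c} = {c. c < N \<and> t \<le> l c}" using none by (auto simp: Suc_le_eq le_less)
        then have "\<mu> (Suc t) = \<mu> t" using \<mu>[of t] \<mu>[of "Suc t"] t0 tk by simp
        then have "flagged \<mu> \<phi> (Suc (k - t)) t = flagged \<mu> ?\<phi> (Suc (k - t)) t"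
          unfolding r using t top[of "Suc t"] tk m by (intro flagged_straighten_row) auto
        then have "flagged \<mu> \<phi> k 1 = flagged \<mu> ?\<phi> k 1"
          using rows[of 1 0 \<mu>] by simp
        moreover have "filling_weights ?\<phi> N l = filling_weights \<phi> N l"
          by (rule filling_weights_straighten[of k]) (use mono top m k lk none in auto)
        ultimately show ?thesis using IH\<phi> tk m by simp
      next
        case exc: True
        then obtain c0 where c0: "c0 < N" "l c0 = t" by blast
        let ?l = "l(c0 := t - 1)" and ?\<mu> = "\<mu>(t := \<mu> t - 1)"
        have weights: "filling_weights \<phi> N l =
          filling_weights ?\<phi> N l \<union> shift m (filling_weights ?\<phi> N l) \<union> shift m (filling_weights \<phi> N ?l)"
          by (rule filling_weights_transition[of k]) (use mono top below lk c0 t0 in auto)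
        have "(\<Sum>c\<in>{..<N} - {c0}. ?l c) = (\<Sum>c\<in>{..<N} - {c0}. l c)" by (rule sum.cong) auto
        then have size: "(\<Sum>c<N. l c) = Suc (\<Sum>c<N. ?l c)"
          using c0 t0 by (simp add: sum.remove[of "{..<N}" c0])
        have \<mu>': "?\<mu> i = card {c. c < N \<and> i \<le> ?l c}" if "1 \<le> i" "i \<le> k" for i
        proof (cases "i = t")
          case True
          have "{c. c < N \<and> t \<le> ?l c} = {c. c < N \<and> t \<le> l c} - {c0}" using t0 by auto
          then show ?thesis using \<mu>[OF that] c0 True by simp
        next
          case False
          then have "{c. c < N \<and> i \<le> ?l c} = {c. c < N \<and> i \<le> l c}" using c0 by auto
          then show ?thesis using \<mu>[OF that] False by simp
        qed
        have IHl: "alternating_with_support (\<Sum>c<N. ?l c) (flagged ?\<mu> \<phi> k 1) (filling_weights \<phi> N ?l)"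
        proof (rule less.hyps)
          show "k + sum \<phi> {..k} + sum ?l {..<N} < k + sum \<phi> {..k} + sum l {..<N}" using size by simp
          show "?l c \<le> k" if "c < N" for c using lk[OF that] t(2) by auto
        qed (use mono \<phi>0 ge \<mu>' in auto)
        have "c0 \<in> {c. c < N \<and> t \<le> l c}" using c0 by simp
        then have \<mu>t: "0 < \<mu> t" using \<mu>[of t] t0 t(2) by (auto simp: card_gt_0_iff)
        show ?thesis
        proof (cases "t < m")
          case True
          have "flagged \<mu> \<phi> (Suc (k - t)) t =
            (1 - X m) * flagged \<mu> ?\<phi> (Suc (k - t)) t + X m * flagged ?\<mu> \<phi> (Suc (k - t)) t"
            by (rule flagged_transition_row) (use top True \<mu>t t(2) in auto)
          then have "flagged \<mu> \<phi> k 1 = (1 - X m) * flagged \<mu> ?\<phi> k 1 + X m * flagged ?\<mu> \<phi> k 1"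
            by (rule rows) (auto simp: swap_vars_diff swap_vars_X_other)
          then show ?thesis
            using alternating_transition[OF IH\<phi>[OF True] IHl size] weights by simp
        next
          case F: False
          then have km: "t = k" "m = k" using m t(2) by auto
          have "\<mu> k = Suc (\<mu> k - 1)" using \<mu>t km by simp
          then have "X k ^ \<mu> k = X k * X k ^ (\<mu> k - 1)" by (metis power_Suc)
          then have "flagged \<mu> \<phi> (Suc (k - t)) t = 0 * flagged \<mu> ?\<phi> (Suc (k - t)) t + X m * flagged ?\<mu> \<phi> (Suc (k - t)) t"
            using km t(1) by simp
          then have "flagged \<mu> \<phi> k 1 = 0 * flagged \<mu> ?\<phi> k 1 + X m * flagged ?\<mu> \<phi> k 1"
            by (rule rows) (auto simp: swap_vars_X_other)
          moreover have "filling_weights ?\<phi> N l = {}"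
            by (rule filling_weights_flag_below_row[of _ t c0]) (use km k c0 in auto)
          ultimately show ?thesis
            using alternating_X_mult(1)[OF IHl, of m] weights size by (simp add: shift_def)
        qed
      qed
    qed
  qed
qed

section \<open>Lehmer codes\<close>

definition code :: "nat \<Rightarrow> (nat \<Rightarrow> nat) \<Rightarrow> nat \<Rightarrow> nat" where
  "code n w i = card {j. i < j \<and> j \<le> n \<and> w j < w i}"

lemma finite_code_set [simp]: "finite {j :: nat. i < j \<and> j \<le> n \<and> P j}"
  by (rule finite_subset[of _ "{..n}"]) auto

lemma inv_count_eq_sum_code: "inv_count n w = (\<Sum>i=1..n. code n w i)"
proof -
  have "{(i, j). 1 \<le> i \<and> i < j \<and> j \<le> n \<and> w j < w i} =
      (SIGMA i:{1..n}. {j. i < j \<and> j \<le> n \<and> w j < w i})"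
    by auto
  then show ?thesis by (simp add: inv_count_def code_def)
qed

lemma code_descent:
  assumes "j < n" "w (Suc j) < w j"
  shows "code n w (Suc j) < code n w j"
proof -
  have "insert (Suc j) {m. Suc j < m \<and> m \<le> n \<and> w m < w (Suc j)} \<subseteq> {m. j < m \<and> m \<le> n \<and> w m < w j}"
    using assms by auto
  then have "card (insert (Suc j) {m. Suc j < m \<and> m \<le> n \<and> w m < w (Suc j)}) \<le> code n w j"
    unfolding code_def by (intro card_mono) auto
  then show ?thesis by (simp add: code_def)
qed

lemma code_ascent:
  assumes "w j < w (Suc j)"
  shows "code n w j \<le> code n w (Suc j)"
  unfolding code_def using assms by (intro card_mono) (auto simp: Suc_le_eq le_less intro: Suc_lessI)

lemma ascent_iff_code:
  assumes "w permutes {1..n}" "j < n"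
  shows "w j < w (Suc j) \<longleftrightarrow> code n w j \<le> code n w (Suc j)"
proof -
  have "w j \<noteq> w (Suc j)" using permutes_inj[OF assms(1)] by (simp add: inj_eq)
  then show ?thesis using code_ascent[of w j n] code_descent[of j n w] assms(2) by fastforce
qed

lemma code_swap_pos:
  assumes "j < n" "w j < w (Suc j)"
  shows "code n (swap_pos j w) j = Suc (code n w (Suc j))"
    and "code n (swap_pos j w) (Suc j) = code n w j"
    and "\<And>i. i \<noteq> j \<Longrightarrow> i \<noteq> Suc j \<Longrightarrow> code n (swap_pos j w) i = code n w i"
proof -
  have "{m. j < m \<and> m \<le> n \<and> swap_pos j w m < swap_pos j w j} =
      insert (Suc j) {m. Suc j < m \<and> m \<le> n \<and> w m < w (Suc j)}"
    using assms by (auto simp: swap_pos_def transpose_def split: if_splits)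
  then show "code n (swap_pos j w) j = Suc (code n w (Suc j))" by (simp add: code_def)
  have "{m. Suc j < m \<and> m \<le> n \<and> swap_pos j w m < swap_pos j w (Suc j)} =
      {m. j < m \<and> m \<le> n \<and> w m < w j}"
    using assms by (auto simp: swap_pos_def transpose_def le_less intro: Suc_lessI split: if_splits)
  then show "code n (swap_pos j w) (Suc j) = code n w j" by (simp add: code_def)
  fix i assume i: "i \<noteq> j" "i \<noteq> Suc j"
  have "bij_betw (transpose j (j + 1)) {m. i < m \<and> m \<le> n \<and> swap_pos j w m < swap_pos j w i}
      {m. i < m \<and> m \<le> n \<and> w m < w i}"
    using i assms(1)
    by (intro bij_betw_byWitness[where f' = "transpose j (j + 1)"])
      (auto simp: swap_pos_def transpose_def split: if_splits)
  then show "code n (swap_pos j w) i = code n w i"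
    unfolding code_def by (rule bij_betw_same_card)
qed

lemma code_longest: "1 \<le> i \<Longrightarrow> i \<le> n \<Longrightarrow> code n (longest n) i = n - i"
proof -
  assume "1 \<le> i" "i \<le> n"
  then have "{j. i < j \<and> j \<le> n \<and> longest n j < longest n i} = {i<..n}"
    by (auto simp: longest_def)
  then show ?thesis by (simp add: code_def)
qed

lemma swap_vars_prod: "swap_vars j (\<Prod>i\<in>A. f i) = (\<Prod>i\<in>A. swap_vars j (f i))"
  by (induction A rule: infinite_finite_induct) (simp_all add: swap_vars_mult)

text \<open>
  At the first ascent \<open>j\<close> of a permutation with weakly decreasing code the entries \<open>j\<close> and \<open>j + 1\<close> of the code
  agree, and the entries before are strictly larger. So swapping the two values keeps the code weakly
  decreasing and multiplies the monomial by \<open>x\<^sub>j\<close>, which the divided difference removes again.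
\<close>

lemma grothendieck_dominant:
  assumes "w permutes {1..n}" "\<And>p q. 1 \<le> p \<Longrightarrow> p \<le> q \<Longrightarrow> q \<le> n \<Longrightarrow> code n w q \<le> code n w p"
  shows "grothendieck n w = (\<Prod>i=1..n. X i ^ code n w i)"
  using assms
proof (induction "\<Sum>i=1..n. i * w i" arbitrary: w rule: less_induct)
  case less
  note w = less.prems(1) and dom = less.prems(2)
  show ?case
  proof (cases "\<exists>j. 1 \<le> j \<and> j < n \<and> w j < w (j + 1)")
    case False
    then have "w = longest n" using no_ascent_longest[OF w] by blast
    then show ?thesis by (simp add: grothendieck_longest code_longest)
  next
    case True
    define j where "j = (LEAST j. 1 \<le> j \<and> j < n \<and> w j < w (j + 1))"
    have j: "1 \<le> j" "j < n" "w j < w (j + 1)"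
      unfolding j_def using LeastI_ex[OF True] by auto
    let ?w = "swap_pos j w"
    have c: "code n w (Suc j) = code n w j"
      using code_ascent[of w j n] dom[of j "Suc j"] j by simp
    have sw: "code n ?w j = Suc (code n w j)" "\<And>i. i \<noteq> j \<Longrightarrow> code n ?w i = code n w i"
      using code_swap_pos[of j n w] j c by (auto, metis)
    have prev: "code n w j < code n w i" if "1 \<le> i" "i < j" for i
    proof -
      have "\<not> w (j - 1) < w j"
        using not_less_Least[of "j - 1" "\<lambda>j. 1 \<le> j \<and> j < n \<and> w j < w (j + 1)"] that j
        by (auto simp: j_def)
      then have "code n w j < code n w (j - 1)"
        using ascent_iff_code[OF w, of "j - 1"] that j by (cases j) auto
      moreover have "code n w (j - 1) \<le> code n w i" using dom[of i "j - 1"] that j by (cases j) auto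
      ultimately show ?thesis by simp
    qed
    have "code n ?w q \<le> code n ?w p" if "1 \<le> p" "p \<le> q" "q \<le> n" for p q
      using that dom[OF that] prev[of p] sw by (cases "p = j"; cases "q = j") auto
    then have G: "grothendieck n ?w = (\<Prod>i=1..n. X i ^ code n ?w i)"
      using less.hyps[OF swap_pos_weight[OF j] swap_pos_permutes[OF w j(1,2)]] by blast
    let ?R = "{1..n} - {j} - {Suc j}"
    have split: "(\<Prod>i=1..n. f i) = f j * (f (Suc j) * (\<Prod>i\<in>?R. f i))" for f :: "nat \<Rightarrow> mpoly"
      using j by (simp add: prod.remove[of _ j] prod.remove[of _ "Suc j"])
    have R: "(\<Prod>i\<in>?R. X i ^ code n ?w i) = (\<Prod>i\<in>?R. X i ^ code n w i)"
      using sw by (intro prod.cong) auto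
    have "swap_vars j (\<Prod>i=1..n. X i ^ code n w i) = (\<Prod>i=1..n. X i ^ code n w i)"
    proof -
      have "swap_vars j (\<Prod>i\<in>?R. X i ^ code n w i) = (\<Prod>i\<in>?R. X i ^ code n w i)"
        unfolding swap_vars_prod by (rule prod.cong) (auto simp: swap_vars_power swap_vars_X_other)
      then show ?thesis unfolding split c
        by (simp add: swap_vars_mult swap_vars_power swap_vars_X_Suc ac_simps)
    qed
    moreover have "grothendieck n ?w = (\<Prod>i=1..n. X i ^ code n w i) * X j"
      unfolding G split R by (simp add: sw ac_simps)
    ultimately have "iso_div_diff j (grothendieck n ?w) = (\<Prod>i=1..n. X i ^ code n w i)"
      by (simp add: iso_div_diff_symmetric_mult iso_div_diff_X)
    then show ?thesis using grothendieck_step[OF w j] by simp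
  qed
qed

section \<open>Codes of vexillary permutations\<close>

lemma vexillaryD:
  assumes "vexillary n w" "1 \<le> i" "i < j" "j < k" "k < l" "l \<le> n" "w j < w i" "w i < w l"
  shows "w k \<le> w l"
  using assms unfolding vexillary_def by (meson not_le)

text \<open>
  If the entry at \<open>j\<close> were smaller than both, then \<open>i\<close> and a later position up to \<open>j\<close> would form the \<open>21\<close> of a pattern \<open>2143\<close>, whose \<open>43\<close>
  is supplied by the larger code at \<open>k\<close>.
\<close>

lemma vexillary_code_between:
  assumes w: "w permutes {1..n}" and vex: "vexillary n w"
    and ijk: "1 \<le> i" "i < j" "j < k" "k \<le> n" and le: "code n w i \<le> code n w k"
  shows "code n w i \<le> code n w j"
proof (rule ccontr)
  assume "\<not> code n w i \<le> code n w j"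
  then have cj: "code n w j < code n w i" by simp
  have inj: "w a = w b \<Longrightarrow> a = b" for a b using permutes_inj[OF w] by (simp add: inj_eq)
  show False
  proof (cases "w j < w i")
    case True
    have "{m. k < m \<and> m \<le> n \<and> w m < w k} \<subseteq> {m. k < m \<and> m \<le> n \<and> w m < w i}"
    proof
      fix q assume "q \<in> {m. k < m \<and> m \<le> n \<and> w m < w k}"
      then have q: "k < q" "q \<le> n" "w q < w k" by auto
      then have "\<not> w i < w q" using vexillaryD[OF vex ijk(1-3) q(1,2) True] by auto
      moreover have "w q \<noteq> w i" using inj[of q i] q ijk by auto
      ultimately show "q \<in> {m. k < m \<and> m \<le> n \<and> w m < w i}" using q by auto
    qed
    then have "code n w k \<le> card {m. k < m \<and> m \<le> n \<and> w m < w i}"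
      unfolding code_def by (intro card_mono) auto
    also have "\<dots> < card (insert j {m. k < m \<and> m \<le> n \<and> w m < w i})"
      using ijk by (subst card_insert_disjoint) auto
    also have "\<dots> \<le> code n w i" unfolding code_def by (rule card_mono) (use ijk True in auto)
    finally show False using le by simp
  next
    case False
    then have ij: "w i < w j" using inj[of i j] ijk by (cases "w i = w j") auto
    have "\<exists>p. i < p \<and> p < j \<and> w p < w i"
    proof (rule ccontr)
      assume "\<nexists>p. i < p \<and> p < j \<and> w p < w i"
      then have "code n w i \<le> code n w j"
      proof -
        have "{m. i < m \<and> m \<le> n \<and> w m < w i} \<subseteq> {m. j < m \<and> m \<le> n \<and> w m < w j}"
        proof
          fix m assume m: "m \<in> {m. i < m \<and> m \<le> n \<and> w m < w i}"
          then have "m \<noteq> j" "\<not> m < j" using \<open>\<nexists>p. i < p \<and> p < j \<and> w p < w i\<close> ij by auto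
          then show "m \<in> {m. j < m \<and> m \<le> n \<and> w m < w j}" using m ij by auto
        qed
        then show ?thesis unfolding code_def by (intro card_mono) auto
      qed
      then show False using cj by simp
    qed
    then obtain p where p: "i < p" "p < j" "w p < w i" by blast
    have nogap: "w q < w i" if "j < q" "q \<le> n" "w q < w j" for q
    proof (rule ccontr)
      assume "\<not> w q < w i"
      then have "w i < w q" using inj[of q i] that ijk by (cases "w q = w i") auto
      then show False using vexillaryD[OF vex ijk(1) p(1,2) that(1,2) p(3)] that by simp
    qed
    have "\<exists>q. k < q \<and> q \<le> n \<and> w q < w k \<and> \<not> w q < w j"
    proof (rule ccontr)
      assume "\<nexists>q. k < q \<and> q \<le> n \<and> w q < w k \<and> \<not> w q < w j"
      then have "code n w k \<le> code n w j"
        unfolding code_def using ijk by (intro card_mono) auto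
      then show False using cj le by simp
    qed
    then obtain q where q: "k < q" "q \<le> n" "w q < w k" "\<not> w q < w j" by blast
    have "w j < w q" using q inj[of q j] ijk by (cases "w q = w j") auto
    then show False
      using vexillaryD[OF vex ijk(1) p(1) _ q(1,2) p(3)] p ij ijk q by simp
  qed
qed

text \<open>
  Unless the set is empty, its members and the positions counted by the code at \<open>j\<close> all form an
  inversion with \<open>i\<close>: otherwise there would be a pattern \<open>2143\<close> whose \<open>2\<close> is at position \<open>i\<close>.
\<close>

lemma vexillary_code_gap:
  assumes w: "w permutes {1..n}" and vex: "vexillary n w"
    and ij: "1 \<le> i" "i < j" "j \<le> n" and le: "code n w j \<le> code n w i"
  shows "card {p. i < p \<and> p < j \<and> code n w p < code n w j} + code n w j \<le> code n w i"
proof -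
  have inj: "w a = w b \<Longrightarrow> a = b" for a b using permutes_inj[OF w] by (simp add: inj_eq)
  let ?P = "{p. i < p \<and> p < j \<and> code n w p < code n w j}" and ?Q = "{m. j < m \<and> m \<le> n \<and> w m < w j}"
  have below: "w p < w i" if p: "p \<in> ?P" for p
  proof (rule ccontr)
    assume "\<not> w p < w i"
    then have ip: "w i < w p" using inj[of p i] p by (cases "w p = w i") auto
    have "\<exists>q. i < q \<and> q < p \<and> w q < w i"
    proof (rule ccontr)
      assume none: "\<nexists>q. i < q \<and> q < p \<and> w q < w i"
      have "{m. i < m \<and> m \<le> n \<and> w m < w i} \<subseteq> {m. p < m \<and> m \<le> n \<and> w m < w p}"
      proof
        fix m assume m: "m \<in> {m. i < m \<and> m \<le> n \<and> w m < w i}"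
        then have "m \<noteq> p" "\<not> m < p" using none ip by auto
        then show "m \<in> {m. p < m \<and> m \<le> n \<and> w m < w p}" using m ip by auto
      qed
      then have "code n w i \<le> code n w p" unfolding code_def by (intro card_mono) auto
      then show False using le p by simp
    qed
    then obtain q where q: "i < q" "q < p" "w q < w i" by blast
    have nogap: "w s < w i" if "p < s" "s \<le> n" "w s < w p" for s
    proof (rule ccontr)
      assume "\<not> w s < w i"
      then have "w i < w s" using inj[of s i] that q by (cases "w s = w i") auto
      then show False using vexillaryD[OF vex ij(1) q(1,2) that(1,2) q(3)] that by simp
    qed
    have "\<exists>s. j < s \<and> s \<le> n \<and> w s < w j \<and> \<not> w s < w p"
    proof (rule ccontr)
      assume "\<nexists>s. j < s \<and> s \<le> n \<and> w s < w j \<and> \<not> w s < w p"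
      then have "code n w j \<le> code n w p" unfolding code_def using p by (intro card_mono) auto
      then show False using p by simp
    qed
    then obtain s where s: "j < s" "s \<le> n" "w s < w j" "\<not> w s < w p" by blast
    have "w i < w s" using ip s by simp
    then show False
      using vexillaryD[OF vex ij(1) q(1) _ s(1,2) q(3)] q s p by simp
  qed
  show ?thesis
  proof (cases "?P = {}")
    case True
    then show ?thesis using le by (metis add_0 card.empty)
  next
    case False
    then obtain p where p: "p \<in> ?P" by blast
    have "w s < w i" if "s \<in> ?Q" for s
    proof (rule ccontr)
      assume "\<not> w s < w i"
      then have "w i < w s" using inj[of s i] that ij by (cases "w s = w i") auto
      then show False using vexillaryD[OF vex ij(1) _ _ _ _ below[OF p], of j s] that p by simp
    qed
    then have sub: "?P \<union> ?Q \<subseteq> {m. i < m \<and> m \<le> n \<and> w m < w i}"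
      using below ij by auto
    have finP: "finite ?P" by (rule finite_subset[of _ "{..j}"]) auto
    have "card ?P + card ?Q = card (?P \<union> ?Q)"
      using finP by (intro card_Un_disjoint[symmetric]) auto
    also have "\<dots> \<le> code n w i" unfolding code_def[of n w i] by (rule card_mono[OF finite_code_set sub])
    finally show ?thesis by (simp add: code_def[of n w j])
  qed
qed

section \<open>Vexillary Grothendieck polynomials are flagged\<close>

text \<open>
  The value at position \<open>e\<close> is moved to position \<open>i\<close> by adjacent swaps. As the code at \<open>e\<close> is maximal on the
  range and grows with each swap, every swap goes along an ascent. The other entries of the code are
  only shifted by one position.
\<close>

lemma grothendieck_move_left:
  assumes "w permutes {1..n}" "1 \<le> i" "i \<le> e" "e \<le> n"
    and "\<And>p. i \<le> p \<Longrightarrow> p < e \<Longrightarrow> code n w p \<le> code n w e"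
  shows "\<exists>u. u permutes {1..n} \<and> grothendieck n w = div_chain i e (grothendieck n u) \<and>
    code n u i = code n w e + (e - i) \<and> (\<forall>p. i < p \<and> p \<le> e \<longrightarrow> code n u p = code n w (p - 1)) \<and>
    (\<forall>p. p < i \<or> e < p \<longrightarrow> code n u p = code n w p)"
  using assms(3,1,2,4,5)
proof (induction e arbitrary: w rule: dec_induct)
  case base
  then show ?case by (intro exI[of _ w]) auto
next
  case (step e)
  have asc: "w e < w (Suc e)" using step ascent_iff_code[of w n e] by simp
  let ?w = "swap_pos e w"
  have e: "1 \<le> e" "e < n" using step by auto
  have sw: "code n ?w e = Suc (code n w (Suc e))" "code n ?w (Suc e) = code n w e"
    "\<And>i. i \<noteq> e \<Longrightarrow> i \<noteq> Suc e \<Longrightarrow> code n ?w i = code n w i"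
    using code_swap_pos[of e n w] e(2) asc by blast+
  have "code n ?w p \<le> code n ?w e" if "i \<le> p" "p < e" for p
    using step.prems(4)[of p] that sw by simp
  then obtain u where u: "u permutes {1..n}" "grothendieck n ?w = div_chain i e (grothendieck n u)"
    "code n u i = code n ?w e + (e - i)" "\<And>p. i < p \<Longrightarrow> p \<le> e \<Longrightarrow> code n u p = code n ?w (p - 1)"
    "\<And>p. p < i \<or> e < p \<Longrightarrow> code n u p = code n ?w p"
    using step.IH[OF swap_pos_permutes[OF step.prems(1) e]] step.prems(2,3) by auto
  have "grothendieck n w = div_chain i (Suc e) (grothendieck n u)"
    using grothendieck_step[OF step.prems(1) e] asc u(2) step.hyps(1) by simp
  moreover have "code n u p = code n w (p - 1)" if "i < p" "p \<le> Suc e" for p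
    using u(4,5)[of p] that sw by (cases "p = Suc e") auto
  moreover have "code n u p = code n w p" if "p < i \<or> Suc e < p" for p
    using u(5)[of p] sw(3)[of p] that step.hyps(1) by auto
  moreover have "code n u i = code n w (Suc e) + (Suc e - i)" using u(3) sw(1) step.hyps(1) by simp
  ultimately show ?case using u(1) by blast
qed

text \<open>
  The code is sorted one row at a time. The entries before position \<open>i\<close> are already dominant, and \<open>f\<close> is
  the flag of the previous row. The largest remaining entry \<open>v\<close> is moved to position \<open>i\<close>, from the first
  place \<open>e\<close> at or after \<open>max f i\<close> where it occurs, so \<open>v\<close> and \<open>e\<close> become the next part and the next flag.
  Searching only from \<open>f\<close> on keeps the flags weakly increasing, and the remaining entries are
  weakly increasing up to \<open>f\<close>, so the search succeeds. Taking the first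
  occurrence keeps the result dominant: the places between \<open>f\<close> and \<open>e\<close> have smaller entries, and the gap property of
  codes bounds their number by the difference of the previous part \<open>L\<close> and \<open>v\<close>. The
  properties of codes of vexillary permutations that are used pass to subsequences, so the
  intermediate permutations need no further study.
\<close>

lemma grothendieck_flagged_from_row:
  assumes "w permutes {1..n}" "1 \<le> i" "i \<le> Suc n" "i \<le> Suc f" "f \<le> n"
    and gap: "\<And>p q. i \<le> p \<Longrightarrow> p < q \<Longrightarrow> q \<le> n \<Longrightarrow> code n w q \<le> code n w p \<Longrightarrow>
      card {k. p < k \<and> k < q \<and> code n w k < code n w q} + code n w q \<le> code n w p"
    and mid: "\<And>p q r. i \<le> p \<Longrightarrow> p < q \<Longrightarrow> q < r \<Longrightarrow> r \<le> n \<Longrightarrow> code n w p \<le> code n w r \<Longrightarrow>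
      code n w p \<le> code n w q"
    and inc: "\<And>p q. i \<le> p \<Longrightarrow> p \<le> q \<Longrightarrow> q \<le> f \<Longrightarrow> code n w p \<le> code n w q"
    and dom: "\<And>p q. 1 \<le> p \<Longrightarrow> p \<le> q \<Longrightarrow> q < i \<Longrightarrow> code n w q \<le> code n w p"
    and prev: "2 \<le> i \<Longrightarrow> code n w (i - 1) + (i - 1) = L + f"
    and prev_max: "\<And>p. 2 \<le> i \<Longrightarrow> i \<le> p \<Longrightarrow> p \<le> n \<Longrightarrow> code n w p \<le> L"
    and prev_gap: "\<And>e. 2 \<le> i \<Longrightarrow> i \<le> e \<Longrightarrow> f < e \<Longrightarrow> e \<le> n \<Longrightarrow>
      card {k. f < k \<and> k < e \<and> code n w k < code n w e} + code n w e \<le> L"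
  shows "\<exists>\<mu> \<phi>. (\<forall>p. i \<le> p \<and> p \<le> n \<longrightarrow> p \<le> \<phi> p \<and> \<phi> p \<le> n \<and> f \<le> \<phi> p \<and> (\<exists>q. i \<le> q \<and> q \<le> n \<and> \<mu> p = code n w q)) \<and>
      (\<forall>p q. i \<le> p \<and> p \<le> q \<and> q \<le> n \<longrightarrow> \<phi> p \<le> \<phi> q \<and> \<mu> q \<le> \<mu> p) \<and>
      (\<Sum>p=i..n. \<mu> p) = (\<Sum>p=i..n. code n w p) \<and>
      grothendieck n w = (\<Prod>p=1..<i. X p ^ code n w p) * flagged \<mu> \<phi> (Suc n - i) i"
  using assms
proof (induction "Suc n - i" arbitrary: i w f L)
  case 0
  then have i: "i = Suc n" by simp
  have "grothendieck n w = (\<Prod>p=1..n. X p ^ code n w p)"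
    by (rule grothendieck_dominant[OF 0(2)]) (use 0(10) i in auto)
  then show ?case using i by (simp add: atLeastLessThanSuc_atLeastAtMost)
next
  case (Suc d)
  let ?a = "code n w"
  note w = Suc.prems(1) and i1 = Suc.prems(2) and fi = Suc.prems(4) and fn = Suc.prems(5)
    and gap = Suc.prems(6) and mid = Suc.prems(7) and inc = Suc.prems(8) and dom = Suc.prems(9)
    and prev = Suc.prems(10) and prev_max = Suc.prems(11) and prev_gap = Suc.prems(12)
  have i_n: "i \<le> n" using Suc.hyps(2) by simp
  define v where "v = Max (?a ` {i..n})"
  have v_max: "?a p \<le> v" if "i \<le> p" "p \<le> n" for p
    unfolding v_def using that by (intro Max_ge) auto
  have "v \<in> ?a ` {i..n}" unfolding v_def using i_n by (intro Max_in) auto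
  then obtain p0 where p0: "i \<le> p0" "p0 \<le> n" "?a p0 = v" by auto
  define g where "g = max f i"
  have ex: "\<exists>p. g \<le> p \<and> p \<le> n \<and> ?a p = v"
  proof (cases "g \<le> p0")
    case True
    then show ?thesis using p0 by blast
  next
    case False
    then have "g = f" "p0 \<le> f" "i \<le> f" using p0 by (auto simp: g_def max_def split: if_splits)
    then have "?a f = v" using inc[of p0 f] v_max[of f] p0 fn by simp
    then show ?thesis using \<open>g = f\<close> fn by auto
  qed
  define e where "e = (LEAST p. g \<le> p \<and> p \<le> n \<and> ?a p = v)"
  have e: "g \<le> e" "e \<le> n" "?a e = v" unfolding e_def using LeastI_ex[OF ex] by auto
  have e_least: "?a p < v" if "g \<le> p" "p < e" for p
  proof -
    have "?a p \<noteq> v"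
      using not_less_Least[of p "\<lambda>p. g \<le> p \<and> p \<le> n \<and> ?a p = v", folded e_def] that e(2) by auto
    moreover have "i \<le> p" "p \<le> n" using that e(2) by (simp_all add: g_def)
    ultimately show ?thesis using v_max[of p] by simp
  qed
  have ie: "i \<le> e" and fe: "f \<le> e" using e(1) by (auto simp: g_def)
  have "?a p \<le> ?a e" if "i \<le> p" "p < e" for p using v_max[of p] that e by simp
  then obtain u where u: "u permutes {1..n}" "grothendieck n w = div_chain i e (grothendieck n u)"
    "code n u i = v + (e - i)" "\<And>p. i < p \<Longrightarrow> p \<le> e \<Longrightarrow> code n u p = ?a (p - 1)"
    "\<And>p. p < i \<or> e < p \<Longrightarrow> code n u p = ?a p"
    using grothendieck_move_left[OF w i1 ie e(2)] e(3) by blast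
  let ?b = "code n u"
  \<comment> \<open>The remaining entries of the new code are those of the old one without entry \<open>e\<close>.\<close>
  define \<sigma> where "\<sigma> p = (if p \<le> e then p - 1 else p)" for p :: nat
  have b\<sigma>: "?b p = ?a (\<sigma> p)" if "i < p" for p using u(4,5)[of p] that by (auto simp: \<sigma>_def)
  have \<sigma>: "i \<le> \<sigma> p" "p \<le> n \<Longrightarrow> \<sigma> p \<le> n" if "i < p" for p using that by (auto simp: \<sigma>_def)
  have \<sigma>_less: "\<sigma> p < \<sigma> q" if "i < p" "p < q" for p q using that by (auto simp: \<sigma>_def)
  \<comment> \<open>The new entry \<open>v + (e - i)\<close> does not exceed the one before it.\<close>
  have last_prev: "v + e \<le> ?a (i - 1) + i" if "2 \<le> i"
  proof (cases "f < e")
    case True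
    have "{k. f < k \<and> k < e \<and> ?a k < ?a e} = {f<..<e}"
      using e_least fi e(3) by (auto simp: g_def)
    then show ?thesis using prev_gap[OF that ie True e(2)] prev[OF that] True e(3) that by simp
  next
    case False
    then show ?thesis using prev_max[OF that ie e(2)] prev[OF that] fe e(3) that by simp
  qed
  have "\<exists>\<mu> \<phi>. (\<forall>p. Suc i \<le> p \<and> p \<le> n \<longrightarrow> p \<le> \<phi> p \<and> \<phi> p \<le> n \<and> e \<le> \<phi> p \<and>
        (\<exists>q. Suc i \<le> q \<and> q \<le> n \<and> \<mu> p = ?b q)) \<and>
      (\<forall>p q. Suc i \<le> p \<and> p \<le> q \<and> q \<le> n \<longrightarrow> \<phi> p \<le> \<phi> q \<and> \<mu> q \<le> \<mu> p) \<and>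
      (\<Sum>p=Suc i..n. \<mu> p) = (\<Sum>p=Suc i..n. ?b p) \<and>
      grothendieck n u = (\<Prod>p=1..<Suc i. X p ^ ?b p) * flagged \<mu> \<phi> (Suc n - Suc i) (Suc i)"
  proof (rule Suc.hyps(1))
    show "d = Suc n - Suc i" "u permutes {1..n}" "1 \<le> Suc i" "Suc i \<le> Suc n" "Suc i \<le> Suc e" "e \<le> n"
      using Suc.hyps(2) u(1) i_n ie e(2) by auto
    show "card {k. p < k \<and> k < q \<and> ?b k < ?b q} + ?b q \<le> ?b p"
      if pq: "Suc i \<le> p" "p < q" "q \<le> n" "?b q \<le> ?b p" for p q
    proof -
      have "\<sigma> ` {k. p < k \<and> k < q \<and> ?b k < ?b q} \<subseteq> {k. \<sigma> p < k \<and> k < \<sigma> q \<and> ?a k < ?a (\<sigma> q)}"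
        using pq b\<sigma> \<sigma>_less by auto
      moreover have "inj_on \<sigma> {k. p < k \<and> k < q \<and> ?b k < ?b q}"
      proof (rule inj_onI)
        fix x y assume "x \<in> {k. p < k \<and> k < q \<and> ?b k < ?b q}" "y \<in> {k. p < k \<and> k < q \<and> ?b k < ?b q}"
          and "\<sigma> x = \<sigma> y"
        then show "x = y" using \<sigma>_less[of x y] \<sigma>_less[of y x] pq by (cases x y rule: linorder_cases) auto
      qed
      ultimately have "card {k. p < k \<and> k < q \<and> ?b k < ?b q} \<le> card {k. \<sigma> p < k \<and> k < \<sigma> q \<and> ?a k < ?a (\<sigma> q)}"
        by (intro card_inj_on_le[of \<sigma>]) auto
      moreover have "card {k. \<sigma> p < k \<and> k < \<sigma> q \<and> ?a k < ?a (\<sigma> q)} + ?a (\<sigma> q) \<le> ?a (\<sigma> p)"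
        using pq b\<sigma> \<sigma>_less \<sigma> by (intro gap) auto
      ultimately show ?thesis using b\<sigma> pq by simp
    qed
    show "?b p \<le> ?b q" if "Suc i \<le> p" "p < q" "q < r" "r \<le> n" "?b p \<le> ?b r" for p q r
      using mid[of "\<sigma> p" "\<sigma> q" "\<sigma> r"] that b\<sigma> \<sigma>_less \<sigma> by simp
    show "?b p \<le> ?b q" if "Suc i \<le> p" "p \<le> q" "q \<le> e" for p q
      using mid[of "p - 1" "q - 1" e] v_max[of "p - 1"] that u(4)[of p] u(4)[of q] e by (cases "p = q") auto
    show "?b q \<le> ?b p" if "1 \<le> p" "p \<le> q" "q < Suc i" for p q
    proof (cases "q = i")
      case False
      then show ?thesis using dom[of p q] that u(5) by simp
    next
      case q: True
      show ?thesis
      proof (cases "p = i")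
        case False
        then have i2: "2 \<le> i" "p \<le> i - 1" "i - 1 < i" "p < i" using that q by auto
        then have "?a (i - 1) \<le> ?b p" using dom[of p "i - 1"] that i2 u(5)[of p] by simp
        then show ?thesis using last_prev[OF i2(1)] u(3) q ie by simp
      qed (simp add: q)
    qed
    show "?b (Suc i - 1) + (Suc i - 1) = v + e" using u(3) ie by simp
    show "?b p \<le> v" if "Suc i \<le> p" "p \<le> n" for p
      using v_max[of "\<sigma> p"] b\<sigma>[of p] \<sigma>[of p] that by simp
    show "card {k. e < k \<and> k < e' \<and> ?b k < ?b e'} + ?b e' \<le> v"
      if "Suc i \<le> e'" "e < e'" "e' \<le> n" for e'
    proof -
      have "{k. e < k \<and> k < e' \<and> ?b k < ?b e'} = {k. e < k \<and> k < e' \<and> ?a k < ?a e'}"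
        using u(5) that by auto
      then show ?thesis using gap[OF ie that(2,3)] v_max[of e'] u(5)[of e'] that e(3) by simp
    qed
  qed
  then obtain \<mu>' \<phi>' where
    row: "\<And>p. Suc i \<le> p \<Longrightarrow> p \<le> n \<Longrightarrow> p \<le> \<phi>' p \<and> \<phi>' p \<le> n \<and> e \<le> \<phi>' p \<and>
        (\<exists>q. Suc i \<le> q \<and> q \<le> n \<and> \<mu>' p = ?b q)"
    and mono: "\<And>p q. Suc i \<le> p \<Longrightarrow> p \<le> q \<Longrightarrow> q \<le> n \<Longrightarrow> \<phi>' p \<le> \<phi>' q \<and> \<mu>' q \<le> \<mu>' p"
    and sum: "(\<Sum>p=Suc i..n. \<mu>' p) = (\<Sum>p=Suc i..n. ?b p)"
    and G: "grothendieck n u = (\<Prod>p=1..<Suc i. X p ^ ?b p) * flagged \<mu>' \<phi>' (Suc n - Suc i) (Suc i)"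
    by blast
  define \<mu> where "\<mu> = \<mu>'(i := v)"
  define \<phi> where "\<phi> = \<phi>'(i := e)"
  have row': "\<exists>q. i \<le> q \<and> q \<le> n \<and> \<mu>' p = ?a q" if p: "Suc i \<le> p" "p \<le> n" for p
  proof -
    obtain q where q: "Suc i \<le> q" "q \<le> n" "\<mu>' p = ?b q" using row[OF p] by blast
    then show ?thesis using b\<sigma>[of q] \<sigma>[of q] by (intro exI[of _ "\<sigma> q"]) simp
  qed
  have 1: "p \<le> \<phi> p \<and> \<phi> p \<le> n \<and> f \<le> \<phi> p \<and> (\<exists>q. i \<le> q \<and> q \<le> n \<and> \<mu> p = ?a q)" if "i \<le> p" "p \<le> n" for p
  proof (cases "p = i")
    case True
    then show ?thesis using ie fe e by (auto simp: \<mu>_def \<phi>_def)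
  next
    case False
    then show ?thesis using row[of p] row'[of p] that fe by (auto simp: \<mu>_def \<phi>_def)
  qed
  have 2: "\<phi> p \<le> \<phi> q \<and> \<mu> q \<le> \<mu> p" if "i \<le> p" "p \<le> q" "q \<le> n" for p q
  proof (cases "p = i")
    case True
    then show ?thesis using row[of q] 1[of q] v_max that by (auto simp: \<mu>_def \<phi>_def)
  next
    case False
    then show ?thesis using mono[of p q] that by (auto simp: \<mu>_def \<phi>_def)
  qed
  have 3: "(\<Sum>p=i..n. \<mu> p) = (\<Sum>p=i..n. ?a p)"
  proof -
    have "(\<Sum>p=Suc i..n. ?b p) = (\<Sum>p\<in>{i..n} - {e}. ?a p)"
      by (rule sum.reindex_bij_witness[of _ "\<lambda>q. if q < e then Suc q else q" \<sigma>])
        (use b\<sigma> ie e(2) in \<open>auto simp: \<sigma>_def\<close>)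
    moreover have "(\<Sum>p=i..n. ?a p) = ?a e + (\<Sum>p\<in>{i..n} - {e}. ?a p)"
      using ie e(2) by (simp add: sum.remove)
    moreover have "(\<Sum>p=i..n. \<mu> p) = v + (\<Sum>p=Suc i..n. \<mu>' p)"
      unfolding sum.atLeast_Suc_atMost[OF i_n] by (simp add: \<mu>_def)
    ultimately show ?thesis using sum e(3) by simp
  qed
  have 4: "grothendieck n w = (\<Prod>p=1..<i. X p ^ ?a p) * flagged \<mu> \<phi> (Suc n - i) i"
  proof -
    let ?F = "flagged \<mu>' \<phi>' (n - i) (Suc i)"
    have F: "flagged \<mu> \<phi> (n - i) (Suc i) = ?F" by (rule flagged_cong) (auto simp: \<mu>_def \<phi>_def)
    have "(\<Prod>p=1..<i. X p ^ ?b p) = (\<Prod>p=1..<i. X p ^ ?a p)" using u(5) by (intro prod.cong) auto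
    then have "grothendieck n w = div_chain i e ((\<Prod>p=1..<i. X p ^ ?a p) * (X i ^ (v + (e - i)) * ?F))"
      unfolding u(2) G using i1 by (simp add: u(3) mult.assoc)
    also have "\<dots> = (\<Prod>p=1..<i. X p ^ ?a p) * div_chain i e (X i ^ (v + (e - i)) * ?F)"
      unfolding swap_vars_prod
      by (rule div_chain_inert_mult, unfold swap_vars_prod, rule prod.cong)
        (auto simp: swap_vars_power swap_vars_X_other)
    also have "div_chain i e (X i ^ (v + (e - i)) * ?F) = flagged \<mu> \<phi> (Suc n - i) i"
      using F ie i_n by (simp add: Suc_diff_le \<mu>_def \<phi>_def)
    finally show ?thesis .
  qed
  show ?case using 1 2 3 4 by blast
qed

theorem vexillary_grothendieck_flagged:
  assumes "w permutes {1..n}" "vexillary n w"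
  obtains \<mu> \<phi> where "\<And>p. 1 \<le> p \<Longrightarrow> p \<le> n \<Longrightarrow> p \<le> \<phi> p \<and> \<phi> p \<le> n"
    "\<And>p q. 1 \<le> p \<Longrightarrow> p \<le> q \<Longrightarrow> q \<le> n \<Longrightarrow> \<phi> p \<le> \<phi> q \<and> \<mu> q \<le> \<mu> p"
    "(\<Sum>p=1..n. \<mu> p) = inv_count n w" "grothendieck n w = flagged \<mu> \<phi> n 1"
proof -
  have "\<exists>\<mu> \<phi>. (\<forall>p. 1 \<le> p \<and> p \<le> n \<longrightarrow> p \<le> \<phi> p \<and> \<phi> p \<le> n \<and> 0 \<le> \<phi> p \<and> (\<exists>q. 1 \<le> q \<and> q \<le> n \<and> \<mu> p = code n w q)) \<and>
      (\<forall>p q. 1 \<le> p \<and> p \<le> q \<and> q \<le> n \<longrightarrow> \<phi> p \<le> \<phi> q \<and> \<mu> q \<le> \<mu> p) \<and>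
      (\<Sum>p=1..n. \<mu> p) = (\<Sum>p=1..n. code n w p) \<and>
      grothendieck n w = (\<Prod>p=1..<1. X p ^ code n w p) * flagged \<mu> \<phi> (Suc n - 1) 1"
    by (rule grothendieck_flagged_from_row[where L = 0])
      (use assms vexillary_code_gap[OF assms] vexillary_code_between[OF assms] in auto)
  then obtain \<mu> \<phi> where "\<forall>p. 1 \<le> p \<and> p \<le> n \<longrightarrow> p \<le> \<phi> p \<and> \<phi> p \<le> n"
    "\<forall>p q. 1 \<le> p \<and> p \<le> q \<and> q \<le> n \<longrightarrow> \<phi> p \<le> \<phi> q \<and> \<mu> q \<le> \<mu> p"
    "(\<Sum>p=1..n. \<mu> p) = (\<Sum>p=1..n. code n w p)" "grothendieck n w = flagged \<mu> \<phi> n 1"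
    by auto
  then show ?thesis by (intro that[of \<phi> \<mu>]) (auto simp: inv_count_eq_sum_code)
qed

section \<open>Minkowski sums of chain-constrained boxes\<close>

definition move :: "nat \<Rightarrow> nat \<Rightarrow> (nat \<Rightarrow> int) \<Rightarrow> nat \<Rightarrow> int" where
  "move i j x = (\<lambda>l. x l - unit_vec i l + unit_vec j l)"

lemma M_convex_iff:
  "M_convex I S \<longleftrightarrow> (\<forall>x\<in>S. \<forall>i. i \<notin> I \<longrightarrow> x i = 0) \<and>
     (\<forall>x\<in>S. \<forall>y\<in>S. \<forall>i\<in>I. y i < x i \<longrightarrow> (\<exists>j\<in>I. x j < y j \<and> move i j x \<in> S \<and> move j i y \<in> S))"
  by (auto simp: M_convex_def move_def)

lemma sum_move:
  assumes "finite A"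
  shows "sum (move i j x) A = sum x A - of_bool (i \<in> A) + of_bool (j \<in> A)"
proof -
  have "sum (unit_vec k) A = of_bool (k \<in> A)" for k
    using assms by (simp add: unit_vec_def)
  then show ?thesis by (simp add: move_def sum.distrib sum_subtractf)
qed

text \<open>
  Integer points of a box with a fixed coordinate sum and lower bounds on the sums over the prefixes of \<open>E\<close> with respect
  to an ordering by \<open>pos\<close>; \<open>C\<close> lists the constrained prefixes with their bounds.
\<close>

definition chain_box :: "nat set \<Rightarrow> (nat \<Rightarrow> nat) \<Rightarrow> (nat \<Rightarrow> int) \<Rightarrow> (nat \<times> int) set \<Rightarrow> int \<Rightarrow> (nat \<Rightarrow> int) set" where
  "chain_box E pos u C d = {x. (\<forall>i. i \<notin> E \<longrightarrow> x i = 0) \<and> (\<forall>i\<in>E. 0 \<le> x i \<and> x i \<le> u i) \<and>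
     sum x E = d \<and> (\<forall>(p, b)\<in>C. b \<le> sum x {i\<in>E. pos i \<le> p})}"

text \<open>
  Every coordinate and every prefix sum of \<open>z\<close> lies between those of \<open>x\<close> and \<open>y\<close>. Hence \<open>z\<close> satisfies
  any bounds on coordinates and prefix sums that \<open>x\<close> and \<open>y\<close> satisfy.
\<close>

definition between_int :: "int \<Rightarrow> int \<Rightarrow> int \<Rightarrow> bool" where
  "between_int a b c \<longleftrightarrow> min a b \<le> c \<and> c \<le> max a b"

definition between :: "nat set \<Rightarrow> (nat \<Rightarrow> nat) \<Rightarrow> (nat \<Rightarrow> int) \<Rightarrow> (nat \<Rightarrow> int) \<Rightarrow> (nat \<Rightarrow> int) \<Rightarrow> bool" where
  "between E pos x y z \<longleftrightarrow> (\<forall>l. between_int (x l) (y l) (z l)) \<and>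
     (\<forall>p. between_int (sum x {l\<in>E. pos l \<le> p}) (sum y {l\<in>E. pos l \<le> p}) (sum z {l\<in>E. pos l \<le> p}))"

lemma between_refl: "between E pos x y x"
  by (auto simp: between_def between_int_def)

lemma between_trans:
  assumes "between E pos x y w" "between E pos w y z"
  shows "between E pos x y z"
proof -
  have "between_int a b d" if "between_int a b c" "between_int c b d" for a b c d
    using that unfolding between_int_def by linarith
  then show ?thesis using assms unfolding between_def by blast
qed

lemma between_reflect:
  assumes "between E pos x y z"
  shows "between E pos x y (\<lambda>l. x l + y l - z l)"
proof -
  have "between_int a b (a + b - c)" if "between_int a b c" for a b c
    using that unfolding between_int_def by linarith
  then show ?thesis using assms unfolding between_def sum_subtractf sum.distrib by blast
qed

lemma chain_box_between:
  assumes "x \<in> chain_box E pos u C d" "y \<in> chain_box E pos u C d" "between E pos x y z" "sum z E = d"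
  shows "z \<in> chain_box E pos u C d"
proof -
  have z: "min (x l) (y l) \<le> z l" "z l \<le> max (x l) (y l)"
    "min (sum x {l\<in>E. pos l \<le> p}) (sum y {l\<in>E. pos l \<le> p}) \<le> sum z {l\<in>E. pos l \<le> p}" for l p
    using assms(3) by (auto simp: between_def between_int_def)
  have xy: "\<And>l. l \<notin> E \<Longrightarrow> x l = 0 \<and> y l = 0" "\<And>l. l \<in> E \<Longrightarrow> 0 \<le> x l \<and> x l \<le> u l \<and> 0 \<le> y l \<and> y l \<le> u l"
    "\<And>p b. (p, b) \<in> C \<Longrightarrow> b \<le> sum x {l\<in>E. pos l \<le> p} \<and> b \<le> sum y {l\<in>E. pos l \<le> p}"
    using assms(1,2) by (auto simp: chain_box_def)
  show ?thesis unfolding chain_box_def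
  proof (intro CollectI conjI allI ballI impI)
    show "z l = 0" if "l \<notin> E" for l using xy(1)[OF that] z(1,2)[of l] by simp
    show "0 \<le> z l" "z l \<le> u l" if "l \<in> E" for l using xy(2)[OF that] z(1,2)[of l] by linarith+
    fix pb assume "pb \<in> C"
    then show "case pb of (p, b) \<Rightarrow> b \<le> sum z {i\<in>E. pos i \<le> p}"
      using xy(3)[of "fst pb" "snd pb"] z(3)[of "fst pb"] by (cases pb) (simp, linarith)
  qed (rule assms(4))
qed

text \<open>
  If the sum of \<open>x - y\<close> over the coordinates before \<open>i\<close> is nonnegative, take the first \<open>j\<close> after \<open>i\<close> where
  \<open>x\<close> is smaller than \<open>y\<close>; otherwise take the last such \<open>j\<close> before \<open>i\<close>. In both cases the prefix
  sums affected by the move differ strictly, in the direction in which they are changed.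
\<close>

lemma conformal_move:
  assumes E: "finite E" and inj: "inj_on pos E" and eq: "sum x E = sum y E"
    and i: "i \<in> E" "y i < x i"
  obtains j where "j \<in> E" "x j < y j" "between E pos x y (move i j x)"
proof -
  let ?D = "\<lambda>A. sum x A - sum y A"
  let ?P = "\<lambda>p. {l\<in>E. pos l \<le> p}"
  have D: "?D A = (\<Sum>l\<in>A. x l - y l)" for A by (simp add: sum_subtractf)
  have finish: "between E pos x y (move i j x)"
    if j: "j \<in> E" "x j < y j"
      and px: "\<And>p. pos i \<le> p \<Longrightarrow> p < pos j \<Longrightarrow> sum y (?P p) < sum x (?P p)"
      and py: "\<And>p. pos j \<le> p \<Longrightarrow> p < pos i \<Longrightarrow> sum x (?P p) < sum y (?P p)" for j
    unfolding between_def
  proof (intro conjI allI)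
    have ij: "i \<noteq> j" using i j by auto
    show "between_int (x l) (y l) (move i j x l)" for l
      using i j ij by (auto simp: between_int_def move_def unit_vec_def)
    show "between_int (sum x (?P p)) (sum y (?P p)) (sum (move i j x) (?P p))" for p
    proof -
      have "sum (move i j x) (?P p) = sum x (?P p) - of_bool (pos i \<le> p) + of_bool (pos j \<le> p)"
        using E i j by (simp add: sum_move)
      then show ?thesis using px[of p] py[of p] by (auto simp: between_int_def not_le)
    qed
  qed
  define B where "B = {l\<in>E. pos l < pos i}"
  have finB: "finite B" using E by (simp add: B_def)
  show thesis
  proof (cases "0 \<le> ?D B")
    case True
    define F where "F = {l\<in>E. pos i < pos l \<and> x l < y l}"
    have "F \<noteq> {}"
    proof
      assume "F = {}"
      have split: "E = B \<union> {i} \<union> {l\<in>E. pos i < pos l}"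
        using i inj by (auto simp: B_def inj_on_def) (meson linorder_neqE_nat)
      have "?D E = ?D B + (x i - y i) + ?D {l\<in>E. pos i < pos l}"
        unfolding D by (subst split, subst sum.union_disjoint)
          (use E finB in \<open>auto simp: B_def sum.union_disjoint\<close>)
      moreover have "0 \<le> ?D {l\<in>E. pos i < pos l}"
        unfolding D by (rule sum_nonneg) (use \<open>F = {}\<close> in \<open>auto simp: F_def not_less\<close>)
      ultimately show False using True i eq by simp
    qed
    moreover have "finite F" using E by (simp add: F_def)
    ultimately have "Min (pos ` F) \<in> pos ` F" "\<And>l. l \<in> F \<Longrightarrow> Min (pos ` F) \<le> pos l"
      by simp_all
    then obtain j where j: "j \<in> F" "\<And>l. l \<in> F \<Longrightarrow> pos j \<le> pos l"
      by (metis imageE)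
    have "between E pos x y (move i j x)"
    proof (rule finish)
      show "sum y (?P p) < sum x (?P p)" if p: "pos i \<le> p" "p < pos j" for p
      proof -
        have split: "?P p = B \<union> {i} \<union> {l\<in>E. pos i < pos l \<and> pos l \<le> p}"
          using i inj p by (auto simp: B_def inj_on_def) (meson linorder_neqE_nat)
        have "?D (?P p) = ?D B + (x i - y i) + ?D {l\<in>E. pos i < pos l \<and> pos l \<le> p}"
          unfolding D by (subst split, subst sum.union_disjoint)
            (use E finB in \<open>auto simp: B_def sum.union_disjoint\<close>)
        moreover have "0 \<le> ?D {l\<in>E. pos i < pos l \<and> pos l \<le> p}"
          unfolding D by (rule sum_nonneg) (use j p in \<open>force simp: F_def not_less\<close>)
        ultimately show ?thesis using True i by simp
      qed
    qed (use j in \<open>auto simp: F_def\<close>)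
    then show ?thesis using that[of j] j by (auto simp: F_def)
  next
    case False
    define F where "F = {l\<in>B. x l < y l}"
    have "F \<noteq> {}"
    proof
      assume "F = {}"
      then have "0 \<le> ?D B" unfolding D by (intro sum_nonneg) (auto simp: F_def not_less)
      then show False using False by simp
    qed
    moreover have "finite F" using finB by (simp add: F_def)
    ultimately have "Max (pos ` F) \<in> pos ` F" "\<And>l. l \<in> F \<Longrightarrow> pos l \<le> Max (pos ` F)"
      by simp_all
    then obtain j where j: "j \<in> F" "\<And>l. l \<in> F \<Longrightarrow> pos l \<le> pos j"
      by (metis imageE)
    have "between E pos x y (move i j x)"
    proof (rule finish)
      show "sum x (?P p) < sum y (?P p)" if p: "pos j \<le> p" "p < pos i" for p
      proof -
        have split: "B = ?P p \<union> {l\<in>E. p < pos l \<and> pos l < pos i}"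
          using p by (auto simp: B_def)
        have "?D B = ?D (?P p) + ?D {l\<in>E. p < pos l \<and> pos l < pos i}"
          unfolding D by (subst split, subst sum.union_disjoint) (use E in auto)
        moreover have "0 \<le> ?D {l\<in>E. p < pos l \<and> pos l < pos i}"
          unfolding D by (rule sum_nonneg) (use j p in \<open>force simp: F_def B_def not_less\<close>)
        ultimately show ?thesis using False by simp
      qed
    qed (use j in \<open>auto simp: F_def B_def\<close>)
    then show ?thesis using that[of j] j by (auto simp: F_def B_def)
  qed
qed

definition minkowski_sum :: "nat \<Rightarrow> (nat \<Rightarrow> (nat \<Rightarrow> int) set) \<Rightarrow> (nat \<Rightarrow> int) set" where
  "minkowski_sum N S = {(\<lambda>i. \<Sum>c<N. U c i) | U. \<forall>c<N. U c \<in> S c}"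

lemma sum_move_component:
  assumes "c < (N :: nat)"
  shows "(\<lambda>l. \<Sum>d<N. (U(c := move i j (U c))) d l) = move i j (\<lambda>l. \<Sum>d<N. U d l)"
proof
  fix l
  have "(\<Sum>d\<in>{..<N} - {c}. (U(c := move i j (U c))) d l) = (\<Sum>d\<in>{..<N} - {c}. U d l)"
    by (rule sum.cong) auto
  then show "(\<Sum>d<N. (U(c := move i j (U c))) d l) = move i j (\<lambda>l. \<Sum>d<N. U d l) l"
    using assms by (simp add: sum.remove[of "{..<N}" c] move_def)
qed

lemma move_move: "move i j (move k i x) = move k j x"
  by (auto simp: move_def)

text \<open>
  To exchange \<open>i\<close> between two sums, move in one summand that has an excess at \<open>i\<close>. If the coordinate
  \<open>j\<close> reached there is not one where \<open>y\<close> is larger, another summand has an excess at \<open>j\<close>, so the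
  process continues, always towards the decomposition \<open>V\<close> of \<open>y\<close>; the distance to \<open>V\<close> decreases. As
  the position \<open>W\<close> that is reached stays between \<open>U\<close> and \<open>V\<close> in every summand, the mirrored
  position \<open>U + V - W\<close> is feasible as well and realizes the opposite move of \<open>y\<close>.
\<close>

lemma M_convex_sum_chain_boxes:
  assumes E: "finite E" and inj: "\<And>c. c < N \<Longrightarrow> inj_on (pos c) E"
  shows "M_convex E (minkowski_sum N (\<lambda>c. chain_box E (pos c) (u c) (C c) (d c)))"
proof -
  let ?B = "\<lambda>c. chain_box E (pos c) (u c) (C c) (d c)"
  let ?s = "\<lambda>U l. \<Sum>c<N. U c l :: int"
  let ?M = "minkowski_sum N ?B"
  \<comment> \<open>\<open>W\<close> has been reached from \<open>U\<close> by moving the unit taken from \<open>i\<close> as far as \<open>k\<close>.\<close>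
  define dist where "dist U V = (\<Sum>c<N. \<Sum>l\<in>E. nat \<bar>U c l - V c l\<bar>)" for U V :: "nat \<Rightarrow> nat \<Rightarrow> int"
  have memI: "?s U \<in> ?M" if "\<forall>c<N. U c \<in> ?B c" for U
    unfolding minkowski_sum_def using that by blast
  have key: "\<exists>j\<in>E. x j < y j \<and> (\<exists>W. (\<forall>c<N. between E (pos c) (U c) (V c) (W c) \<and> sum (W c) E = d c) \<and>
      ?s W = move i j x)"
    if "\<forall>c<N. between E (pos c) (U c) (V c) (W c) \<and> sum (W c) E = d c" "\<forall>c<N. V c \<in> ?B c"
      "?s V = y" "?s W = move i k x" "k \<in> E" "i \<in> E" "y i < x i" "y k \<le> x k" for U V W x y i k
    using that
  proof (induction "dist W V" arbitrary: W k rule: less_induct)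
    case less
    note W = less.prems(1) and V = less.prems(2)
    have "?s V k < ?s W k"
      using fun_cong[OF less.prems(3), of k] fun_cong[OF less.prems(4), of k] less.prems(7,8)
      by (cases "i = k") (simp_all add: move_def unit_vec_def)
    then obtain c where c: "c < N" "V c k < W c k"
      by (meson lessThan_iff linorder_not_less sum_mono)
    have eq: "sum (W c) E = sum (V c) E" using W V c by (auto simp: chain_box_def)
    obtain j where j: "j \<in> E" "W c j < V c j" "between E (pos c) (W c) (V c) (move k j (W c))"
      by (rule conformal_move[of E "pos c" "W c" "V c" k, OF E inj[OF c(1)] eq less.prems(5) c(2)])
    let ?W = "W(c := move k j (W c))"
    have W': "\<forall>c<N. between E (pos c) (U c) (V c) (?W c) \<and> sum (?W c) E = d c"
      using W between_trans[OF _ j(3)] c(1) j(1) less.prems(5) E by (auto simp: sum_move)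
    have sums: "?s ?W = move i j x"
      unfolding sum_move_component[OF c(1)] less.prems(4) move_move ..
    show ?case
    proof (cases "x j < y j")
      case True
      then show ?thesis using W' sums j by blast
    next
      case False
      have "dist ?W V < dist W V" unfolding dist_def
      proof (rule sum_strict_mono_ex1)
        have comp: "\<forall>l\<in>E. nat \<bar>move k j (W c) l - V c l\<bar> \<le> nat \<bar>W c l - V c l\<bar>"
          using c j by (auto simp: move_def unit_vec_def)
        have "nat \<bar>move k j (W c) k - V c k\<bar> < nat \<bar>W c k - V c k\<bar>"
          using c j by (cases "j = k") (auto simp: move_def unit_vec_def)
        then have "(\<Sum>l\<in>E. nat \<bar>move k j (W c) l - V c l\<bar>) < (\<Sum>l\<in>E. nat \<bar>W c l - V c l\<bar>)"
          using less.prems(5) comp E by (intro sum_strict_mono_ex1) blast+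
        then show "\<forall>e\<in>{..<N}. (\<Sum>l\<in>E. nat \<bar>?W e l - V e l\<bar>) \<le> (\<Sum>l\<in>E. nat \<bar>W e l - V e l\<bar>)"
          and "\<exists>e\<in>{..<N}. (\<Sum>l\<in>E. nat \<bar>?W e l - V e l\<bar>) < (\<Sum>l\<in>E. nat \<bar>W e l - V e l\<bar>)"
          using c by auto
      qed simp
      then show ?thesis
        using less.hyps[of ?W j] W' V less.prems(3,6,7) sums j(1) False by simp
    qed
  qed
  have ex: "\<exists>j\<in>E. x j < y j \<and> move i j x \<in> ?M \<and> move j i y \<in> ?M"
    if U: "\<forall>c<N. U c \<in> ?B c" "x = ?s U" and V: "\<forall>c<N. V c \<in> ?B c" "y = ?s V"
      and i: "i \<in> E" "y i < x i" for U V x y i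
  proof -
    have "?s U = move i i x" using U(2) by (auto simp: move_def)
    moreover have "\<forall>c<N. between E (pos c) (U c) (V c) (U c) \<and> sum (U c) E = d c"
      using U(1) by (auto simp: between_refl chain_box_def)
    ultimately obtain j W where j: "j \<in> E" "x j < y j"
      and W: "\<forall>c<N. between E (pos c) (U c) (V c) (W c) \<and> sum (W c) E = d c" "?s W = move i j x"
      using key[of U V U y i i x] V i by auto
    let ?Z = "\<lambda>c l. U c l + V c l - W c l"
    have "W c \<in> ?B c" "?Z c \<in> ?B c" if "c < N" for c
    proof -
      have Uc: "U c \<in> ?B c" and Vc: "V c \<in> ?B c" and Wc: "between E (pos c) (U c) (V c) (W c)" "sum (W c) E = d c"
        using U V W that by auto
      show "W c \<in> ?B c" by (rule chain_box_between[OF Uc Vc Wc])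
      have "sum (?Z c) E = d c" using Uc Vc Wc(2) by (simp add: chain_box_def sum_subtractf sum.distrib)
      then show "?Z c \<in> ?B c" by (rule chain_box_between[OF Uc Vc between_reflect[OF Wc(1)]])
    qed
    then have "?s W \<in> ?M" "?s ?Z \<in> ?M" using memI by auto
    moreover have "?s ?Z = move j i y"
    proof
      fix l
      have "?s ?Z l = x l + y l - ?s W l" by (simp add: U V sum_subtractf sum.distrib)
      also have "\<dots> = move j i y l" using fun_cong[OF W(2), of l] by (simp add: move_def)
      finally show "?s ?Z l = move j i y l" .
    qed
    ultimately show ?thesis using j W(2) by auto
  qed
  show ?thesis unfolding M_convex_iff
  proof (intro conjI ballI allI impI)
    fix x i assume "x \<in> ?M" "i \<notin> E"
    then show "x i = 0" by (auto simp: minkowski_sum_def chain_box_def intro!: sum.neutral)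
  next
    fix x y i
    assume "x \<in> ?M" "y \<in> ?M" and i: "i \<in> E" "y i < x i"
    then obtain U V where "\<forall>c<N. U c \<in> ?B c" "x = ?s U" "\<forall>c<N. V c \<in> ?B c" "y = ?s V"
      by (auto simp: minkowski_sum_def)
    then show "\<exists>j\<in>E. x j < y j \<and> move i j x \<in> ?M \<and> move j i y \<in> ?M" using ex i by blast
  qed
qed

lemma M_convex_translate:
  assumes "M_convex E S" and "\<And>i. i \<notin> E \<Longrightarrow> v i = 0"
  shows "M_convex E ((\<lambda>x i. x i + v i) ` S)"
proof -
  have m: "move i j (\<lambda>l. x l + v l) = (\<lambda>l. move i j x l + v l)" for i j x by (auto simp: move_def)
  let ?T = "(\<lambda>x i. x i + v i) ` S"
  have mem: "(\<lambda>l. x l + v l) \<in> ?T" if "x \<in> S" for x using that by blast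
  have "\<exists>j\<in>E. x j + v j < y j + v j \<and> move i j (\<lambda>l. x l + v l) \<in> ?T \<and> move j i (\<lambda>l. y l + v l) \<in> ?T"
    if "x \<in> S" "y \<in> S" "i \<in> E" "y i + v i < x i + v i" for x y i
  proof -
    have "y i < x i" using that(4) by simp
    then obtain j where "j \<in> E" "x j < y j" "move i j x \<in> S" "move j i y \<in> S"
      using assms(1) \<open>x \<in> S\<close> \<open>y \<in> S\<close> \<open>i \<in> E\<close> unfolding M_convex_iff by blast
    then show ?thesis unfolding m using mem by (intro bexI[of _ j]) auto
  qed
  moreover have "\<forall>x\<in>?T. \<forall>i. i \<notin> E \<longrightarrow> x i = 0"
    using assms unfolding M_convex_iff by auto
  ultimately show ?thesis unfolding M_convex_iff by blast
qed

section \<open>Homogenization\<close>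

definition homogenize :: "nat \<Rightarrow> int \<Rightarrow> (nat \<Rightarrow> int) \<Rightarrow> nat \<Rightarrow> int" where
  "homogenize n d x = (\<lambda>i. if i = 0 then d - (\<Sum>j=1..n. x j) else x i)"

lemma keys_sum_single:
  assumes "finite K" "inj_on h K" "\<And>m. m \<in> K \<Longrightarrow> c m \<noteq> 0"
  shows "Poly_Mapping.keys (\<Sum>m\<in>K. Poly_Mapping.single (h m) (c m :: int)) = h ` K"
proof -
  have l: "Poly_Mapping.lookup (\<Sum>m\<in>K. Poly_Mapping.single (h m) (c m)) y =
      (\<Sum>m\<in>K. if h m = y then c m else 0)" for y
    by (simp add: lookup_sum lookup_single when_def)
  have "(\<Sum>m\<in>K. if h m = y then c m else 0) \<noteq> 0 \<longleftrightarrow> y \<in> h ` K" for y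
  proof
    assume "(\<Sum>m\<in>K. if h m = y then c m else 0) \<noteq> 0"
    then obtain m where "m \<in> K" "(if h m = y then c m else 0) \<noteq> 0"
      by (rule sum.not_neutral_contains_not_neutral)
    then show "y \<in> h ` K" by (auto split: if_splits)
  next
    assume "y \<in> h ` K"
    then obtain m0 where m0: "m0 \<in> K" "y = h m0" by blast
    have "(\<Sum>m\<in>K. if h m = y then c m else 0) = (\<Sum>m\<in>K. if m = m0 then c m else 0)"
      by (rule sum.cong) (use m0 assms(2) in \<open>auto dest: inj_onD\<close>)
    then show "(\<Sum>m\<in>K. if h m = y then c m else 0) \<noteq> 0" using assms(1,3) m0 by simp
  qed
  then show ?thesis unfolding set_eq_iff in_keys_iff l by blast
qed

lemma support_hom_component: "support (hom_component k f) = exp_vec ` {m \<in> Poly_Mapping.keys f. mdeg m = k}"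
proof -
  have "Poly_Mapping.keys (hom_component k f) = (\<lambda>m. m) ` {m \<in> Poly_Mapping.keys f. mdeg m = k}"
    unfolding hom_component_def by (rule keys_sum_single) (simp_all add: in_keys_iff)
  then show ?thesis by (simp add: support_eq_image)
qed

text \<open>
  Without the variable of index \<open>0\<close>, distinct monomials stay distinct when their degree is filled up.
\<close>

lemma support_sum_hom_component:
  assumes z: "\<And>m. m \<in> Poly_Mapping.keys f \<Longrightarrow> Poly_Mapping.lookup m 0 = 0"
    and deg: "\<And>m. m \<in> Poly_Mapping.keys f \<Longrightarrow> a \<le> mdeg m \<and> mdeg m \<le> d"
  shows "support (\<Sum>k=a..d. hom_component k f * X 0 ^ (d - k)) =
    (\<lambda>m i. if i = 0 then int d - int (mdeg m) else exp_vec m i) ` Poly_Mapping.keys f"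
proof -
  let ?K = "Poly_Mapping.keys f"
  define h where "h m = m + Poly_Mapping.single 0 (d - mdeg m)" for m
  have "hom_component k f * X 0 ^ (d - k) =
      (\<Sum>m\<in>{m\<in>?K. mdeg m = k}. Poly_Mapping.single (h m) (Poly_Mapping.lookup f m))" for k
    unfolding hom_component_def sum_distrib_right h_def
    by (rule sum.cong) (auto simp: mult_single simp flip: monom_times_X)
  then have "(\<Sum>k=a..d. hom_component k f * X 0 ^ (d - k)) =
      (\<Sum>k=a..d. \<Sum>m\<in>{m\<in>?K. mdeg m = k}. Poly_Mapping.single (h m) (Poly_Mapping.lookup f m))"
    by simp
  also have "\<dots> = (\<Sum>m\<in>?K. Poly_Mapping.single (h m) (Poly_Mapping.lookup f m))"
    by (rule sum.group) (use deg in auto)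
  finally have eq: "(\<Sum>k=a..d. hom_component k f * X 0 ^ (d - k)) =
      (\<Sum>m\<in>?K. Poly_Mapping.single (h m) (Poly_Mapping.lookup f m))" .
  have ev: "exp_vec (h m) = (\<lambda>i. if i = 0 then int d - int (mdeg m) else exp_vec m i)" if "m \<in> ?K" for m
    using z[OF that] deg[OF that]
    by (auto simp: h_def exp_vec_def lookup_add lookup_single when_def fun_eq_iff)
  have "inj_on h ?K"
  proof (rule inj_onI)
    fix m m' assume m: "m \<in> ?K" "m' \<in> ?K" "h m = h m'"
    have "Poly_Mapping.lookup m i = Poly_Mapping.lookup m' i" for i
    proof (cases "i = 0")
      case True
      then show ?thesis using z m by simp
    next
      case False
      then show ?thesis using fun_cong[OF arg_cong[OF m(3), of exp_vec], of i]
        by (simp add: h_def exp_vec_def lookup_add lookup_single when_def)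
    qed
    then show "m = m'" by (rule poly_mapping_eqI)
  qed
  then have "Poly_Mapping.keys (\<Sum>m\<in>?K. Poly_Mapping.single (h m) (Poly_Mapping.lookup f m)) = h ` ?K"
    by (intro keys_sum_single) (auto simp: in_keys_iff[symmetric])
  then show ?thesis unfolding eq support_eq_image using ev by (auto simp: image_image)
qed

section \<open>Homogenized column sets are chain-constrained boxes\<close>

text \<open>
  The homogenizing variable takes its place between \<open>\<phi> r\<close> and \<open>\<phi> r + 1\<close>. There it counts for the upper bounds
  on large elements from row \<open>r\<close> on, turning them into lower bounds on prefixes, but does not
  disturb the lower bounds belonging to the rows before \<open>r\<close>.
\<close>

definition column_pos :: "(nat \<Rightarrow> nat) \<Rightarrow> nat \<Rightarrow> nat \<Rightarrow> nat" where
  "column_pos \<phi> r i = (if i = 0 then Suc (2 * \<phi> r) else 2 * i)"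

definition column_constraints :: "(nat \<Rightarrow> nat) \<Rightarrow> nat \<Rightarrow> nat \<Rightarrow> nat \<Rightarrow> (nat \<times> int) set" where
  "column_constraints \<phi> n l r =
     (\<lambda>q. (2 * \<phi> q, int q)) ` {..<r} \<union> (\<lambda>q. (Suc (2 * \<phi> q), int (n + q))) ` {r..l}"

lemma inj_column_pos: "inj_on (column_pos \<phi> r) E"
  by (auto simp: inj_on_def column_pos_def) presburger+

text \<open>
  The coordinate \<open>0\<close> is \<open>l + n\<close> minus the number of elements. Its upper bound \<open>n\<close> states that
  there are at least \<open>l\<close> elements, and from that the lower bounds for the rows from \<open>r\<close> on follow from
  the upper ones.
\<close>

lemma chain_box_column_sets:
  assumes mono: "\<And>q q'. q \<le> q' \<Longrightarrow> q' \<le> l \<Longrightarrow> \<phi> q \<le> \<phi> q'" and n: "\<phi> l \<le> n" and r: "r \<le> l"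
  shows "chain_box {0..n} (column_pos \<phi> r) (\<lambda>i. if i = 0 then int n else 1)
      (column_constraints \<phi> n l r) (int (l + n)) =
    (\<lambda>I. homogenize n (int (l + n)) (\<lambda>i. of_bool (i \<in> I))) ` column_sets \<phi> l r"
    (is "?B = ?h ` ?K")
proof -
  have before: "{i\<in>{0..n}. column_pos \<phi> r i \<le> 2 * \<phi> q} = {1..\<phi> q}" if "q \<in> {..<r}" for q
    using that mono[of q r] mono[of q l] n r by (auto simp: column_pos_def)
  have after: "{i\<in>{0..n}. column_pos \<phi> r i \<le> Suc (2 * \<phi> q)} = insert 0 {1..\<phi> q}" if "q \<in> {r..l}" for q
    using that mono[of r q] mono[of q l] n by (auto simp: column_pos_def)
  have E: "{0..n} = insert 0 {1..n}" by auto
  have count: "(\<Sum>i=1..a. of_bool (i \<in> I)) = int (low I a)" if "0 \<notin> I" for I a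
  proof -
    have "{1..a} \<inter> I = I \<inter> {..a}" using that by (auto simp: Suc_le_eq intro: Nat.gr0I)
    then show ?thesis by (simp add: low_def sum_of_bool_eq Int_def[symmetric] Collect_mem_eq)
  qed
  have char: "x \<in> ?B \<longleftrightarrow> (\<forall>i. i \<notin> {0..n} \<longrightarrow> x i = 0) \<and> 0 \<le> x 0 \<and> x 0 \<le> int n \<and>
      (\<forall>i\<in>{1..n}. 0 \<le> x i \<and> x i \<le> 1) \<and> x 0 + (\<Sum>i=1..n. x i) = int (l + n) \<and>
      (\<forall>q<r. int q \<le> (\<Sum>i=1..\<phi> q. x i)) \<and>
      (\<forall>q. r \<le> q \<and> q \<le> l \<longrightarrow> int (n + q) \<le> x 0 + (\<Sum>i=1..\<phi> q. x i))" for x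
  proof -
    have "(\<forall>(p, b)\<in>column_constraints \<phi> n l r. b \<le> sum x {i\<in>{0..n}. column_pos \<phi> r i \<le> p}) \<longleftrightarrow>
        (\<forall>q\<in>{..<r}. int q \<le> sum x {1..\<phi> q}) \<and> (\<forall>q\<in>{r..l}. int (n + q) \<le> sum x (insert 0 {1..\<phi> q}))"
      unfolding column_constraints_def ball_Un ball_simps prod.case
      by (simp only: before after cong: ball_cong)
    then show ?thesis unfolding chain_box_def mem_Collect_eq by (auto simp: E)
  qed
  have hK: "?h I \<in> ?B" if I: "I \<in> ?K" for I
  proof -
    note ID = column_setsD[OF I]
    have sub: "I \<subseteq> {..n}" using column_sets_bounded[OF I r] n by auto
    then have In: "low I n = card I" by (rule low_full)
    have cn: "card I \<le> n"
      using card_mono[of "{1..n}" I] sub ID(2) by (auto simp: subset_iff Suc_le_eq intro: Nat.gr0I)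
    have s: "(\<Sum>i=1..a. ?h I i) = int (low I a)" for a
    proof -
      have "(\<Sum>i=1..a. ?h I i) = (\<Sum>i=1..a. of_bool (i \<in> I))"
        by (rule sum.cong) (auto simp: homogenize_def)
      then show ?thesis using count ID(2) by simp
    qed
    have h0: "?h I 0 = int (l + n) - int (card I)"
      using count[OF ID(2), of n] In by (simp add: homogenize_def)
    show ?thesis unfolding char s h0
    proof (intro conjI allI impI ballI)
      show "?h I i = 0" if "i \<notin> {0..n}" for i using that sub by (auto simp: homogenize_def)
      show "int (n + q) \<le> int (l + n) - int (card I) + int (low I (\<phi> q))" if "r \<le> q \<and> q \<le> l" for q
        using ID(4)[of q] low_plus_high[OF ID(1), of "\<phi> q"] that by linarith
    qed (use ID cn In r in \<open>auto simp: homogenize_def\<close>)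
  qed
  moreover have "x \<in> ?h ` ?K" if x: "x \<in> ?B" for x
  proof -
    note xB = x[unfolded char]
    define I where "I = {i\<in>{1..n}. x i = 1}"
    have fin: "finite I" "0 \<notin> I" "I \<subseteq> {..n}" by (auto simp: I_def)
    have xi: "x i = of_bool (i \<in> I)" if "i \<noteq> 0" for i
    proof (cases "i \<in> {1..n}")
      case True
      then have "0 \<le> x i \<and> x i \<le> 1" using xB by blast
      then have "x i = 0 \<or> x i = 1" by linarith
      then show ?thesis using True by (auto simp: I_def)
    next
      case False
      then have "i \<notin> {0..n}" "i \<notin> I" using that by (auto simp: I_def)
      then show ?thesis using xB by simp
    qed
    have s: "(\<Sum>i=1..a. x i) = int (low I a)" for a
    proof -
      have "(\<Sum>i=1..a. x i) = (\<Sum>i=1..a. of_bool (i \<in> I))" by (rule sum.cong) (auto simp: xi)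
      then show ?thesis using count fin by simp
    qed
    have x0: "x 0 = int (l + n) - int (card I)" using xB s[of n] low_full[OF fin(3)] by simp
    have cl: "l \<le> card I" using xB x0 by simp
    have up: "high I (\<phi> q) \<le> l - q" if "r \<le> q" "q \<le> l" for q
    proof -
      have "int (n + q) \<le> x 0 + int (low I (\<phi> q))" using xB s that by simp
      then show ?thesis using x0 low_plus_high[OF fin(1), of "\<phi> q"] by linarith
    qed
    have "q \<le> low I (\<phi> q)" if "q \<le> l" for q
    proof (cases "q < r")
      case True
      then show ?thesis using xB s by simp
    next
      case False
      then show ?thesis using up[of q] that cl low_plus_high[OF fin(1), of "\<phi> q"] by simp
    qed
    then have "I \<in> ?K" using fin up by (intro column_setsI) auto
    moreover have "x = ?h I"
    proof
      fix i
      show "x i = ?h I i"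
        using x0 xi count[OF fin(2), of n] low_full[OF fin(3)] by (simp add: homogenize_def)
    qed
    ultimately show ?thesis by blast
  qed
  ultimately show ?thesis by blast
qed

lemma homogenize_column_sum:
  "homogenize n (\<Sum>c<N. D c) (column_sum N I) = (\<lambda>i. \<Sum>c<N. homogenize n (D c) (\<lambda>i. of_bool (i \<in> I c)) i)"
proof
  fix i
  have "(\<Sum>j=1..n. column_sum N I j) = (\<Sum>c<N. \<Sum>j=1..n. of_bool (j \<in> I c))"
    unfolding column_sum_def by (rule sum.swap)
  then show "homogenize n (\<Sum>c<N. D c) (column_sum N I) i =
      (\<Sum>c<N. homogenize n (D c) (\<lambda>i. of_bool (i \<in> I c)) i)"
    by (cases "i = 0") (simp_all add: homogenize_def sum_subtractf column_sum_def del: sum_of_bool_eq)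
qed

text \<open>
  Homogenizing each column separately gives a Minkowski sum of chain-constrained boxes for the
  degree \<open>\<Sum> (l c + n)\<close>; another degree only translates the coordinate \<open>0\<close>.
\<close>

lemma M_convex_homogenized_filling_weights:
  assumes mono: "\<And>q q'. q \<le> q' \<Longrightarrow> q' \<le> n \<Longrightarrow> \<phi> q \<le> \<phi> q'" and \<phi>n: "\<phi> n \<le> n"
    and ln: "\<And>c. c < N \<Longrightarrow> l c \<le> n"
    and sorted: "\<And>c c'. c \<le> c' \<Longrightarrow> c' < N \<Longrightarrow> l c \<le> l c'"
  shows "M_convex {0..n} (homogenize n d ` filling_weights \<phi> N l)"
proof -
  obtain g where g: "g \<in> assignments N l" "filling_weights \<phi> N l = column_sum N ` fillings \<phi> N l g"
    by (rule filling_weights_dominant_assignment[of n \<phi> N l]) (use mono ln sorted in blast)+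
  let ?D = "\<lambda>c. int (l c + n)" and ?T = "\<Sum>c<N. int (l c + n)"
  let ?B = "\<lambda>c. chain_box {0..n} (column_pos \<phi> (g c)) (\<lambda>i. if i = 0 then int n else 1)
      (column_constraints \<phi> n (l c) (g c)) (?D c)"
  let ?h = "\<lambda>c I. homogenize n (?D c) (\<lambda>i. of_bool (i \<in> I))"
  have B: "?B c = ?h c ` column_sets \<phi> (l c) (g c)" if "c < N" for c
  proof (rule chain_box_column_sets)
    show "\<phi> q \<le> \<phi> q'" if "q \<le> q'" "q' \<le> l c" for q q'
      using mono[OF that(1)] that(2) ln[OF \<open>c < N\<close>] by simp
    show "\<phi> (l c) \<le> n" using mono[of "l c" n] ln[OF that] \<phi>n by simp
    show "g c \<le> l c" using g(1) that by (simp add: assignments_def)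
  qed
  have "minkowski_sum N ?B = homogenize n ?T ` filling_weights \<phi> N l"
  proof
    show "minkowski_sum N ?B \<subseteq> homogenize n ?T ` filling_weights \<phi> N l"
    proof
      fix x assume "x \<in> minkowski_sum N ?B"
      then obtain U where U: "x = (\<lambda>i. \<Sum>c<N. U c i)" "\<forall>c<N. U c \<in> ?B c"
        by (auto simp: minkowski_sum_def)
      then have "\<forall>c<N. \<exists>I. I \<in> column_sets \<phi> (l c) (g c) \<and> U c = ?h c I" using B by blast
      then obtain I where I: "\<forall>c<N. I c \<in> column_sets \<phi> (l c) (g c) \<and> U c = ?h c (I c)" by metis
      then have "x = homogenize n ?T (column_sum N I)"
        unfolding homogenize_column_sum U(1) by (intro ext sum.cong) auto
      moreover have "I \<in> fillings \<phi> N l g" using I by (auto simp: fillings_def)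
      ultimately show "x \<in> homogenize n ?T ` filling_weights \<phi> N l" using g(2) by blast
    qed
    show "homogenize n ?T ` filling_weights \<phi> N l \<subseteq> minkowski_sum N ?B"
    proof
      fix x assume "x \<in> homogenize n ?T ` filling_weights \<phi> N l"
      then obtain I where I: "I \<in> fillings \<phi> N l g" "x = homogenize n ?T (column_sum N I)" using g(2) by auto
      have "\<forall>c<N. ?h c (I c) \<in> ?B c" using I(1) B by (auto simp: fillings_def)
      moreover have "x = (\<lambda>i. \<Sum>c<N. ?h c (I c) i)" unfolding I(2) homogenize_column_sum ..
      ultimately show "x \<in> minkowski_sum N ?B"
        unfolding minkowski_sum_def by (intro CollectI exI[of _ "\<lambda>c. ?h c (I c)"]) auto
    qed
  qed
  then have "M_convex {0..n} (homogenize n ?T ` filling_weights \<phi> N l)"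
    using M_convex_sum_chain_boxes[of "{0..n}" N "\<lambda>c. column_pos \<phi> (g c)" "\<lambda>c i. if i = 0 then int n else 1"
      "\<lambda>c. column_constraints \<phi> n (l c) (g c)" ?D] inj_column_pos by simp
  then have "M_convex {0..n} ((\<lambda>x i. x i + (if i = 0 then d - ?T else 0)) ` homogenize n ?T ` filling_weights \<phi> N l)"
    by (rule M_convex_translate) auto
  moreover have "(\<lambda>x i. x i + (if i = 0 then d - ?T else 0)) ` homogenize n ?T ` filling_weights \<phi> N l =
      homogenize n d ` filling_weights \<phi> N l"
    unfolding image_image by (intro image_cong refl ext) (simp add: homogenize_def)
  ultimately show ?thesis by simp
qed

text \<open>
  Two homogenized points of equal degree agree in the coordinate \<open>0\<close>, which therefore never takes part in
  an exchange.
\<close>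

lemma M_convex_slice:
  assumes M: "M_convex {0..n} (homogenize n d ` S)"
    and S: "\<And>x i. x \<in> S \<Longrightarrow> i \<notin> {1..n} \<Longrightarrow> x i = 0"
  shows "M_convex {1..n} {x\<in>S. (\<Sum>j=1..n. x j) = k}"
  unfolding M_convex_iff
proof (intro conjI ballI impI allI)
  fix x i assume "x \<in> {x\<in>S. (\<Sum>j=1..n. x j) = k}" "i \<notin> {1..n}"
  then show "x i = 0" using S by blast
next
  fix x y i
  assume xk: "x \<in> {x\<in>S. (\<Sum>j=1..n. x j) = k}" and yk: "y \<in> {x\<in>S. (\<Sum>j=1..n. x j) = k}"
    and i: "i \<in> {1..n}" "y i < x i"
  then have "homogenize n d y i < homogenize n d x i" "i \<in> {0..n}" by (auto simp: homogenize_def)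
  then obtain j where j: "j \<in> {0..n}" "homogenize n d x j < homogenize n d y j"
    "move i j (homogenize n d x) \<in> homogenize n d ` S" "move j i (homogenize n d y) \<in> homogenize n d ` S"
    using M xk yk unfolding M_convex_iff by blast
  have j0: "j \<noteq> 0"
  proof
    assume "j = 0"
    then show False using j(2) xk yk by (simp add: homogenize_def)
  qed
  have dehomogenize: "move p q x \<in> {x\<in>S. (\<Sum>j=1..n. x j) = k}"
    if A: "move p q (homogenize n d x) \<in> homogenize n d ` S" "x \<in> S" "(\<Sum>j=1..n. x j) = k"
      "p \<in> {1..n}" "q \<in> {1..n}" for p q x
  proof -
    obtain z where z: "z \<in> S" "move p q (homogenize n d x) = homogenize n d z" using A(1) by blast
    have "z l = move p q x l" for l
    proof (cases "l = 0")
      case True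
      then show ?thesis using S[OF z(1), of 0] S[OF A(2), of 0] A(4,5) by (auto simp: move_def unit_vec_def)
    next
      case False
      then show ?thesis using fun_cong[OF z(2), of l] by (simp add: homogenize_def move_def)
    qed
    then have "move p q x \<in> S" using z(1) by (metis ext)
    then show ?thesis using A(3-5) by (simp add: sum_move)
  qed
  have jn: "j \<in> {1..n}" using j(1) j0 by simp
  have "x j < y j" using j(2) j0 by (simp add: homogenize_def)
  moreover have "move i j x \<in> {x\<in>S. (\<Sum>j=1..n. x j) = k}" using dehomogenize[OF j(3)] xk i(1) jn by blast
  moreover have "move j i y \<in> {x\<in>S. (\<Sum>j=1..n. x j) = k}" using dehomogenize[OF j(4)] yk i(1) jn by blast
  ultimately show "\<exists>j\<in>{1..n}. x j < y j \<and> move i j x \<in> {x\<in>S. (\<Sum>j=1..n. x j) = k} \<and>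
      move j i y \<in> {x\<in>S. (\<Sum>j=1..n. x j) = k}"
    using jn by blast
qed

section \<open>Conjugate partitions\<close>

text \<open>
  The columns are listed from right to left, which makes their lengths increase.
\<close>

lemma conjugate_partition:
  fixes \<mu> :: "nat \<Rightarrow> nat"
  assumes anti: "\<And>p q. 1 \<le> p \<Longrightarrow> p \<le> q \<Longrightarrow> q \<le> n \<Longrightarrow> \<mu> q \<le> \<mu> p"
  shows "\<exists>(N :: nat) l. (\<forall>c<N. l c \<le> n) \<and> (\<forall>c c'. c \<le> c' \<and> c' < N \<longrightarrow> l c \<le> l c') \<and>
    (\<forall>i. 1 \<le> i \<and> i \<le> n \<longrightarrow> \<mu> i = card {c. c < N \<and> i \<le> l c}) \<and> (\<Sum>c<N. l c) = (\<Sum>i=1..n. \<mu> i)"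
proof -
  define N where "N = \<mu> 1"
  define l where "l c = card {j\<in>{1..n}. N - c \<le> \<mu> j}" for c
  have ln: "l c \<le> n" for c
  proof -
    have "l c \<le> card {1..n}" unfolding l_def by (rule card_mono) auto
    then show ?thesis by simp
  qed
  have iff: "i \<le> l c \<longleftrightarrow> N - c \<le> \<mu> i" if i: "1 \<le> i" "i \<le> n" for i c
  proof
    assume "N - c \<le> \<mu> i"
    then have "{1..i} \<subseteq> {j\<in>{1..n}. N - c \<le> \<mu> j}" using anti i by (auto intro: order_trans)
    then have "card {1..i} \<le> l c" unfolding l_def by (intro card_mono) auto
    then show "i \<le> l c" by simp
  next
    assume le: "i \<le> l c"
    show "N - c \<le> \<mu> i"
    proof (rule ccontr)
      assume not: "\<not> N - c \<le> \<mu> i"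
      have "{j\<in>{1..n}. N - c \<le> \<mu> j} \<subseteq> {1..<i}"
      proof
        fix j assume j: "j \<in> {j\<in>{1..n}. N - c \<le> \<mu> j}"
        have "\<not> i \<le> j" using anti[of i j] i j not by auto
        then show "j \<in> {1..<i}" using j by simp
      qed
      then have "l c \<le> card {1..<i}" unfolding l_def by (intro card_mono) auto
      then show False using le i by simp
    qed
  qed
  have \<mu>: "\<mu> i = card {c. c < N \<and> i \<le> l c}" if i: "1 \<le> i" "i \<le> n" for i
  proof -
    have "\<mu> i \<le> N" using anti[of 1 i] i by (simp add: N_def)
    moreover have "{c. c < N \<and> i \<le> l c} = {N - \<mu> i..<N}" unfolding iff[OF i] by auto
    ultimately show ?thesis by simp
  qed
  have "(\<Sum>c<N. l c) = (\<Sum>c<N. \<Sum>i=1..n. of_bool (i \<le> l c))"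
  proof (rule sum.cong[OF refl])
    fix c
    have "{1..n} \<inter> {i. i \<le> l c} = {1..l c}" using ln[of c] by auto
    then show "l c = (\<Sum>i=1..n. of_bool (i \<le> l c))" by (simp add: sum_of_bool_eq)
  qed
  also have "\<dots> = (\<Sum>i=1..n. \<Sum>c<N. of_bool (i \<le> l c))" by (rule sum.swap)
  also have "\<dots> = (\<Sum>i=1..n. \<mu> i)"
  proof (rule sum.cong[OF refl])
    fix i assume "i \<in> {1..n}"
    moreover have "{..<N} \<inter> {c. i \<le> l c} = {c. c < N \<and> i \<le> l c}" by auto
    ultimately show "(\<Sum>c<N. of_bool (i \<le> l c)) = \<mu> i" using \<mu>[of i] by (simp add: sum_of_bool_eq)
  qed
  finally have "(\<Sum>c<N. l c) = (\<Sum>i=1..n. \<mu> i)" .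
  moreover have "l c \<le> l c'" if "c \<le> c'" for c c'
    unfolding l_def by (rule card_mono) (use that in auto)
  ultimately show ?thesis using ln \<mu> by (intro exI[of _ N] exI[of _ l]) blast
qed

section \<open>M-convexity of vexillary Grothendieck polynomials\<close>

theorem theorem1p3:
  fixes n :: nat and w :: "nat \<Rightarrow> nat"
  assumes "w permutes {1..n}"
    and "vexillary n w"
  shows "M_convex {0..n} (support (hom_grothendieck n w)) \<and>
         (\<forall>k. M_convex {1..n} (support (hom_component k (grothendieck n w))))"
proof -
  define G where "G = grothendieck n w"
  obtain \<mu> \<phi>' where \<phi>': "\<And>p. 1 \<le> p \<Longrightarrow> p \<le> n \<Longrightarrow> p \<le> \<phi>' p \<and> \<phi>' p \<le> n"
    and mono': "\<And>p q. 1 \<le> p \<Longrightarrow> p \<le> q \<Longrightarrow> q \<le> n \<Longrightarrow> \<phi>' p \<le> \<phi>' q \<and> \<mu> q \<le> \<mu> p"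
    and size: "(\<Sum>p=1..n. \<mu> p) = inv_count n w" and G': "G = flagged \<mu> \<phi>' n 1"
    using vexillary_grothendieck_flagged[OF assms] unfolding G_def by metis
  \<comment> \<open>The flag of the fictitious row \<open>0\<close> expresses that a column has no multiple box.\<close>
  define \<phi> where "\<phi> = \<phi>'(0 := 0)"
  have G: "G = flagged \<mu> \<phi> n 1" unfolding G' by (rule flagged_cong) (auto simp: \<phi>_def)
  have mono: "\<phi> q \<le> \<phi> q'" if "q \<le> q'" "q' \<le> n" for q q'
    using mono'[of q q'] that by (auto simp: \<phi>_def)
  have ge: "q \<le> \<phi> q" if "q \<le> n" for q using \<phi>'[of q] that by (auto simp: \<phi>_def)
  have \<phi>n: "\<phi> n \<le> n" using \<phi>'[of n] by (auto simp: \<phi>_def)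
  have "\<mu> q \<le> \<mu> p" if "1 \<le> p" "p \<le> q" "q \<le> n" for p q using mono'[OF that] by simp
  then obtain N :: nat and l where l: "\<And>c. c < N \<Longrightarrow> l c \<le> n" "\<And>c c'. c \<le> c' \<Longrightarrow> c' < N \<Longrightarrow> l c \<le> l c'"
    "\<And>i. 1 \<le> i \<Longrightarrow> i \<le> n \<Longrightarrow> \<mu> i = card {c. c < N \<and> i \<le> l c}" "(\<Sum>c<N. l c) = (\<Sum>i=1..n. \<mu> i)"
    using conjugate_partition[of n \<mu>] by blast
  let ?S = "filling_weights \<phi> N l"
  have "alternating_with_support (\<Sum>c<N. l c) G ?S"
    unfolding G by (rule flagged_alternating_support) (use mono ge l in \<open>auto simp: \<phi>_def\<close>)
  then have S: "exp_vec ` Poly_Mapping.keys G = ?S"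
    by (simp add: alternating_with_support_def support_eq_image)
  have S_zero: "x i = 0" if x: "x \<in> ?S" and i: "i \<notin> {1..n}" for x i
  proof -
    obtain r I where I: "r \<in> assignments N l" "I \<in> fillings \<phi> N l r" "x = column_sum N I"
      using x by (rule filling_weightsE)
    have "i \<notin> I c" if c: "c < N" for c
    proof -
      have Ic: "I c \<in> column_sets \<phi> (l c) (r c)" "r c \<le> l c"
        using I c by (auto simp: fillings_def assignments_def)
      have "\<phi> (l c) \<le> n" using mono[of "l c" n] l(1)[OF c] \<phi>n by simp
      then have "I c \<subseteq> {1..n}"
        using column_sets_bounded[OF Ic] column_setsD(2)[OF Ic(1)] by (fastforce simp: Suc_le_eq intro: Nat.gr0I)
      then show ?thesis using i by blast
    qed
    then show ?thesis unfolding I(3) column_sum_def by (intro sum.neutral) auto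
  qed
  have S_size: "int (inv_count n w) \<le> (\<Sum>j=1..n. x j)" if x: "x \<in> ?S" for x
  proof -
    obtain r I where I: "r \<in> assignments N l" "I \<in> fillings \<phi> N l r" "x = column_sum N I"
      using x by (rule filling_weightsE)
    have "int (l c) \<le> (\<Sum>j=1..n. of_bool (j \<in> I c))" if c: "c < N" for c
    proof -
      have Ic: "I c \<in> column_sets \<phi> (l c) (r c)" "r c \<le> l c"
        using I c by (auto simp: fillings_def assignments_def)
      have "\<phi> (l c) \<le> n" using mono[of "l c" n] l(1)[OF c] \<phi>n by simp
      then have "{1..n} \<inter> I c = I c"
        using column_sets_bounded[OF Ic] column_setsD(2)[OF Ic(1)] by (fastforce simp: Suc_le_eq intro: Nat.gr0I)
      then have "(\<Sum>j=1..n. of_bool (j \<in> I c)) = int (card (I c))" by (simp add: sum_of_bool_eq)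
      then show ?thesis using column_setsD(5)[OF Ic(1)] by simp
    qed
    then have "(\<Sum>c<N. int (l c)) \<le> (\<Sum>c<N. \<Sum>j=1..n. of_bool (j \<in> I c))" by (intro sum_mono) auto
    also have "\<dots> = (\<Sum>j=1..n. x j)" unfolding I(3) column_sum_def by (rule sum.swap)
    finally show ?thesis using l(4) size by (simp flip: of_nat_sum)
  qed
  have zero: "Poly_Mapping.lookup m i = 0" if "m \<in> Poly_Mapping.keys G" "i \<notin> {1..n}" for m i
    using S_zero[of "exp_vec m" i] S that by (force simp: exp_vec_def)
  have mdeg: "int (mdeg m) = (\<Sum>j=1..n. exp_vec m j)" if "m \<in> Poly_Mapping.keys G" for m
  proof -
    have "Poly_Mapping.keys m \<subseteq> {1..n}" using zero[OF that] by (meson in_keys_iff subsetI)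
    then show ?thesis by (simp add: mdeg_eq_sum[of "{1..n}"] exp_vec_def)
  qed
  define d where "d = total_degree G"
  have deg: "inv_count n w \<le> mdeg m \<and> mdeg m \<le> d" if m: "m \<in> Poly_Mapping.keys G" for m
  proof
    have "exp_vec m \<in> ?S" using S m by blast
    then show "inv_count n w \<le> mdeg m" using S_size[of "exp_vec m"] mdeg[OF m] by simp
    show "mdeg m \<le> d" unfolding d_def total_degree_def using m by (intro Max_ge) auto
  qed
  have "support (hom_grothendieck n w) =
      (\<lambda>m i. if i = 0 then int d - int (mdeg m) else exp_vec m i) ` Poly_Mapping.keys G"
    unfolding hom_grothendieck_def Let_def G_def[symmetric] d_def[symmetric]
    by (rule support_sum_hom_component) (use zero deg in auto)
  also have "\<dots> = homogenize n (int d) ` ?S"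
    unfolding S[symmetric] image_image by (rule image_cong) (auto simp: homogenize_def mdeg)
  finally have H: "support (hom_grothendieck n w) = homogenize n (int d) ` ?S" .
  have M: "M_convex {0..n} (homogenize n (int d) ` ?S)"
    by (rule M_convex_homogenized_filling_weights) (use mono \<phi>n l in auto)
  have "support (hom_component k G) = {x\<in>?S. (\<Sum>j=1..n. x j) = int k}" for k
    unfolding support_hom_component S[symmetric] using mdeg by force
  moreover have "M_convex {1..n} {x\<in>?S. (\<Sum>j=1..n. x j) = int k}" for k
    by (rule M_convex_slice[OF M]) (rule S_zero)
  ultimately have "M_convex {1..n} (support (hom_component k G))" for k by simp
  then show ?thesis using M H by (simp add: G_def)
qed

end
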